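(* Let $(\Sigma,\xi)$ be a contact $3$-orbifold. For $x\in\Sigma$ let $G_x$ denote the isotropy group at $x$. Then: (1) the Cartan prolongation $\mathbb{P}(\Sigma,\xi)$ is a manifold if and only if $(\Sigma,\xi)$ is positive and $|G_x|$ is odd for all $x\in\Sigma$; (2) the oriented Cartan prolongation $\mathbb{S}(\Sigma,\xi)$ is a manifold if and only if $(\Sigma,\xi)$ is positive.
   Context: A Lie groupoid $\mathcal{G}$ is a groupoid whose sets of objects $\mathcal{G}_0$ and arrows $\mathcal{G}_1$ are manifolds, whose structure maps (source $s$, target $t$, identities, inversion, composition) are smooth, and whose source map is a submersion. It is étale if $s$ is a local diffeomorphism, and proper if $s\times t:\mathcal{G}_1\to\mathcal{G}_0\times\mathcal{G}_0$ is a proper map. An orbifold is a proper étale Lie groupoid. The isotropy group at an object $x$ is the group $G_x$ of arrows $x\to x$. Near each object $x$ an orbifold is isomorphic to the action groupoid $G_x\ltimes V$ of the finite group $G_x$ acting on a neighbourhood $V$ of $x$; such a $V$ with its $G_x$-action is called an orbifold chart. A contact structure on a $3$-manifold is a rank $2$ distribution $\xi$ such that $\alpha\wedge d\alpha$ vanishes nowhere for any local $1$-form $\alpha$ with $\xi=\operatorname{Ker}\alpha$. A contact structure $\xi$ on a $3$-dimensional orbifold $\Sigma$ is a family of contact structures, one on each chart, such that all local group actions preserve the contact structures and all transition maps are contactomorphisms (equivalently, $\Sigma$ is a proper étale Lie groupoid whose object and arrow manifolds are contact manifolds and whose structure maps are local contactomorphisms, i.e. local diffeomorphisms whose differentials map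 contact structure into contact structure). The pair $(\Sigma,\xi)$ is then called a contact $3$-orbifold. $(\Sigma,\xi)$ is positive if for every $x\in\Sigma$ the linear action of $G_x$ on the plane $\xi_x$ (by differentials, in a chart around $x$) preserves the orientation of $\xi_x$. For a contact $3$-manifold $(V,\xi)$, let $\mathbb{P}(\xi)=\coprod_{v\in V}\mathbb{P}(\xi_v)$ be the bundle of $1$-dimensional linear subspaces of the planes $\xi_v$, and let $\mathbb{S}(\xi)=\coprod_{v\in V}(\xi_v\setminus\{0\})/\mathbb{R}_{>0}$ be the bundle of rays. An Engel structure on a $4$-manifold is a rank $2$ distribution $\mathcal{D}$ such that $\mathcal{D}^2=\mathcal{D}+[\mathcal{D},\mathcal{D}]$ has rank $3$ and $\mathcal{D}^2+[\mathcal{D}^2,\mathcal{D}^2]$ has rank $4$. With projection $\pi:\mathbb{P}(\xi)\to V$, $\mathbb{P}(\xi)$ carries the Engel structure $\mathcal{D}_{(l,v)}=d\pi_{(l,v)}^{-1}(l)$, and $\mathbb{S}(\xi)$ carries its pull-back under the double cover $\mathbb{S}(\xi)\to\mathbb{P}(\xi)$. For a contact $3$-orbifold $(\Sigma,\xi)$, the Cartan prolongation $\mathbb{P}(\Sigma,\xi)$ (resp. the oriented Cartan prolongation $\mathbb{S}(\Sigma,\xi)$) is the Engel $4$-orbifold obtained by applying this chart by chart: a chart $V$ with group $G$ and contact structure $\xi_V$ yields the chart $\mathbb{P}(\xi_V)$ (resp. $\mathbb{S}(\xi_V)$) with the action of $G$ induced by differentials. An orbifold is a manifold if it is free, i.e.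 $s\times t$ is injective; equivalently all its isotropy groups are trivial, i.e. the local groups act freely on the charts.
   Formalization: The orbifold is additionally assumed effective (an isotropy arrow acting as the identity near its object is an identity arrow); without this both "if" directions fail, e.g. for Z/3 acting trivially on a contact 3-manifold. *)

theory Defs
  imports "HOL-Analysis.Analysis"
begin

section \<open>Smooth maps between Euclidean spaces\<close>

text \<open>Only meaningful on open sets, since \<^term>\<open>frechet_derivative f (at x)\<close> is the unrestricted
  derivative.\<close>

primrec Ck_on :: "nat \<Rightarrow> 'e::euclidean_space set \<Rightarrow> ('e \<Rightarrow> 'f::real_normed_vector) \<Rightarrow> bool" where
  "Ck_on 0 S f \<longleftrightarrow> continuous_on S f"
| "Ck_on (Suc k) S f \<longleftrightarrow>
     f differentiable_on S \<and> (\<forall>v. Ck_on k S (\<lambda>x. frechet_derivative f (at x) v))"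

definition smooth_on :: "'e::euclidean_space set \<Rightarrow> ('e \<Rightarrow> 'f::real_normed_vector) \<Rightarrow> bool" where
  "smooth_on S f \<longleftrightarrow> (\<forall>k. Ck_on k S f)"


section \<open>Manifolds\<close>

text \<open>A manifold is given by its atlas. A chart is a pair of its domain and its coordinate map, whose
  values outside the domain are irrelevant. The topology is the one generated by the charts.\<close>

type_synonym ('p, 'e) chart = "'p set \<times> ('p \<Rightarrow> 'e)"
type_synonym ('p, 'e) atlas = "('p, 'e) chart set"

definition points :: "('p, 'e) atlas \<Rightarrow> 'p set" where
  "points A = (\<Union>c\<in>A. fst c)"

definition mtop :: "('p, 'e::euclidean_space) atlas \<Rightarrow> 'p topology" where
  "mtop A = topology_generated_by {{p \<in> fst c. snd c p \<in> W} |c W. c \<in> A \<and> open W}"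

definition chart_inv :: "('p, 'e) chart \<Rightarrow> 'e \<Rightarrow> 'p" where
  "chart_inv c = inv_into (fst c) (snd c)"

definition transition :: "('p, 'e) chart \<Rightarrow> ('p, 'f) chart \<Rightarrow> 'e \<Rightarrow> 'f" where
  "transition c d = snd d \<circ> chart_inv c"

definition manifold :: "('p, 'e::euclidean_space) atlas \<Rightarrow> bool" where
  "manifold A \<longleftrightarrow>
     (\<forall>c\<in>A. inj_on (snd c) (fst c)) \<and>
     (\<forall>c\<in>A. \<forall>d\<in>A. open (snd c ` (fst c \<inter> fst d)) \<and>
                   smooth_on (snd c ` (fst c \<inter> fst d)) (transition c d)) \<and>
     Hausdorff_space (mtop A) \<and> second_countable (mtop A)"

definition prod_atlas ::
  "('p, 'e) atlas \<Rightarrow> ('q, 'f) atlas \<Rightarrow> ('p \<times> 'q, 'e \<times> 'f) atlas" where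
  "prod_atlas A B = {(fst c \<times> fst d, map_prod (snd c) (snd d)) |c d. c \<in> A \<and> d \<in> B}"

text \<open>Smoothness of \<^term>\<open>f\<close> on a subset \<^term>\<open>S\<close> of a manifold means that, in charts, \<^term>\<open>f\<close> extends
  locally to a smooth map on an open set. For open \<^term>\<open>S\<close> this is ordinary smoothness, and for an
  embedded submanifold it is smoothness for the submanifold structure.\<close>

definition smooth_map_on ::
  "('p, 'e::euclidean_space) atlas \<Rightarrow> ('q, 'f::euclidean_space) atlas \<Rightarrow> 'p set \<Rightarrow> ('p \<Rightarrow> 'q) \<Rightarrow> bool"
where
  "smooth_map_on A B S f \<longleftrightarrow>
     (\<forall>p\<in>S. \<exists>c\<in>A. \<exists>d\<in>B. \<exists>W F. p \<in> fst c \<and> f p \<in> fst d \<and>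
        open W \<and> snd c p \<in> W \<and> W \<subseteq> snd c ` fst c \<and> smooth_on W F \<and>
        (\<forall>q \<in> S \<inter> fst c. snd c q \<in> W \<longrightarrow> f q \<in> fst d \<and> snd d (f q) = F (snd c q)))"

abbreviation smooth_map ::
  "('p, 'e::euclidean_space) atlas \<Rightarrow> ('q, 'f::euclidean_space) atlas \<Rightarrow> ('p \<Rightarrow> 'q) \<Rightarrow> bool" where
  "smooth_map A B \<equiv> smooth_map_on A B (points A)"

definition local_diffeo ::
  "('p, 'e::euclidean_space) atlas \<Rightarrow> ('q, 'f::euclidean_space) atlas \<Rightarrow> ('p \<Rightarrow> 'q) \<Rightarrow> bool" where
  "local_diffeo A B f \<longleftrightarrow>
     (\<forall>p\<in>points A. \<exists>U. openin (mtop A) U \<and> p \<in> U \<and> openin (mtop B) (f ` U) \<and> inj_on f U \<and>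
        smooth_map_on A B U f \<and> smooth_map_on B A (f ` U) (inv_into U f))"

text \<open>The tangent space at \<^term>\<open>p\<close> is the model space itself, a tangent vector being identified with its
  coordinates in a chart chosen once and for all at \<^term>\<open>p\<close>. Passing to another chart \<^term>\<open>c\<close> around
  \<^term>\<open>p\<close> is done by \<open>coord_deriv A c p\<close>.\<close>

definition chart_at :: "('p, 'e) atlas \<Rightarrow> 'p \<Rightarrow> ('p, 'e) chart" where
  "chart_at A p = (SOME c. c \<in> A \<and> p \<in> fst c)"

definition coord_deriv ::
  "('p, 'e::euclidean_space) atlas \<Rightarrow> ('p, 'e) chart \<Rightarrow> 'p \<Rightarrow> 'e \<Rightarrow> 'e" where
  "coord_deriv A c p =
     frechet_derivative (transition (chart_at A p) c) (at (snd (chart_at A p) p))"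

definition mderiv ::
  "('p, 'e::euclidean_space) atlas \<Rightarrow> ('q, 'f::euclidean_space) atlas \<Rightarrow> ('p \<Rightarrow> 'q) \<Rightarrow> 'p \<Rightarrow> 'e \<Rightarrow> 'f"
where
  "mderiv A B f p =
     frechet_derivative (snd (chart_at B (f p)) \<circ> f \<circ> chart_inv (chart_at A p))
       (at (snd (chart_at A p) p))"

definition submersion ::
  "('p, 'e::euclidean_space) atlas \<Rightarrow> ('q, 'f::euclidean_space) atlas \<Rightarrow> ('p \<Rightarrow> 'q) \<Rightarrow> bool" where
  "submersion A B f \<longleftrightarrow> smooth_map A B f \<and> (\<forall>p\<in>points A. surj (mderiv A B f p))"


section \<open>Rank 2 distributions and contact structures\<close>

definition local_frame ::
  "('p, 'e::euclidean_space) atlas \<Rightarrow> ('p \<Rightarrow> 'e set) \<Rightarrow> ('p, 'e) chart \<Rightarrow> 'e set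
     \<Rightarrow> ('e \<Rightarrow> 'e) \<Rightarrow> ('e \<Rightarrow> 'e) \<Rightarrow> bool" where
  "local_frame A \<xi> c W X Y \<longleftrightarrow>
     c \<in> A \<and> open W \<and> W \<subseteq> snd c ` fst c \<and> smooth_on W X \<and> smooth_on W Y \<and>
     (\<forall>p\<in>fst c. snd c p \<in> W \<longrightarrow>
        coord_deriv A c p ` \<xi> p = span {X (snd c p), Y (snd c p)})"

definition rank2_distribution ::
  "('p, 'e::euclidean_space) atlas \<Rightarrow> ('p \<Rightarrow> 'e set) \<Rightarrow> bool" where
  "rank2_distribution A \<xi> \<longleftrightarrow>
     (\<forall>p\<in>points A. subspace (\<xi> p) \<and> dim (\<xi> p) = 2 \<and>
        (\<exists>c W X Y. p \<in> fst c \<and> snd c p \<in> W \<and> local_frame A \<xi> c W X Y))"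

definition ext_deriv :: "('e::euclidean_space \<Rightarrow> 'e \<Rightarrow>\<^sub>L real) \<Rightarrow> 'e \<Rightarrow> 'e \<Rightarrow> 'e \<Rightarrow> real" where
  "ext_deriv \<alpha> y u v =
     blinfun_apply (frechet_derivative \<alpha> (at y) u) v
     - blinfun_apply (frechet_derivative \<alpha> (at y) v) u"

definition wedge_ext_deriv ::
  "('e::euclidean_space \<Rightarrow> 'e \<Rightarrow>\<^sub>L real) \<Rightarrow> 'e \<Rightarrow> 'e \<Rightarrow> 'e \<Rightarrow> 'e \<Rightarrow> real" where
  "wedge_ext_deriv \<alpha> y u v w =
     blinfun_apply (\<alpha> y) u * ext_deriv \<alpha> y v w
     + blinfun_apply (\<alpha> y) v * ext_deriv \<alpha> y w u
     + blinfun_apply (\<alpha> y) w * ext_deriv \<alpha> y u v"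

text \<open>Local 1-forms are taken on open subsets of coordinate domains, which is enough because the
  condition is local. The dimension 3 is imposed through the model space.\<close>

definition contact_structure ::
  "('p, real ^ 3) atlas \<Rightarrow> ('p \<Rightarrow> (real ^ 3) set) \<Rightarrow> bool" where
  "contact_structure A \<xi> \<longleftrightarrow>
     rank2_distribution A \<xi> \<and>
     (\<forall>c\<in>A. \<forall>W \<alpha>. open W \<and> W \<subseteq> snd c ` fst c \<and> smooth_on W \<alpha> \<and>
        (\<forall>p\<in>fst c. snd c p \<in> W \<longrightarrow>
           coord_deriv A c p ` \<xi> p = {v. blinfun_apply (\<alpha> (snd c p)) v = 0})
        \<longrightarrow> (\<forall>y\<in>W. \<exists>u v w. wedge_ext_deriv \<alpha> y u v w \<noteq> 0))"

definition local_contactomorphism ::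
  "('p, real ^ 3) atlas \<Rightarrow> ('p \<Rightarrow> (real ^ 3) set) \<Rightarrow>
   ('q, real ^ 3) atlas \<Rightarrow> ('q \<Rightarrow> (real ^ 3) set) \<Rightarrow> ('p \<Rightarrow> 'q) \<Rightarrow> bool" where
  "local_contactomorphism A \<xi> B \<eta> f \<longleftrightarrow>
     local_diffeo A B f \<and> (\<forall>p\<in>points A. mderiv A B f p ` \<xi> p \<subseteq> \<eta> (f p))"


section \<open>Lie groupoids and orbifolds\<close>

text \<open>The product \<open>mult G g h\<close> is meaningful when \<^term>\<open>src G g = tgt G h\<close>.\<close>

record ('o, 'a, 'e, 'f) groupoid =
  obj :: "('o, 'e) atlas"
  arr :: "('a, 'f) atlas"
  src :: "'a \<Rightarrow> 'o"
  tgt :: "'a \<Rightarrow> 'o"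
  ident :: "'o \<Rightarrow> 'a"
  invs :: "'a \<Rightarrow> 'a"
  mult :: "'a \<Rightarrow> 'a \<Rightarrow> 'a"

definition is_groupoid :: "('o, 'a, 'e, 'f, 'z) groupoid_scheme \<Rightarrow> bool" where
  "is_groupoid G \<longleftrightarrow>
     (\<forall>g\<in>points (arr G). src G g \<in> points (obj G) \<and> tgt G g \<in> points (obj G)) \<and>
     (\<forall>x\<in>points (obj G). ident G x \<in> points (arr G) \<and>
        src G (ident G x) = x \<and> tgt G (ident G x) = x) \<and>
     (\<forall>g\<in>points (arr G). \<forall>h\<in>points (arr G). src G g = tgt G h \<longrightarrow>
        mult G g h \<in> points (arr G) \<and>
        src G (mult G g h) = src G h \<and> tgt G (mult G g h) = tgt G g) \<and>
     (\<forall>g\<in>points (arr G). \<forall>h\<in>points (arr G). \<forall>k\<in>points (arr G).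
        src G g = tgt G h \<and> src G h = tgt G k \<longrightarrow>
        mult G (mult G g h) k = mult G g (mult G h k)) \<and>
     (\<forall>g\<in>points (arr G). mult G g (ident G (src G g)) = g \<and> mult G (ident G (tgt G g)) g = g) \<and>
     (\<forall>g\<in>points (arr G). invs G g \<in> points (arr G) \<and>
        src G (invs G g) = tgt G g \<and> tgt G (invs G g) = src G g \<and>
        mult G g (invs G g) = ident G (tgt G g) \<and> mult G (invs G g) g = ident G (src G g))"

definition composable :: "('o, 'a, 'e, 'f, 'z) groupoid_scheme \<Rightarrow> ('a \<times> 'a) set" where
  "composable G = {(g, h) \<in> points (arr G) \<times> points (arr G). src G g = tgt G h}"

definition lie_groupoid ::
  "('o, 'a, 'e::euclidean_space, 'f::euclidean_space, 'z) groupoid_scheme \<Rightarrow> bool" where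
  "lie_groupoid G \<longleftrightarrow>
     is_groupoid G \<and> manifold (obj G) \<and> manifold (arr G) \<and>
     submersion (arr G) (obj G) (src G) \<and>
     smooth_map (arr G) (obj G) (tgt G) \<and>
     smooth_map (obj G) (arr G) (ident G) \<and>
     smooth_map (arr G) (arr G) (invs G) \<and>
     smooth_map_on (prod_atlas (arr G) (arr G)) (arr G) (composable G) (\<lambda>(g, h). mult G g h)"

definition etale ::
  "('o, 'a, 'e::euclidean_space, 'f::euclidean_space, 'z) groupoid_scheme \<Rightarrow> bool" where
  "etale G \<longleftrightarrow> local_diffeo (arr G) (obj G) (src G)"

definition proper ::
  "('o, 'a, 'e::euclidean_space, 'f::euclidean_space, 'z) groupoid_scheme \<Rightarrow> bool" where
  "proper G \<longleftrightarrow>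
     proper_map (mtop (arr G)) (prod_topology (mtop (obj G)) (mtop (obj G)))
       (\<lambda>g. (src G g, tgt G g))"

definition orbifold ::
  "('o, 'a, 'e::euclidean_space, 'f::euclidean_space, 'z) groupoid_scheme \<Rightarrow> bool" where
  "orbifold G \<longleftrightarrow> lie_groupoid G \<and> etale G \<and> proper G"

text \<open>An orbifold is a manifold if it is free.\<close>

definition is_manifold :: "('o, 'a, 'e, 'f, 'z) groupoid_scheme \<Rightarrow> bool" where
  "is_manifold G \<longleftrightarrow> inj_on (\<lambda>g. (src G g, tgt G g)) (points (arr G))"

definition isotropy :: "('o, 'a, 'e, 'f, 'z) groupoid_scheme \<Rightarrow> 'o \<Rightarrow> 'a set" where
  "isotropy G x = {g \<in> points (arr G). src G g = x \<and> tgt G g = x}"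

text \<open>Near an arrow \<^term>\<open>g\<close> of an etale groupoid the source map has a local inverse, and following it by
  the target map gives the local diffeomorphism through which \<^term>\<open>g\<close> acts in a chart. It is the
  identity near \<^term>\<open>src G g\<close> iff source and target agree near \<^term>\<open>g\<close>; its differential at
  \<^term>\<open>src G g\<close> is \<open>arrow_deriv G g\<close>.

  Effectiveness is the usual standing convention for orbifolds. It is not part of being a proper
  etale Lie groupoid: for the trivial action of a group of order 3 on a contact manifold, isotropy is
  odd and orientation is preserved, yet neither prolongation is free.\<close>

definition effective ::
  "('o, 'a, 'e::euclidean_space, 'f::euclidean_space, 'z) groupoid_scheme \<Rightarrow> bool" where
  "effective G \<longleftrightarrow>
     (\<forall>x\<in>points (obj G). \<forall>g\<in>isotropy G x.
        (\<exists>U. openin (mtop (arr G)) U \<and> g \<in> U \<and> (\<forall>h\<in>U. src G h = tgt G h)) \<longrightarrow> g = ident G x)"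

definition arrow_deriv ::
  "('o, 'a, 'e::euclidean_space, 'f::euclidean_space, 'z) groupoid_scheme \<Rightarrow> 'a \<Rightarrow> 'e \<Rightarrow> 'e" where
  "arrow_deriv G g = mderiv (arr G) (obj G) (tgt G) g \<circ> inv (mderiv (arr G) (obj G) (src G) g)"


section \<open>Contact 3-orbifolds\<close>

record ('o, 'a, 'e, 'f) dist_groupoid = "('o, 'a, 'e, 'f) groupoid" +
  obj_dist :: "'o \<Rightarrow> 'e set"
  arr_dist :: "'a \<Rightarrow> 'f set"

text \<open>The pairs of composable arrows carry the contact structure pulled back along the second
  projection. Multiplication is then a local contactomorphism automatically, because composing it
  with the source map gives the source map of the second factor.\<close>

definition contact_3_orbifold :: "('o, 'a, real ^ 3, real ^ 3) dist_groupoid \<Rightarrow> bool" where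
  "contact_3_orbifold S \<longleftrightarrow>
     orbifold S \<and>
     contact_structure (obj S) (obj_dist S) \<and>
     contact_structure (arr S) (arr_dist S) \<and>
     local_contactomorphism (arr S) (arr_dist S) (obj S) (obj_dist S) (src S) \<and>
     local_contactomorphism (arr S) (arr_dist S) (obj S) (obj_dist S) (tgt S) \<and>
     local_contactomorphism (obj S) (obj_dist S) (arr S) (arr_dist S) (ident S) \<and>
     local_contactomorphism (arr S) (arr_dist S) (arr S) (arr_dist S) (invs S)"

definition preserves_plane_orientation ::
  "'e::euclidean_space set \<Rightarrow> ('e \<Rightarrow> 'e) \<Rightarrow> bool" where
  "preserves_plane_orientation P L \<longleftrightarrow>
     (\<forall>u\<in>P. \<forall>v\<in>P. u \<noteq> v \<and> independent {u, v} \<longrightarrow>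
        (\<exists>a b c d. L u = a *\<^sub>R u + b *\<^sub>R v \<and> L v = c *\<^sub>R u + d *\<^sub>R v \<and> a * d - b * c > 0))"

definition positive_orbifold :: "('o, 'a, real ^ 3, real ^ 3) dist_groupoid \<Rightarrow> bool" where
  "positive_orbifold S \<longleftrightarrow>
     (\<forall>x\<in>points (obj S). \<forall>g\<in>isotropy S x.
        preserves_plane_orientation (obj_dist S x) (arrow_deriv S g))"


section \<open>Cartan prolongations\<close>

definition lines :: "'e::euclidean_space set \<Rightarrow> 'e set set" where
  "lines P = {l. subspace l \<and> dim l = 1 \<and> l \<subseteq> P}"

definition rays :: "'e::euclidean_space set \<Rightarrow> 'e set set" where
  "rays P = {{c *\<^sub>R w |c. c > 0} |w. w \<in> P - {0}}"

text \<open>The two prolongations are treated uniformly, \<open>Fib\<close> being \<^const>\<open>lines\<close> or \<^const>\<open>rays\<close>. A local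
  frame \<open>X, Y\<close> of the distribution gives the chart on those \<^term>\<open>(p, l)\<close> for which \<^term>\<open>l\<close> contains
  a vector \<open>X + a Y\<close>, and \<open>a\<close> is the fibre coordinate. The frames \<open>X, Y\<close> and \<open>Y, X\<close>
  together cover the lines; with \<open>-X, Y\<close> and \<open>-Y, X\<close> they cover the rays.\<close>

definition prolong_atlas ::
  "('e::euclidean_space set \<Rightarrow> 'e set set) \<Rightarrow> ('p, 'e) atlas \<Rightarrow> ('p \<Rightarrow> 'e set)
     \<Rightarrow> ('p \<times> 'e set, 'e \<times> real) atlas" where
  "prolong_atlas Fib A \<xi> =
     {({(p, l). p \<in> fst c \<and> snd c p \<in> W \<and> l \<in> Fib (\<xi> p) \<and>
          (\<exists>a. X (snd c p) + a *\<^sub>R Y (snd c p) \<in> coord_deriv A c p ` l)},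
       \<lambda>(p, l). (snd c p, THE a. X (snd c p) + a *\<^sub>R Y (snd c p) \<in> coord_deriv A c p ` l))
      |c W X Y. local_frame A \<xi> c W X Y}"

definition prolong_map ::
  "('p, 'e::euclidean_space) atlas \<Rightarrow> ('q, 'f::euclidean_space) atlas \<Rightarrow> ('p \<Rightarrow> 'q)
     \<Rightarrow> 'p \<times> 'e set \<Rightarrow> 'q \<times> 'f set" where
  "prolong_map A B f = (\<lambda>(p, l). (f p, mderiv A B f p ` l))"

text \<open>The Engel distribution: the preimage, under the differential of the bundle projection, of the
  line \<^term>\<open>l\<close>, or of the line spanned by the ray \<^term>\<open>l\<close>.\<close>

definition prolong_dist ::
  "('e::euclidean_space set \<Rightarrow> 'e set set) \<Rightarrow> ('p, 'e) atlas \<Rightarrow> ('p \<Rightarrow> 'e set)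
     \<Rightarrow> 'p \<times> 'e set \<Rightarrow> ('e \<times> real) set" where
  "prolong_dist Fib A \<xi> =
     (\<lambda>(p, l). {w. mderiv (prolong_atlas Fib A \<xi>) A fst (p, l) w \<in> span l})"

text \<open>Objects and arrows are prolonged as contact manifolds, source, target, identities and inversion
  act by their differentials. A product of arrows takes its line (or ray) from the second factor,
  the tangent spaces at \<open>h\<close> and at \<open>mult S g h\<close> being identified through that at their common source.\<close>

definition prolongation ::
  "('e::euclidean_space set \<Rightarrow> 'e set set) \<Rightarrow> ('o, 'a, 'e, 'e) dist_groupoid
     \<Rightarrow> ('o \<times> 'e set, 'a \<times> 'e set, 'e \<times> real, 'e \<times> real) dist_groupoid" where
  "prolongation Fib S =
     \<lparr> obj = prolong_atlas Fib (obj S) (obj_dist S),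
       arr = prolong_atlas Fib (arr S) (arr_dist S),
       src = prolong_map (arr S) (obj S) (src S),
       tgt = prolong_map (arr S) (obj S) (tgt S),
       ident = prolong_map (obj S) (arr S) (ident S),
       invs = prolong_map (arr S) (arr S) (invs S),
       mult = (\<lambda>(g, l) (h, l'). (mult S g h,
         {v. mderiv (arr S) (obj S) (src S) (mult S g h) v
               \<in> mderiv (arr S) (obj S) (src S) h ` l'})),
       obj_dist = prolong_dist Fib (obj S) (obj_dist S),
       arr_dist = prolong_dist Fib (arr S) (arr_dist S) \<rparr>"

definition cartan_prolongation ::
  "('o, 'a, real ^ 3, real ^ 3) dist_groupoid
     \<Rightarrow> ('o \<times> (real ^ 3) set, 'a \<times> (real ^ 3) set, (real ^ 3) \<times> real, (real ^ 3) \<times> real) dist_groupoid"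
where
  "cartan_prolongation = prolongation lines"

definition oriented_cartan_prolongation ::
  "('o, 'a, real ^ 3, real ^ 3) dist_groupoid
     \<Rightarrow> ('o \<times> (real ^ 3) set, 'a \<times> (real ^ 3) set, (real ^ 3) \<times> real, (real ^ 3) \<times> real) dist_groupoid"
where
  "oriented_cartan_prolongation = prolongation rays"

end

theory Submission
  imports "HOL-Algebra.Multiplicative_Group" "HOL-Algebra.Sylow" Defs
begin

text \<open>A prolongation fails to be free exactly when some nontrivial isotropy arrow \<open>k\<close> at an object
  \<open>x\<close> fixes a line (or a ray) of the contact plane \<open>\<xi>\<^sub>x\<close>, because two distinct prolonged arrows with the
  same source and target differ by such a \<open>k\<close>; this is \<open>prolongation_is_manifold_iff\<close>. The theorem
  is thereby reduced to the linear action of the isotropy group on \<open>\<xi>\<^sub>x\<close>.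

  If the differential of \<open>k\<close> reverses the orientation of \<open>\<xi>\<^sub>x\<close>, its two real eigenvalues on the plane
  have opposite signs, so it fixes a ray, and \<open>k\<close> is nontrivial because the identity preserves
  orientation. Hence freeness of either prolongation forces positivity. If the isotropy group has even order,
  it contains an involution, and a linear involution of a plane always fixes a line; so freeness of the
  unoriented prolongation also forces odd order.

  For the converse let the differential \<open>A\<close> of \<open>k\<close> preserve the orientation and fix a ray. It has finite order, so
  the eigenvalue on that ray is 1, and by orientation the other eigenvalue is a positive
  root of unity, hence 1 too; a unipotent map of finite order is the identity, so \<open>A\<close> is the identity on
  \<open>\<xi>\<^sub>x\<close>. Now the contact condition enters: for a local frame \<open>X\<close>, \<open>Y\<close> of \<open>\<xi>\<close> the bracket
  \<open>[X, Y]\<close> at \<open>x\<close> is transverse to \<open>\<xi>\<^sub>x\<close>, and its class modulo \<open>\<xi>\<^sub>x\<close> depends only on the values of the frame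
  at \<open>x\<close>, so \<open>A\<close> acts trivially on \<open>T\<^sub>x / \<xi>\<^sub>x\<close> as well (\<open>isotropy_transverse\<close>). Again \<open>A\<close> is unipotent of finite
  order, thus the identity. Finally an isotropy arrow with trivial differential is trivial
  (\<open>isotropy_faithful\<close>): summing, in coordinates, the local diffeomorphisms of all isotropy arrows with trivial
  differential gives an invariant function that is injective near \<open>x\<close>, so these diffeomorphisms
  are germs of the identity, and the groupoid is effective. On a fixed line the eigenvalue
  is \<open>1\<close> or \<open>-1\<close>, and odd order excludes \<open>-1\<close>, which gives the unoriented case.\<close>

unbundle no m_inv_syntax

section \<open>Calculus of smooth maps\<close>

lemma frechet_derivative_eqI:
  "(f has_derivative f') (at x) \<Longrightarrow> frechet_derivative f (at x) = f'"
  using frechet_derivative_at by metis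

lemma differentiable_on_imp_has_derivative:
  assumes "f differentiable_on S" "open S" "x \<in> S"
  shows "(f has_derivative frechet_derivative f (at x)) (at x)"
  using assms differentiable_on_eq_differentiable_at frechet_derivative_works by blast

lemma Ck_on_cong:
  assumes "open S" "\<And>x. x \<in> S \<Longrightarrow> f x = g x" "Ck_on k S f"
  shows "Ck_on k S g"
  using assms(2,3)
proof (induction k arbitrary: f g)
  case 0
  then show ?case by (auto cong: continuous_on_cong)
next
  case (Suc k)
  have d: "f differentiable_on S" using Suc.prems by simp
  have "(g has_derivative frechet_derivative f (at x)) (at x)" if "x \<in> S" for x
    using has_derivative_transform_within_open[OF
        differentiable_on_imp_has_derivative[OF d assms(1) that] assms(1) that Suc.prems(1)] .
  then have "g differentiable_on S" "\<And>x. x \<in> S \<Longrightarrow> frechet_derivative f (at x) = frechet_derivative g (at x)"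
    using assms(1) differentiable_on_eq_differentiable_at differentiable_def frechet_derivative_at
    by metis+
  moreover have "Ck_on k S (\<lambda>x. frechet_derivative f (at x) v)" for v using Suc.prems by simp
  ultimately show ?case using Suc.IH[of "\<lambda>x. frechet_derivative f (at x) v" "\<lambda>x. frechet_derivative g (at x) v" for v]
    by simp
qed

lemma Ck_on_subset: "Ck_on k S f \<Longrightarrow> T \<subseteq> S \<Longrightarrow> Ck_on k T f"
  by (induction k arbitrary: f) (auto intro: continuous_on_subset differentiable_on_subset)

lemma Ck_on_pred: "Ck_on (Suc k) S f \<Longrightarrow> Ck_on k S f"
  by (induction k arbitrary: f) (auto intro: differentiable_imp_continuous_on)

text \<open>Frees the inductive proofs below from \<^const>\<open>frechet_derivative\<close>: any known formula for the
  derivative may be used.\<close>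

lemma Ck_on_SucI:
  assumes "open S" "\<And>x. x \<in> S \<Longrightarrow> (f has_derivative f' x) (at x)"
    and "\<And>v. Ck_on k S (\<lambda>x. f' x v)"
  shows "Ck_on (Suc k) S f"
proof -
  have "f differentiable_on S" 
    using assms(1,2) differentiable_on_eq_differentiable_at differentiable_def by metis
  moreover have "Ck_on k S (\<lambda>x. frechet_derivative f (at x) v)" for v
    by (rule Ck_on_cong[OF assms(1) _ assms(3)[of v]]) (simp add: frechet_derivative_eqI[OF assms(2)])
  ultimately show ?thesis by simp
qed

lemma Ck_on_const: "open S \<Longrightarrow> Ck_on k S (\<lambda>x. c)"
  by (induction k arbitrary: c) (auto simp: differentiable_on_def)

lemma Ck_on_add:
  assumes "open S" "Ck_on k S f" "Ck_on k S g"
  shows "Ck_on k S (\<lambda>x. f x + g x)"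
  using assms(2,3)
proof (induction k arbitrary: f g)
  case 0
  then show ?case by (auto intro: continuous_intros)
next
  case (Suc k)
  show ?case
    by (rule Ck_on_SucI[OF assms(1) has_derivative_add[OF
          differentiable_on_imp_has_derivative[OF _ assms(1)] differentiable_on_imp_has_derivative[OF _ assms(1)]]])
       (use Suc in auto)
qed

lemma Ck_on_sum:
  assumes "open S" "finite I" "\<And>i. i \<in> I \<Longrightarrow> Ck_on k S (f i)"
  shows "Ck_on k S (\<lambda>x. \<Sum>i\<in>I. f i x)"
  using assms(2,3) by (induction I) (auto intro: Ck_on_const Ck_on_add assms(1))

lemma Ck_on_bilinear:
  assumes "bounded_bilinear B" "open S" "Ck_on k S f" "Ck_on k S g"
  shows "Ck_on k S (\<lambda>x. B (f x) (g x))"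
  using assms(3,4)
proof (induction k arbitrary: f g)
  case 0
  then show ?case by (auto intro: bounded_bilinear.continuous_on[OF assms(1)])
next
  case (Suc k)
  have [simp]: "Ck_on k S f" "Ck_on k S g" using Suc.prems Ck_on_pred by blast+
  show ?case
    by (rule Ck_on_SucI[OF assms(2) bounded_bilinear.FDERIV[OF assms(1)
          differentiable_on_imp_has_derivative[OF _ assms(2)] differentiable_on_imp_has_derivative[OF _ assms(2)]]])
       (use Suc in \<open>auto intro!: Ck_on_add assms(2)\<close>)
qed

lemma Ck_on_linear:
  assumes "bounded_linear L" "open S" "Ck_on k S f"
  shows "Ck_on k S (\<lambda>x. L (f x))"
  using assms(3)
proof (induction k arbitrary: f)
  case 0
  then show ?case by (auto intro: bounded_linear.continuous_on[OF assms(1)])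
next
  case (Suc k)
  show ?case
    by (rule Ck_on_SucI[OF assms(2) bounded_linear.has_derivative[OF assms(1)
          differentiable_on_imp_has_derivative[OF _ assms(2)]]])
       (use Suc in auto)
qed

text \<open>By the chain rule the directional derivatives of \<open>f \<circ> g\<close> are finite sums of products of coordinates of
  directional derivatives of \<open>g\<close> with partial derivatives of \<open>f\<close> composed with \<open>g\<close>, so induction on \<open>k\<close>
  applies to the latter.\<close>

lemma Ck_on_compose:
  fixes f :: "'f::euclidean_space \<Rightarrow> 'g::real_normed_vector" and g :: "'e::euclidean_space \<Rightarrow> 'f"
  assumes "open S" "open T" "g ` S \<subseteq> T" "Ck_on k S g" "Ck_on k T f"
  shows "Ck_on k S (f \<circ> g)"
  using assms(4,5)
proof (induction k arbitrary: f)
  case 0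
  then show ?case using assms(3) by (simp add: continuous_on_compose continuous_on_subset del: comp_apply o_apply)
next
  case (Suc k)
  have g: "(g has_derivative frechet_derivative g (at x)) (at x)" if "x \<in> S" for x
    by (rule differentiable_on_imp_has_derivative[OF _ assms(1) that]) (use Suc.prems in simp)
  have f: "(f has_derivative frechet_derivative f (at x)) (at x)" if "x \<in> T" for x
    by (rule differentiable_on_imp_has_derivative[OF _ assms(2) that]) (use Suc.prems in simp)
  have e: "frechet_derivative f (at y) w = (\<Sum>b\<in>Basis. (w \<bullet> b) *\<^sub>R frechet_derivative f (at y) b)"
    if "y \<in> T" for y w
    using linear_sum[OF has_derivative_linear[OF f[OF that]], of "\<lambda>b. (w \<bullet> b) *\<^sub>R b" Basis]
    by (simp add: euclidean_representation linear_cmul[OF has_derivative_linear[OF f[OF that]]])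
  have "Ck_on k S (\<lambda>x. \<Sum>b\<in>Basis. (frechet_derivative g (at x) v \<bullet> b) *\<^sub>R
            ((\<lambda>y. frechet_derivative f (at y) b) \<circ> g) x)" for v
    by (intro Ck_on_sum Ck_on_bilinear[OF bounded_bilinear_scaleR] assms(1) finite_Basis
        Ck_on_linear[OF bounded_linear_inner_left] Suc.IH) (use Suc.prems Ck_on_pred in auto)
  then have "Ck_on k S (\<lambda>x. (frechet_derivative f (at (g x)) \<circ> frechet_derivative g (at x)) v)" for v
    by (rule Ck_on_cong[OF assms(1), rotated]) (use assms(3) in \<open>auto simp: e[of "g _" "frechet_derivative g (at _) v"]\<close>)
  then show ?case
    by (intro Ck_on_SucI[OF assms(1) diff_chain_at[OF g f]]) (use assms(3) in auto)
qed

lemma smooth_on_subset: "smooth_on S f \<Longrightarrow> T \<subseteq> S \<Longrightarrow> smooth_on T f"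
  unfolding smooth_on_def using Ck_on_subset by blast

lemma smooth_on_cong: "open S \<Longrightarrow> (\<And>x. x \<in> S \<Longrightarrow> f x = g x) \<Longrightarrow> smooth_on S f \<Longrightarrow> smooth_on S g"
  unfolding smooth_on_def using Ck_on_cong by blast

lemma smooth_on_compose:
  "open S \<Longrightarrow> open T \<Longrightarrow> g ` S \<subseteq> T \<Longrightarrow> smooth_on S g \<Longrightarrow> smooth_on T f \<Longrightarrow> smooth_on S (f \<circ> g)"
  unfolding smooth_on_def using Ck_on_compose by blast

lemma smooth_on_bilinear:
  "bounded_bilinear B \<Longrightarrow> open S \<Longrightarrow> smooth_on S f \<Longrightarrow> smooth_on S g \<Longrightarrow> smooth_on S (\<lambda>x. B (f x) (g x))"
  unfolding smooth_on_def using Ck_on_bilinear by blast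

lemma smooth_on_linear:
  "bounded_linear L \<Longrightarrow> open S \<Longrightarrow> smooth_on S f \<Longrightarrow> smooth_on S (\<lambda>x. L (f x))"
  unfolding smooth_on_def using Ck_on_linear by blast

lemma smooth_on_has_derivative:
  "smooth_on S f \<Longrightarrow> open S \<Longrightarrow> x \<in> S \<Longrightarrow> (f has_derivative frechet_derivative f (at x)) (at x)"
  unfolding smooth_on_def using differentiable_on_imp_has_derivative Ck_on.simps(2) by blast

lemma smooth_on_deriv: "smooth_on S f \<Longrightarrow> smooth_on S (\<lambda>x. frechet_derivative f (at x) v)"
  unfolding smooth_on_def using Ck_on.simps(2) by blast

lemma smooth_on_continuous_on: "smooth_on S f \<Longrightarrow> continuous_on S f"
  unfolding smooth_on_def using Ck_on.simps(1) by blast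

lemma smooth_on_ident: "open S \<Longrightarrow> smooth_on S (\<lambda>x. x)"
proof -
  assume S: "open S"
  have "Ck_on k S (\<lambda>x. x)" for k
  proof (cases k)
    case (Suc n)
    show ?thesis unfolding Suc by (rule Ck_on_SucI[OF S has_derivative_ident Ck_on_const[OF S]])
  qed simp
  then show ?thesis by (simp add: smooth_on_def)
qed

lemma Ck_on_Pair:
  assumes "open S" "Ck_on k S f" "Ck_on k S g"
  shows "Ck_on k S (\<lambda>x. (f x, g x))"
proof -
  have 1: "bounded_linear (\<lambda>a. (a, 0))" "bounded_linear (\<lambda>b. (0, b))"
    by (auto intro!: bounded_linear_Pair bounded_linear_zero bounded_linear_ident)
  have "Ck_on k S (\<lambda>x. (f x, 0) + (0, g x))"
    using Ck_on_add[OF assms(1) Ck_on_linear[OF 1(1) assms(1,2)] Ck_on_linear[OF 1(2) assms(1,3)]] .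
  then show ?thesis by simp
qed

lemma smooth_on_Pair:
  "open S \<Longrightarrow> smooth_on S f \<Longrightarrow> smooth_on S g \<Longrightarrow> smooth_on S (\<lambda>x. (f x, g x))"
  unfolding smooth_on_def by (simp add: Ck_on_Pair)

lemma smooth_on_sum:
  "open S \<Longrightarrow> finite I \<Longrightarrow> (\<And>i. i \<in> I \<Longrightarrow> smooth_on S (f i)) \<Longrightarrow> smooth_on S (\<lambda>x. \<Sum>i\<in>I. f i x)"
  unfolding smooth_on_def using Ck_on_sum by blast

text \<open>The local injectivity half of the inverse function theorem. Smoothness is given through directional
  derivatives; the operator norm that the library theorem asks for is bounded by the sum of the norms of the values
  on a basis.\<close>

lemma smooth_on_locally_injective:
  fixes f :: "'e::euclidean_space \<Rightarrow> 'f::euclidean_space"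
  assumes S: "open S" "a \<in> S" and f: "smooth_on S f" and inj: "inj (frechet_derivative f (at a))"
  obtains r where "r > 0" "ball a r \<subseteq> S" "inj_on f (ball a r)"
proof -
  let ?D = "\<lambda>x. frechet_derivative f (at x)"
  have d: "(f has_derivative ?D x) (at x)" if "x \<in> S" for x
    by (rule smooth_on_has_derivative[OF f S(1) that])
  note lin = has_derivative_linear[OF d]
  obtain g where g: "linear g" "g \<circ> ?D a = id"
    using linear_injective_left_inverse[OF lin[OF S(2)] inj] by blast
  have "\<exists>d>0. \<forall>x. dist a x < d \<longrightarrow> onorm (\<lambda>v. ?D x v - ?D a v) < e" if e: "e > 0" for e
  proof -
    define h where "h x = (\<Sum>b\<in>Basis. norm (?D x b - ?D a b))" for x
    have "continuous_on S h" unfolding h_def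
      by (intro continuous_intros smooth_on_continuous_on[OF smooth_on_deriv[OF f]])
    then have "(h \<longlongrightarrow> h a) (at a)"
      using S by (simp add: continuous_on_eq_continuous_at isCont_def)
    moreover have "h a = 0" by (simp add: h_def)
    ultimately obtain d1 where d1: "d1 > 0" "\<And>x. x \<noteq> a \<Longrightarrow> dist x a < d1 \<Longrightarrow> h x < e"
      using e unfolding tendsto_iff eventually_at by (auto simp: dist_real_def) (metis abs_less_iff)
    obtain d2 where d2: "d2 > 0" "ball a d2 \<subseteq> S" using S openE by blast
    have "onorm (\<lambda>v. ?D x v - ?D a v) < e" if "dist a x < min d1 d2" for x
    proof -
      have "x \<in> S" using that d2(2) by auto
      then have "bounded_linear (\<lambda>v. ?D x v - ?D a v)"
        using has_derivative_bounded_linear[OF d] S(2) by (intro bounded_linear_sub) auto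
      then have "onorm (\<lambda>v. ?D x v - ?D a v) \<le> h x"
        unfolding h_def by (rule onorm_componentwise)
      also have "h x < e"
        using d1(2)[of x] that e \<open>h a = 0\<close> by (cases "x = a") (auto simp: dist_commute)
      finally show ?thesis .
    qed
    then show ?thesis using d1(1) d2(1) by (intro exI[of _ "min d1 d2"]) auto
  qed
  from has_derivative_locally_injective[OF S(2,1) linear_conv_bounded_linear[THEN iffD1, OF g(1)] g(2) d this]
  show thesis using that by blast
qed

text \<open>The mixed second difference quotient tends to the second derivative: the increment in direction
  \<open>u\<close> is evaluated by the mean value theorem, the one in direction \<open>v\<close> by differentiability of the
  derivative along \<open>u\<close> at the base point.\<close>

lemma mixed_difference_limit:
  fixes f :: "'e::euclidean_space \<Rightarrow> real"
  assumes "open S" "a \<in> S"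
    and f: "\<And>x. x \<in> S \<Longrightarrow> (f has_derivative f' x) (at x)"
    and u: "((\<lambda>x. f' x u) has_derivative D) (at a)"
  shows "((\<lambda>t. (f (a + t *\<^sub>R u + t *\<^sub>R v) - f (a + t *\<^sub>R u) - f (a + t *\<^sub>R v) + f a) / t\<^sup>2) \<longlongrightarrow> D v)
           (at_right 0)"
proof (rule tendstoI)
  fix e :: real assume e: "e > 0"
  \<comment> \<open>All points below lie within distance \<open>t M\<close> of \<open>a\<close>. Two linear approximations of the derivative are
    used, each with an error of at most \<open>e' t M\<close>, that is \<open>t e / 4\<close>.\<close>
  define M where "M = 2 * (norm u + norm v) + 1"
  have M: "M > 0" by (simp add: M_def add_nonneg_pos)
  have Mb: "norm u + norm v \<le> M" "norm u \<le> M" by (simp_all add: M_def)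
  define e' where "e' = e / (4 * M)"
  have e': "e' > 0" using e M by (simp add: e'_def)
  obtain r where r: "r > 0" "ball a r \<subseteq> S" using assms(1,2) openE by blast
  obtain d where d: "d > 0" and dd: "\<And>y. norm (y - a) < d \<Longrightarrow> norm (f' y u - f' a u - D (y - a)) \<le> e' * norm (y - a)"
    using u e' unfolding has_derivative_at_alt by blast
  interpret D: bounded_linear D using u by (rule has_derivative_bounded_linear)
  have "\<forall>\<^sub>F t in at_right (0::real). t < min r d / M"
    using r d M by (auto simp: eventually_at_right_field intro!: exI[of _ "min r d / M"])
  moreover have "\<forall>\<^sub>F t in at_right (0::real). t > 0" by (simp add: eventually_at_right_less)
  ultimately show "\<forall>\<^sub>F t in at_right 0. dist ((f (a + t *\<^sub>R u + t *\<^sub>R v) - f (a + t *\<^sub>R u) - f (a + t *\<^sub>R v) + f a) / t\<^sup>2) (D v) < e"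
  proof eventually_elim
    case (elim t)
    have tM: "t * M < r" "t * M < d" using elim M by (auto simp: field_simps)
    have nrm: "norm (s *\<^sub>R u + t *\<^sub>R v) \<le> t * M" "norm (s *\<^sub>R u) \<le> t * M" if "0 \<le> s" "s \<le> t" for s
    proof -
      have 1: "s * norm u \<le> t * norm u" using that by (simp add: mult_right_mono)
      have "norm (s *\<^sub>R u + t *\<^sub>R v) \<le> s * norm u + t * norm v"
        using norm_triangle_ineq[of "s *\<^sub>R u" "t *\<^sub>R v"] that elim by simp
      also have "\<dots> \<le> t * (norm u + norm v)" using 1 by (simp add: algebra_simps)
      also have "\<dots> \<le> t * M" using Mb elim by (simp add: mult_left_mono)
      finally show "norm (s *\<^sub>R u + t *\<^sub>R v) \<le> t * M" .
      show "norm (s *\<^sub>R u) \<le> t * M" using 1 Mb elim that by (simp, smt (verit) mult_left_mono)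
    qed
    have inS: "a + s *\<^sub>R u + t *\<^sub>R v \<in> S" "a + s *\<^sub>R u \<in> S" if "0 \<le> s" "s \<le> t" for s
      using nrm[OF that] tM r(2) by (auto simp: subset_iff dist_norm norm_minus_commute add.assoc)
    let ?g = "\<lambda>s. f (a + s *\<^sub>R u + t *\<^sub>R v) - f (a + s *\<^sub>R u)"
    have der: "(?g has_derivative (\<lambda>h. f' (a + s *\<^sub>R u + t *\<^sub>R v) (h *\<^sub>R u) - f' (a + s *\<^sub>R u) (h *\<^sub>R u))) (at s)"
      if "0 \<le> s" "s \<le> t" for s
    proof (rule has_derivative_diff)
      have 1: "((\<lambda>s. a + s *\<^sub>R u + t *\<^sub>R v) has_derivative (\<lambda>h. h *\<^sub>R u)) (at s)"
        and 2: "((\<lambda>s. a + s *\<^sub>R u) has_derivative (\<lambda>h. h *\<^sub>R u)) (at s)"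
        by (auto intro!: derivative_eq_intros)
      show "((\<lambda>s. f (a + s *\<^sub>R u + t *\<^sub>R v)) has_derivative (\<lambda>h. f' (a + s *\<^sub>R u + t *\<^sub>R v) (h *\<^sub>R u))) (at s)"
        by (rule has_derivative_compose[OF 1]) (rule f[OF inS(1)[OF that]])
      show "((\<lambda>s. f (a + s *\<^sub>R u)) has_derivative (\<lambda>h. f' (a + s *\<^sub>R u) (h *\<^sub>R u))) (at s)"
        by (rule has_derivative_compose[OF 2]) (rule f[OF inS(2)[OF that]])
    qed
    have "\<exists>s\<in>{0<..<t}. ?g t - ?g 0 =
        f' (a + s *\<^sub>R u + t *\<^sub>R v) ((t - 0) *\<^sub>R u) - f' (a + s *\<^sub>R u) ((t - 0) *\<^sub>R u)"
      by (rule mvt_simple) (use elim(2) in simp, rule has_derivative_at_withinI, rule der)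
    then obtain s where s: "s \<in> {0<..<t}" and
      mv: "?g t - ?g 0 = f' (a + s *\<^sub>R u + t *\<^sub>R v) (t *\<^sub>R u) - f' (a + s *\<^sub>R u) (t *\<^sub>R u)"
      unfolding diff_zero by blast
    have s': "0 \<le> s" "s \<le> t" using s by auto
    have diff: "?g t - ?g 0 = t * (f' (a + s *\<^sub>R u + t *\<^sub>R v) u - f' (a + s *\<^sub>R u) u)"
      unfolding mv
      by (simp add: linear_cmul[OF has_derivative_linear[OF f[OF inS(1)[OF s']]]]
        linear_cmul[OF has_derivative_linear[OF f[OF inS(2)[OF s']]]] right_diff_distrib)
    let ?p = "a + s *\<^sub>R u + t *\<^sub>R v" and ?q = "a + s *\<^sub>R u"
    have p: "\<bar>f' ?p u - f' a u - D (s *\<^sub>R u + t *\<^sub>R v)\<bar> \<le> e' * (t * M)"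
      using dd[of ?p] nrm(1)[OF s'] tM e' by (simp add: add.assoc) (smt (verit) mult_left_mono)
    have q: "\<bar>f' ?q u - f' a u - D (s *\<^sub>R u)\<bar> \<le> e' * (t * M)"
      using dd[of ?q] nrm(2)[OF s'] tM e' by (simp add: add.assoc) (smt (verit) mult_left_mono)
    have "\<bar>f' ?p u - f' ?q u - t * D v\<bar> \<le> 2 * (e' * (t * M))"
      using p q by (simp add: D.add D.scaleR)
    also have "2 * (e' * (t * M)) = t * (e / 2)" using M by (simp add: e'_def field_simps)
    finally have "\<bar>f' ?p u - f' ?q u - t * D v\<bar> / t \<le> e / 2"
      using elim by (simp add: field_simps)
    moreover have "f (a + t *\<^sub>R u + t *\<^sub>R v) - f (a + t *\<^sub>R u) - f (a + t *\<^sub>R v) + f a = t * (f' ?p u - f' ?q u)"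
      using diff by simp
    then have "(f (a + t *\<^sub>R u + t *\<^sub>R v) - f (a + t *\<^sub>R u) - f (a + t *\<^sub>R v) + f a) / t\<^sup>2 - D v
        = (f' ?p u - f' ?q u - t * D v) / t"
      using elim(2) by (simp only: power2_eq_square) (simp add: divide_simps)
    ultimately show ?case
      using e elim(2) by (simp only: dist_real_def abs_divide abs_of_pos)
  qed
qed

text \<open>Symmetry holds because the mixed second difference does not change when \<open>u\<close> and \<open>v\<close> are
  exchanged.\<close>

lemma second_derivative_symmetric:
  fixes f :: "'e::euclidean_space \<Rightarrow> 'f::euclidean_space"
  assumes "open S" "a \<in> S"
    and f: "\<And>x. x \<in> S \<Longrightarrow> (f has_derivative f' x) (at x)"
    and u: "((\<lambda>x. f' x u) has_derivative Du) (at a)"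
    and v: "((\<lambda>x. f' x v) has_derivative Dv) (at a)"
  shows "Du v = Dv u"
proof (rule euclidean_eqI)
  fix b :: 'f
  let ?q = "\<lambda>u v t. (f (a + t *\<^sub>R u + t *\<^sub>R v) \<bullet> b - f (a + t *\<^sub>R u) \<bullet> b - f (a + t *\<^sub>R v) \<bullet> b + f a \<bullet> b) / t\<^sup>2"
  have 1: "(?q u v \<longlongrightarrow> Du v \<bullet> b) (at_right 0)"
    by (rule mixed_difference_limit[OF assms(1,2) has_derivative_inner_left[OF f] has_derivative_inner_left[OF u]])
  have "(?q v u \<longlongrightarrow> Dv u \<bullet> b) (at_right 0)"
    by (rule mixed_difference_limit[OF assms(1,2) has_derivative_inner_left[OF f] has_derivative_inner_left[OF v]])
  moreover have "?q v u = ?q u v" by (simp add: fun_eq_iff add.commute add.left_commute)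
  ultimately show "Du v \<bullet> b = Dv u \<bullet> b"
    using tendsto_unique[OF _ 1] by simp
qed

section \<open>Charts and derivatives on manifolds\<close>

lemma topspace_mtop: "topspace (mtop A) = points A"
proof -
  have "fst c = {p \<in> fst c. snd c p \<in> UNIV}" for c :: "('a, 'b) chart" by simp
  then have "\<exists>W. fst c = {p \<in> fst c. snd c p \<in> W} \<and> open W" for c :: "('a, 'b) chart" by blast
  then show ?thesis
    unfolding mtop_def topology_generated_by_topspace points_def by blast
qed

lemma openin_chart_set: "c \<in> A \<Longrightarrow> open W \<Longrightarrow> openin (mtop A) {p \<in> fst c. snd c p \<in> W}"
  unfolding mtop_def by (rule topology_generated_by_Basis) blast

lemma openin_chart_domain: "c \<in> A \<Longrightarrow> openin (mtop A) (fst c)"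
  using openin_chart_set[of c A UNIV] by simp

lemma chart_inv_left: "manifold A \<Longrightarrow> c \<in> A \<Longrightarrow> p \<in> fst c \<Longrightarrow> chart_inv c (snd c p) = p"
  unfolding manifold_def chart_inv_def by auto

lemma transition_open:
  "manifold A \<Longrightarrow> c \<in> A \<Longrightarrow> d \<in> A \<Longrightarrow> open (snd c ` (fst c \<inter> fst d))"
  unfolding manifold_def by auto

lemma transition_smooth:
  "manifold A \<Longrightarrow> c \<in> A \<Longrightarrow> d \<in> A \<Longrightarrow> smooth_on (snd c ` (fst c \<inter> fst d)) (transition c d)"
  unfolding manifold_def by auto

lemma chart_image_open: "manifold A \<Longrightarrow> c \<in> A \<Longrightarrow> open (snd c ` fst c)"
  using transition_open[of A c c] by simp

lemma transition_coord: "manifold A \<Longrightarrow> c \<in> A \<Longrightarrow> p \<in> fst c \<Longrightarrow> transition c d (snd c p) = snd d p"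
  by (simp add: transition_def chart_inv_left)

lemma chart_inj: "manifold A \<Longrightarrow> c \<in> A \<Longrightarrow> p \<in> fst c \<Longrightarrow> q \<in> fst c \<Longrightarrow> snd c p = snd c q \<Longrightarrow> p = q"
  by (metis chart_inv_left)

text \<open>The topology is generated by chart domains of all charts; this translates openness into any one
  chart, using that transition maps are continuous.\<close>

lemma openin_mtop_chart_image:
  assumes "manifold A" "openin (mtop A) U" "c \<in> A"
  shows "open (snd c ` (U \<inter> fst c))"
proof -
  have "generate_topology_on {{p \<in> fst c. snd c p \<in> W} |c W. c \<in> A \<and> open W} U"
    using assms(2) unfolding mtop_def openin_topology_generated_by_iff .
  then show ?thesis
  proof induction
    case (Int U V)
    have "snd c ` (U \<inter> V \<inter> fst c) = snd c ` (U \<inter> fst c) \<inter> snd c ` (V \<inter> fst c)"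
      using chart_inj[OF assms(1,3)] by auto
    then show ?case using Int.IH by auto
  next
    case (UN K)
    have "snd c ` (\<Union>K \<inter> fst c) = (\<Union>U\<in>K. snd c ` (U \<inter> fst c))" by auto
    then show ?case using UN.IH by auto
  next
    case (Basis U)
    then obtain d W where d: "d \<in> A" "open W" "U = {p \<in> fst d. snd d p \<in> W}" by blast
    have tc: "transition c d (snd c q) = snd d q" if "q \<in> fst c" for q
      by (rule transition_coord[OF assms(1,3) that])
    have "snd c ` (U \<inter> fst c) = snd c ` (fst c \<inter> fst d) \<inter> transition c d -` W"
      unfolding d(3) by (auto simp: tc)
    then show ?case
      using continuous_on_open_vimage[OF transition_open[OF assms(1,3) d(1)], of "transition c d"]
        smooth_on_continuous_on[OF transition_smooth[OF assms(1,3) d(1)]] d(2)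
      by (simp add: Int_commute)
  qed simp
qed

lemma openin_pointsD: "openin (mtop A) U \<Longrightarrow> p \<in> U \<Longrightarrow> p \<in> points A"
  using openin_subset[of "mtop A" U] by (auto simp: topspace_mtop)

lemma openin_points: "openin (mtop A) (points A)"
  using openin_topspace[of "mtop A"] by (simp add: topspace_mtop)

lemma chart_at_in: assumes "p \<in> points A" shows "chart_at A p \<in> A" "p \<in> fst (chart_at A p)"
proof -
  have "\<exists>c. c \<in> A \<and> p \<in> fst c" using assms unfolding points_def by auto
  from someI_ex[OF this] show "chart_at A p \<in> A" "p \<in> fst (chart_at A p)"
    unfolding chart_at_def by auto
qed

lemma smooth_map_onE:
  assumes "smooth_map_on A B S f" "p \<in> S"
  obtains c d W F where "c \<in> A" "p \<in> fst c" "d \<in> B" "f p \<in> fst d" "open W" "snd c p \<in> W"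
    "W \<subseteq> snd c ` fst c" "smooth_on W F"
    "\<And>q. q \<in> S \<Longrightarrow> q \<in> fst c \<Longrightarrow> snd c q \<in> W \<Longrightarrow> f q \<in> fst d \<and> snd d (f q) = F (snd c q)"
proof -
  obtain c where c: "c \<in> A" and 1: "\<exists>d\<in>B. \<exists>W F. p \<in> fst c \<and> f p \<in> fst d \<and> open W \<and> snd c p \<in> W \<and> W \<subseteq> snd c ` fst c \<and>
      smooth_on W F \<and> (\<forall>q\<in>S \<inter> fst c. snd c q \<in> W \<longrightarrow> f q \<in> fst d \<and> snd d (f q) = F (snd c q))"
    using bspec[OF assms(1)[unfolded smooth_map_on_def] assms(2)] by (rule bexE)
  from 1 obtain d where d: "d \<in> B" and 2: "\<exists>W F. p \<in> fst c \<and> f p \<in> fst d \<and> open W \<and> snd c p \<in> W \<and> W \<subseteq> snd c ` fst c \<and>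
      smooth_on W F \<and> (\<forall>q\<in>S \<inter> fst c. snd c q \<in> W \<longrightarrow> f q \<in> fst d \<and> snd d (f q) = F (snd c q))"
    by (rule bexE)
  from 2 obtain W F where "p \<in> fst c" "f p \<in> fst d" "open W" "snd c p \<in> W" "W \<subseteq> snd c ` fst c" "smooth_on W F"
    and 3: "\<forall>q\<in>S \<inter> fst c. snd c q \<in> W \<longrightarrow> f q \<in> fst d \<and> snd d (f q) = F (snd c q)"
    by (elim exE conjE)
  then show thesis using that[OF c _ d] by simp
qed

lemma smooth_map_onI:
  assumes "\<And>p. p \<in> S \<Longrightarrow> \<exists>c d W F. c \<in> A \<and> p \<in> fst c \<and> d \<in> B \<and> f p \<in> fst d \<and> open W \<and> snd c p \<in> W \<and>
      W \<subseteq> snd c ` fst c \<and> smooth_on W F \<and>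
      (\<forall>q. q \<in> S \<longrightarrow> q \<in> fst c \<longrightarrow> snd c q \<in> W \<longrightarrow> f q \<in> fst d \<and> snd d (f q) = F (snd c q))"
  shows "smooth_map_on A B S f"
  unfolding smooth_map_on_def
proof (rule ballI)
  fix p assume "p \<in> S"
  from assms[OF this] obtain c d W F where w: "c \<in> A" "d \<in> B" and 1: "p \<in> fst c" "f p \<in> fst d" "open W" "snd c p \<in> W"
    "W \<subseteq> snd c ` fst c" "smooth_on W F"
    "\<forall>q. q \<in> S \<longrightarrow> q \<in> fst c \<longrightarrow> snd c q \<in> W \<longrightarrow> f q \<in> fst d \<and> snd d (f q) = F (snd c q)"
    by (elim exE conjE)
  show "\<exists>c\<in>A. \<exists>d\<in>B. \<exists>W F. p \<in> fst c \<and> f p \<in> fst d \<and> open W \<and> snd c p \<in> W \<and> W \<subseteq> snd c ` fst c \<and>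
      smooth_on W F \<and> (\<forall>q\<in>S \<inter> fst c. snd c q \<in> W \<longrightarrow> f q \<in> fst d \<and> snd d (f q) = F (snd c q))"
    by (rule bexI[OF _ w(1)], rule bexI[OF _ w(2)], rule exI[of _ W], rule exI[of _ F])
      (use 1 in simp)
qed

lemma smooth_map_on_in_points: 
  assumes "smooth_map_on A B S f" "p \<in> S" shows "f p \<in> points B"
proof -
  obtain d where "d \<in> B" "f p \<in> fst d" by (rule smooth_map_onE[OF assms]) (rule that)
  then show ?thesis by (auto simp only: points_def)
qed

lemma smooth_map_on_subset: 
  assumes "smooth_map_on A B S f" "T \<subseteq> S" 
  shows "smooth_map_on A B T f"
proof (rule smooth_map_onI)
  fix p assume "p \<in> T"
  then have p: "p \<in> S" using assms(2) by (rule rev_subsetD)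
  obtain c d W F where w: "c \<in> A" "p \<in> fst c" "d \<in> B" "f p \<in> fst d" "open W" "snd c p \<in> W"
    "W \<subseteq> snd c ` fst c" "smooth_on W F"
    "\<And>q. q \<in> S \<Longrightarrow> q \<in> fst c \<Longrightarrow> snd c q \<in> W \<Longrightarrow> f q \<in> fst d \<and> snd d (f q) = F (snd c q)"
    by (rule smooth_map_onE[OF assms(1) p]) (rule that)
  have "\<forall>q. q \<in> T \<longrightarrow> q \<in> fst c \<longrightarrow> snd c q \<in> W \<longrightarrow> f q \<in> fst d \<and> snd d (f q) = F (snd c q)"
    using w(9) subsetD[OF assms(2)] by simp
  with w(1-8) show "\<exists>c d W F. c \<in> A \<and> p \<in> fst c \<and> d \<in> B \<and> f p \<in> fst d \<and> open W \<and> snd c p \<in> W \<and>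
      W \<subseteq> snd c ` fst c \<and> smooth_on W F \<and>
      (\<forall>q. q \<in> T \<longrightarrow> q \<in> fst c \<longrightarrow> snd c q \<in> W \<longrightarrow> f q \<in> fst d \<and> snd d (f q) = F (snd c q))"
    by (intro exI conjI)
qed

text \<open>Smoothness is witnessed by some pair of charts at each point; by smoothness of the transition maps any
  other pair of charts serves as well, on a smaller neighbourhood.\<close>

lemma smooth_map_on_chart:
  assumes A: "manifold A" and B: "manifold B" and S: "openin (mtop A) S"
    and f: "smooth_map_on A B S f"
    and p: "p \<in> S" and c: "c \<in> A" "p \<in> fst c" and d: "d \<in> B" "f p \<in> fst d"
  obtains W where "open W" "snd c p \<in> W" "W \<subseteq> snd c ` (S \<inter> fst c)"
    "\<And>y. y \<in> W \<Longrightarrow> f (chart_inv c y) \<in> fst d" "smooth_on W (snd d \<circ> f \<circ> chart_inv c)"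
proof -
  obtain c0 d0 W0 F where 0: "c0 \<in> A" "d0 \<in> B" "p \<in> fst c0" "f p \<in> fst d0"
        "open W0" "snd c0 p \<in> W0" "W0 \<subseteq> snd c0 ` fst c0" "smooth_on W0 F"
    and F: "\<And>q. q \<in> S \<Longrightarrow> q \<in> fst c0 \<Longrightarrow> snd c0 q \<in> W0 \<Longrightarrow> f q \<in> fst d0 \<and> snd d0 (f q) = F (snd c0 q)"
    by (rule smooth_map_onE[OF f p]) (rule that)
  define U where "U = S \<inter> {q \<in> fst c0. snd c0 q \<in> W0}"
  define W1 where "W1 = snd c ` (U \<inter> fst c)"
  have W1: "open W1" unfolding W1_def U_def
    using openin_mtop_chart_image[OF A _ c(1)] openin_Int[OF S openin_chart_set[OF 0(1,5)]] by blast
  have q: "chart_inv c y \<in> S" "chart_inv c y \<in> fst c0" "chart_inv c y \<in> fst c" "snd c (chart_inv c y) = y"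
      "transition c c0 y \<in> W0" "transition c c0 y = snd c0 (chart_inv c y)" if "y \<in> W1" for y
    using that chart_inv_left[OF A c(1)] unfolding W1_def U_def by (auto simp: transition_def)
  have sub: "W1 \<subseteq> snd c ` (fst c \<inter> fst c0)" unfolding W1_def U_def by auto
  have sm: "smooth_on W1 (F \<circ> transition c c0)"
    by (rule smooth_on_compose[OF W1 0(5) _ smooth_on_subset[OF transition_smooth[OF A c(1) 0(1)] sub] 0(8)])
       (use q in auto)
  define W where "W = W1 \<inter> (F \<circ> transition c c0) -` (snd d0 ` (fst d0 \<inter> fst d))"
  have W: "open W" unfolding W_def
    using continuous_on_open_vimage[OF W1, of "F \<circ> transition c c0"] smooth_on_continuous_on[OF sm]
      transition_open[OF B 0(2) d(1)] by (simp add: Int_commute)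
  have fd: "f (chart_inv c y) \<in> fst d0" "snd d0 (f (chart_inv c y)) = F (transition c c0 y)" if "y \<in> W1" for y
    using F[OF q(1,2)[OF that]] q(5,6)[OF that] by auto
  have fd': "f (chart_inv c y) \<in> fst d" if "y \<in> W" for y
  proof -
    have y: "y \<in> W1" using that W_def by auto
    have "snd d0 (f (chart_inv c y)) \<in> snd d0 ` (fst d0 \<inter> fst d)"
      using that fd(2)[OF y] by (simp add: W_def)
    then obtain r where r: "snd d0 (f (chart_inv c y)) = snd d0 r" "r \<in> fst d0 \<inter> fst d"
      by (rule imageE)
    then have "f (chart_inv c y) = r" using chart_inj[OF B 0(2) fd(1)[OF y] _ r(1)] by blast
    then show ?thesis using r(2) by simp
  qed
  have "smooth_on W (transition d0 d \<circ> (F \<circ> transition c c0))"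
    by (rule smooth_on_compose[OF W transition_open[OF B 0(2) d(1)] _ smooth_on_subset[OF sm]
          transition_smooth[OF B 0(2) d(1)]]) (auto simp: W_def)
  then have "smooth_on W (snd d \<circ> f \<circ> chart_inv c)"
  proof (rule smooth_on_cong[OF W, rotated])
    fix y assume "y \<in> W"
    then have y: "y \<in> W1" by (simp add: W_def)
    show "(transition d0 d \<circ> (F \<circ> transition c c0)) y = (snd d \<circ> f \<circ> chart_inv c) y"
      using transition_coord[OF B 0(2) fd(1)[OF y], of d] fd(2)[OF y] by simp
  qed
  moreover have pW: "snd c p \<in> W"
  proof -
    have p1: "snd c p \<in> W1" unfolding W1_def U_def using p c 0 by auto
    have "F (transition c c0 (snd c p)) = snd d0 (f p)"
      using fd(2)[OF p1] chart_inv_left[OF A c] by simp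
    then show ?thesis unfolding W_def using p1 d(2) 0(4) by auto
  qed
  moreover have "W \<subseteq> snd c ` (S \<inter> fst c)" unfolding W_def W1_def U_def by auto
  ultimately show ?thesis using that W fd' by blast
qed

lemma smooth_map_on_openin_vimage:
  assumes A: "manifold A" and B: "manifold B" and S: "openin (mtop A) S"
    and f: "smooth_map_on A B S f" and V: "openin (mtop B) V"
  shows "openin (mtop A) {p \<in> S. f p \<in> V}"
proof (subst openin_subopen, intro ballI)
  fix p assume "p \<in> {p \<in> S. f p \<in> V}"
  then have p: "p \<in> S" "f p \<in> V" by auto
  have pA: "p \<in> points A" and fB: "f p \<in> points B" using openin_pointsD[OF S p(1)] openin_pointsD[OF V p(2)] by simp_all
  define c d where cd: "c = chart_at A p" "d = chart_at B (f p)"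
  have c: "c \<in> A" "p \<in> fst c" and d: "d \<in> B" "f p \<in> fst d"
    using chart_at_in[OF pA] chart_at_in[OF fB] by (auto simp: cd)
  obtain W where W: "open W" "snd c p \<in> W" "W \<subseteq> snd c ` (S \<inter> fst c)"
    "\<And>y. y \<in> W \<Longrightarrow> f (chart_inv c y) \<in> fst d" "smooth_on W (snd d \<circ> f \<circ> chart_inv c)"
    by (rule smooth_map_on_chart[OF A B S f p(1) c d]) (rule that)
  define W' where "W' = (snd d \<circ> f \<circ> chart_inv c) -` (snd d ` (V \<inter> fst d)) \<inter> W"
  have W': "open W'" unfolding W'_def
    using continuous_on_open_vimage[OF W(1)] smooth_on_continuous_on[OF W(5)] openin_mtop_chart_image[OF B V d(1)]
    by blast
  have "openin (mtop A) {q \<in> fst c. snd c q \<in> W'}" by (rule openin_chart_set[OF c(1) W'])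
  moreover have "p \<in> {q \<in> fst c. snd c q \<in> W'}"
    using c d p W(2) by (auto simp: W'_def chart_inv_left[OF A c])
  moreover have "{q \<in> fst c. snd c q \<in> W'} \<subseteq> {p \<in> S. f p \<in> V}"
  proof
    fix q assume "q \<in> {q \<in> fst c. snd c q \<in> W'}"
    then have q: "q \<in> fst c" "snd c q \<in> W" "snd d (f q) \<in> snd d ` (V \<inter> fst d)"
      by (auto simp: W'_def chart_inv_left[OF A c(1)])
    obtain s where "s \<in> S \<inter> fst c" "snd c q = snd c s" using W(3) q(2) by auto
    then have "q \<in> S" using chart_inj[OF A c(1)] q(1) by auto
    moreover have "f q \<in> fst d" using W(4)[OF q(2)] chart_inv_left[OF A c(1) q(1)] by simp
    then have "f q \<in> V" using q(3) chart_inj[OF B d(1)] by auto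
    ultimately show "q \<in> {p \<in> S. f p \<in> V}" by simp
  qed
  ultimately show "\<exists>T. openin (mtop A) T \<and> p \<in> T \<and> T \<subseteq> {p \<in> S. f p \<in> V}" by blast
qed

lemma smooth_map_on_compose:
  assumes A: "manifold A" and B: "manifold B" and C: "manifold C"
    and S: "openin (mtop A) S" and T: "openin (mtop B) T"
    and f: "smooth_map_on A B S f" and g: "smooth_map_on B C T g" and sub: "f ` S \<subseteq> T"
  shows "smooth_map_on A C S (g \<circ> f)"
proof (rule smooth_map_onI)
  fix p assume p: "p \<in> S"
  have pA: "p \<in> points A" by (rule openin_pointsD[OF S p])
  have fpT: "f p \<in> T" using sub p by auto
  have pB: "f p \<in> points B" by (rule smooth_map_on_in_points[OF f p])
  have pC: "g (f p) \<in> points C" by (rule smooth_map_on_in_points[OF g fpT])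
  define c d e where cde: "c = chart_at A p" "d = chart_at B (f p)" "e = chart_at C (g (f p))"
  have c: "c \<in> A" "p \<in> fst c" and d: "d \<in> B" "f p \<in> fst d" and e: "e \<in> C" "g (f p) \<in> fst e"
    using chart_at_in[OF pA] chart_at_in[OF pB] chart_at_in[OF pC] by (auto simp: cde)
  obtain W where W: "open W" "snd c p \<in> W" "W \<subseteq> snd c ` (S \<inter> fst c)"
    "\<And>y. y \<in> W \<Longrightarrow> f (chart_inv c y) \<in> fst d" "smooth_on W (snd d \<circ> f \<circ> chart_inv c)"
    by (rule smooth_map_on_chart[OF A B S f p c d]) (rule that)
  obtain W1 where W1: "open W1" "snd d (f p) \<in> W1" "W1 \<subseteq> snd d ` (T \<inter> fst d)"
    "\<And>y. y \<in> W1 \<Longrightarrow> g (chart_inv d y) \<in> fst e" "smooth_on W1 (snd e \<circ> g \<circ> chart_inv d)"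
    by (rule smooth_map_on_chart[OF B C T g fpT d e]) (rule that)
  define W' where "W' = (snd d \<circ> f \<circ> chart_inv c) -` W1 \<inter> W"
  have W': "open W'" unfolding W'_def
    using continuous_on_open_vimage[OF W(1)] smooth_on_continuous_on[OF W(5)] W1(1) by blast
  have sm: "smooth_on W' ((snd e \<circ> g \<circ> chart_inv d) \<circ> (snd d \<circ> f \<circ> chart_inv c))"
    by (rule smooth_on_compose[OF W' W1(1) _ smooth_on_subset[OF W(5)] W1(5)]) (auto simp: W'_def)
  have val: "g (f q) \<in> fst e \<and> snd e (g (f q)) = ((snd e \<circ> g \<circ> chart_inv d) \<circ> (snd d \<circ> f \<circ> chart_inv c)) (snd c q)"
    if "q \<in> fst c" "snd c q \<in> W'" for q
  proof -
    have y: "snd c q \<in> W" "snd d (f q) \<in> W1" using that chart_inv_left[OF A c(1) that(1)] by (auto simp: W'_def)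
    have "f q \<in> fst d" using W(4)[OF y(1)] chart_inv_left[OF A c(1) that(1)] by simp
    then show ?thesis using W1(4)[OF y(2)] chart_inv_left[OF B d(1)] chart_inv_left[OF A c(1) that(1)] by simp
  qed
  have sub': "W' \<subseteq> snd c ` fst c" and pW: "snd c p \<in> W'" using W(2,3) W1(2) by (auto simp: W'_def chart_inv_left[OF A c])
  show "\<exists>c d W F. c \<in> A \<and> p \<in> fst c \<and> d \<in> C \<and> (g \<circ> f) p \<in> fst d \<and> open W \<and> snd c p \<in> W \<and>
      W \<subseteq> snd c ` fst c \<and> smooth_on W F \<and>
      (\<forall>q. q \<in> S \<longrightarrow> q \<in> fst c \<longrightarrow> snd c q \<in> W \<longrightarrow> (g \<circ> f) q \<in> fst d \<and> snd d ((g \<circ> f) q) = F (snd c q))"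
    by (rule exI[of _ c], rule exI[of _ e], rule exI[of _ W'], rule exI[of _ "(snd e \<circ> g \<circ> chart_inv d) \<circ> (snd d \<circ> f \<circ> chart_inv c)"])
       (use c e W' pW sub' sm val in \<open>simp del: comp_apply add: comp_apply[of g f]\<close>)
qed

text \<open>This is how the multiplication of a groupoid is composed with sections. The composable pairs do not form an
  open set, so \<open>smooth_map_on_chart\<close> is applied only to \<open>f1\<close> and \<open>f2\<close>, in the charts witnessing
  smoothness of \<open>g\<close>.\<close>

lemma smooth_map_on_compose_pair:
  assumes A: "manifold A" and B1: "manifold B1" and B2: "manifold B2" and S: "openin (mtop A) S"
    and f1: "smooth_map_on A B1 S f1" and f2: "smooth_map_on A B2 S f2"
    and g: "smooth_map_on (prod_atlas B1 B2) C T g" and sub: "\<And>p. p \<in> S \<Longrightarrow> (f1 p, f2 p) \<in> T"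
  shows "smooth_map_on A C S (\<lambda>p. g (f1 p, f2 p))"
proof (rule smooth_map_onI)
  fix p assume p: "p \<in> S"
  have pA: "p \<in> points A" by (rule openin_pointsD[OF S p])
  define c where "c = chart_at A p"
  have c: "c \<in> A" "p \<in> fst c" using chart_at_in[OF pA] by (auto simp: c_def)
  obtain d e W0 F where d: "d \<in> prod_atlas B1 B2" and e: "e \<in> C" "g (f1 p, f2 p) \<in> fst e" and
    pd: "(f1 p, f2 p) \<in> fst d" and W0: "open W0" "snd d (f1 p, f2 p) \<in> W0" "smooth_on W0 F"
    and F: "\<And>q. q \<in> T \<Longrightarrow> q \<in> fst d \<Longrightarrow> snd d q \<in> W0 \<Longrightarrow> g q \<in> fst e \<and> snd e (g q) = F (snd d q)"
    by (rule smooth_map_onE[OF g sub[OF p]]) (rule that)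
  obtain d1 d2 where d12: "d1 \<in> B1" "d2 \<in> B2" "d = (fst d1 \<times> fst d2, map_prod (snd d1) (snd d2))"
    using d unfolding prod_atlas_def by blast
  have pd1: "f1 p \<in> fst d1" and pd2: "f2 p \<in> fst d2" using pd d12(3) by simp_all
  obtain W1 where W1: "open W1" "snd c p \<in> W1" "W1 \<subseteq> snd c ` (S \<inter> fst c)"
    "\<And>y. y \<in> W1 \<Longrightarrow> f1 (chart_inv c y) \<in> fst d1" "smooth_on W1 (snd d1 \<circ> f1 \<circ> chart_inv c)"
    by (rule smooth_map_on_chart[OF A B1 S f1 p c d12(1) pd1]) (rule that)
  obtain W2 where W2: "open W2" "snd c p \<in> W2" "W2 \<subseteq> snd c ` (S \<inter> fst c)"
    "\<And>y. y \<in> W2 \<Longrightarrow> f2 (chart_inv c y) \<in> fst d2" "smooth_on W2 (snd d2 \<circ> f2 \<circ> chart_inv c)"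
    by (rule smooth_map_on_chart[OF A B2 S f2 p c d12(2) pd2]) (rule that)
  define h where "h = (\<lambda>y. ((snd d1 \<circ> f1 \<circ> chart_inv c) y, (snd d2 \<circ> f2 \<circ> chart_inv c) y))"
  have o: "open (W1 \<inter> W2)" by (rule open_Int[OF W1(1) W2(1)])
  have h: "smooth_on (W1 \<inter> W2) h" unfolding h_def
    by (rule smooth_on_Pair[OF o smooth_on_subset[OF W1(5)] smooth_on_subset[OF W2(5)]]) auto
  define W' where "W' = h -` W0 \<inter> (W1 \<inter> W2)"
  have W': "open W'" unfolding W'_def
    using continuous_on_open_vimage[OF o] smooth_on_continuous_on[OF h] W0(1) by blast
  have sm: "smooth_on W' (F \<circ> h)"
    by (rule smooth_on_compose[OF W' W0(1) _ smooth_on_subset[OF h] W0(3)]) (auto simp: W'_def)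
  have val: "g (f1 q, f2 q) \<in> fst e \<and> snd e (g (f1 q, f2 q)) = (F \<circ> h) (snd c q)"
    if "q \<in> S" "q \<in> fst c" "snd c q \<in> W'" for q
  proof -
    note cq = chart_inv_left[OF A c(1) that(2)]
    have "f1 q \<in> fst d1" "f2 q \<in> fst d2" "h (snd c q) = snd d (f1 q, f2 q)" "h (snd c q) \<in> W0"
      using W1(4)[of "snd c q"] W2(4)[of "snd c q"] that(3) by (simp_all add: W'_def cq h_def d12(3))
    then show ?thesis using F[OF sub[OF that(1)]] by (simp add: d12(3))
  qed
  have sub': "W' \<subseteq> snd c ` fst c" using W1(3) by (auto simp: W'_def)
  have pW: "snd c p \<in> W'" using W1(2) W2(2) W0(2) by (simp add: W'_def h_def chart_inv_left[OF A c] d12(3))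
  show "\<exists>c d W F. c \<in> A \<and> p \<in> fst c \<and> d \<in> C \<and> g (f1 p, f2 p) \<in> fst d \<and> open W \<and> snd c p \<in> W \<and>
      W \<subseteq> snd c ` fst c \<and> smooth_on W F \<and>
      (\<forall>q. q \<in> S \<longrightarrow> q \<in> fst c \<longrightarrow> snd c q \<in> W \<longrightarrow> g (f1 q, f2 q) \<in> fst d \<and> snd d (g (f1 q, f2 q)) = F (snd c q))"
    by (rule exI[of _ c], rule exI[of _ e], rule exI[of _ W'], rule exI[of _ "F \<circ> h"])
       (use c e W' pW sub' sm val in simp)
qed

lemma smooth_map_on_ident:
  assumes A: "manifold A" and S: "S \<subseteq> points A"
  shows "smooth_map_on A A S (\<lambda>x. x)"
proof (rule smooth_map_onI)
  fix p assume "p \<in> S"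
  then have pA: "p \<in> points A" using S by auto
  note c = chart_at_in[OF pA]
  show "\<exists>c d W F. c \<in> A \<and> p \<in> fst c \<and> d \<in> A \<and> p \<in> fst d \<and> open W \<and> snd c p \<in> W \<and>
      W \<subseteq> snd c ` fst c \<and> smooth_on W F \<and>
      (\<forall>q. q \<in> S \<longrightarrow> q \<in> fst c \<longrightarrow> snd c q \<in> W \<longrightarrow> q \<in> fst d \<and> snd d (q) = F (snd c q))"
    by (rule exI[of _ "chart_at A p"], rule exI[of _ "chart_at A p"],
        rule exI[of _ "snd (chart_at A p) ` fst (chart_at A p)"], rule exI[of _ "\<lambda>x. x"])
       (use c chart_image_open[OF A c(1)] smooth_on_ident[OF chart_image_open[OF A c(1)]] in simp)
qed

lemma chart_rep_has_derivative:
  assumes A: "manifold A" and B: "manifold B" and S: "openin (mtop A) S"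
    and f: "smooth_map_on A B S f" and p: "p \<in> S"
  shows "(snd (chart_at B (f p)) \<circ> f \<circ> chart_inv (chart_at A p) has_derivative mderiv A B f p)
           (at (snd (chart_at A p) p))"
proof -
  have pA: "p \<in> points A" and pB: "f p \<in> points B"
    using p openin_pointsD[OF S] smooth_map_on_in_points[OF f] by auto
  show ?thesis
    unfolding mderiv_def
    by (rule smooth_map_on_chart[OF A B S f p chart_at_in[OF pA] chart_at_in[OF pB]])
       (rule smooth_on_has_derivative)
qed

lemma mderivI:
  "(snd (chart_at B (f p)) \<circ> f \<circ> chart_inv (chart_at A p) has_derivative L) (at (snd (chart_at A p) p))
    \<Longrightarrow> mderiv A B f p = L"
  unfolding mderiv_def by (rule frechet_derivative_eqI)

lemma mderiv_compose:
  assumes A: "manifold A" and B: "manifold B" and C: "manifold C"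
    and S: "openin (mtop A) S" and T: "openin (mtop B) T"
    and f: "smooth_map_on A B S f" and g: "smooth_map_on B C T g" and p: "p \<in> S" "f p \<in> T"
  shows "mderiv A C (g \<circ> f) p = mderiv B C g (f p) \<circ> mderiv A B f p"
proof (rule mderivI)
  have pA: "p \<in> points A" by (rule openin_pointsD[OF S p(1)])
  have pB: "f p \<in> points B" by (rule smooth_map_on_in_points[OF f p(1)])
  define c d e where cde: "c = chart_at A p" "d = chart_at B (f p)" "e = chart_at C (g (f p))"
  have c: "c \<in> A" "p \<in> fst c" and d: "d \<in> B" "f p \<in> fst d"
    using chart_at_in[OF pA] chart_at_in[OF pB] by (auto simp: cde)
  obtain W where W: "open W" "snd c p \<in> W" "W \<subseteq> snd c ` (S \<inter> fst c)"
    "\<And>y. y \<in> W \<Longrightarrow> f (chart_inv c y) \<in> fst d" "smooth_on W (snd d \<circ> f \<circ> chart_inv c)"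
    by (rule smooth_map_on_chart[OF A B S f p(1) c d]) (rule that)
  have 1: "(snd d \<circ> f \<circ> chart_inv c has_derivative mderiv A B f p) (at (snd c p))"
    using chart_rep_has_derivative[OF A B S f p(1)] by (simp add: cde)
  have 2: "(snd e \<circ> g \<circ> chart_inv d has_derivative mderiv B C g (f p)) (at ((snd d \<circ> f \<circ> chart_inv c) (snd c p)))"
    using chart_rep_has_derivative[OF B C T g p(2)] chart_inv_left[OF A c] by (simp add: cde)
  show "(snd (chart_at C ((g \<circ> f) p)) \<circ> (g \<circ> f) \<circ> chart_inv (chart_at A p) has_derivative
         mderiv B C g (f p) \<circ> mderiv A B f p) (at (snd (chart_at A p) p))"
    unfolding cde(1)[symmetric]
    by (rule has_derivative_transform_within_open[OF diff_chain_at[OF 1 2] W(1,2)])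
       (use chart_inv_left[OF B d(1) W(4)] in \<open>simp add: cde\<close>)
qed

lemma mderiv_cong:
  assumes A: "manifold A" and B: "manifold B" and S: "openin (mtop A) S"
    and f: "smooth_map_on A B S f" and T: "openin (mtop A) T" "p \<in> T" "p \<in> S" and eq: "\<And>q. q \<in> T \<Longrightarrow> f q = g q"
  shows "mderiv A B f p = mderiv A B g p"
proof (rule mderivI[THEN sym])
  have pA: "p \<in> points A" by (rule openin_pointsD[OF T(1,2)])
  note c = chart_at_in[OF pA]
  let ?c = "chart_at A p"
  have o: "open (snd ?c ` (T \<inter> fst ?c))" "snd ?c p \<in> snd ?c ` (T \<inter> fst ?c)"
    using openin_mtop_chart_image[OF A T(1) c(1)] T(2) c(2) by auto
  show "(snd (chart_at B (g p)) \<circ> g \<circ> chart_inv (chart_at A p) has_derivative mderiv A B f p) (at (snd (chart_at A p) p))"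
    by (rule has_derivative_transform_within_open[OF chart_rep_has_derivative[OF A B S f T(3)] o])
       (use eq eq[OF T(2)] chart_inv_left[OF A c(1)] in auto)
qed

lemma mderiv_ident:
  assumes A: "manifold A" and p: "p \<in> points A"
  shows "mderiv A A (\<lambda>x. x) p = id"
proof (rule mderivI)
  note c = chart_at_in[OF p]
  show "(snd (chart_at A p) \<circ> (\<lambda>x. x) \<circ> chart_inv (chart_at A p) has_derivative id) (at (snd (chart_at A p) p))"
    by (rule has_derivative_transform_within_open[OF has_derivative_id chart_image_open[OF A c(1)]])
       (use c in \<open>auto simp: chart_inv_left[OF A]\<close>)
qed

lemma mderiv_linear:
  assumes "manifold A" "manifold B" "smooth_map A B f" "p \<in> points A"
  shows "linear (mderiv A B f p)"
  by (rule has_derivative_linear[OF chart_rep_has_derivative[OF assms(1,2) openin_points assms(3,4)]])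

lemma transition_has_derivative:
  assumes A: "manifold A" and c: "c \<in> A" "d \<in> A" "p \<in> fst c" "p \<in> fst d"
  shows "(transition c d has_derivative frechet_derivative (transition c d) (at (snd c p))) (at (snd c p))"
  by (rule smooth_on_has_derivative[OF transition_smooth[OF A c(1,2)] transition_open[OF A c(1,2)]]) (use c in auto)

lemma transition_deriv_inverse:
  assumes A: "manifold A" and c: "c \<in> A" "d \<in> A" "p \<in> fst c" "p \<in> fst d"
  shows "frechet_derivative (transition d c) (at (snd d p)) \<circ> frechet_derivative (transition c d) (at (snd c p)) = id"
proof (rule has_derivative_unique)
  show "(transition d c \<circ> transition c d has_derivative
      frechet_derivative (transition d c) (at (snd d p)) \<circ> frechet_derivative (transition c d) (at (snd c p))) (at (snd c p))"
    by (rule diff_chain_at[OF transition_has_derivative[OF A c]])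
       (simp only: transition_coord[OF A c(1,3)] transition_has_derivative[OF A c(2,1,4,3)])
  have "transition d c (transition c d (snd c q)) = snd c q" if "q \<in> fst c" "q \<in> fst d" for q
    by (simp only: transition_coord[OF A c(1) that(1)] transition_coord[OF A c(2) that(2)])
  then show "(transition d c \<circ> transition c d has_derivative id) (at (snd c p))"
    by (intro has_derivative_transform_within_open[OF has_derivative_id transition_open[OF A c(1,2)]])
       (use c in auto)
qed

lemma coord_deriv_linear: "manifold A \<Longrightarrow> c \<in> A \<Longrightarrow> p \<in> fst c \<Longrightarrow> linear (coord_deriv A c p)"
proof -
  assume a: "manifold A" "c \<in> A" "p \<in> fst c"
  then have p: "p \<in> points A" by (auto simp: points_def)
  show ?thesis using transition_has_derivative[OF a(1) chart_at_in(1)[OF p] a(2) chart_at_in(2)[OF p] a(3)]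
    unfolding coord_deriv_def by (rule has_derivative_linear)
qed

lemma coord_deriv_bij:
  assumes a: "manifold A" "c \<in> A" "p \<in> fst c"
  shows "bij (coord_deriv A c p)" 
    "inv (coord_deriv A c p) = frechet_derivative (transition c (chart_at A p)) (at (snd c p))"
proof -
  have p: "p \<in> points A" using a by (auto simp: points_def)
  note c = chart_at_in[OF p]
  note i = transition_deriv_inverse[OF a(1) c(1) a(2) c(2) a(3)] transition_deriv_inverse[OF a(1) a(2) c(1) a(3) c(2)]
  show "bij (coord_deriv A c p)" unfolding coord_deriv_def using i o_bij by blast
  show "inv (coord_deriv A c p) = frechet_derivative (transition c (chart_at A p)) (at (snd c p))"
    unfolding coord_deriv_def by (rule inv_unique_comp[OF i(2) i(1)])
qed

text \<open>Relates \<^const>\<open>mderiv\<close>, which refers to the preferred charts, to the coordinate expression in arbitrary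
  charts. It is needed since a frame of a distribution comes with a chart of its own.\<close>

lemma chart_rep_deriv:
  assumes A: "manifold A" and B: "manifold B" and S: "openin (mtop A) S"
    and f: "smooth_map_on A B S f" and p: "p \<in> S" and c: "c \<in> A" "p \<in> fst c" and d: "d \<in> B" "f p \<in> fst d"
  shows "(snd d \<circ> f \<circ> chart_inv c has_derivative
           coord_deriv B d (f p) \<circ> mderiv A B f p \<circ> inv (coord_deriv A c p)) (at (snd c p))"
proof -
  have pA: "p \<in> points A" and pB: "f p \<in> points B"
    using p openin_pointsD[OF S] smooth_map_on_in_points[OF f] by auto
  let ?c = "chart_at A p" and ?d = "chart_at B (f p)"
  note c' = chart_at_in[OF pA] and d' = chart_at_in[OF pB]
  have 1: "(transition c ?c has_derivative inv (coord_deriv A c p)) (at (snd c p))"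
    unfolding coord_deriv_bij(2)[OF A c] by (rule transition_has_derivative[OF A c(1) c'(1) c(2) c'(2)])
  have 2: "(snd ?d \<circ> f \<circ> chart_inv ?c has_derivative mderiv A B f p) (at (transition c ?c (snd c p)))"
    using chart_rep_has_derivative[OF A B S f p] transition_coord[OF A c, of ?c] by simp
  have 3: "(transition ?d d has_derivative coord_deriv B d (f p)) (at (((snd ?d \<circ> f \<circ> chart_inv ?c) \<circ> transition c ?c) (snd c p)))"
    unfolding coord_deriv_def 
    using transition_has_derivative[OF B d'(1) d(1) d'(2) d(2)] transition_coord[OF A c, of ?c] chart_inv_left[OF A c'] by simp
  have 4: "(transition ?d d \<circ> ((snd ?d \<circ> f \<circ> chart_inv ?c) \<circ> transition c ?c) has_derivative
      coord_deriv B d (f p) \<circ> (mderiv A B f p \<circ> inv (coord_deriv A c p))) (at (snd c p))"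
    by (rule diff_chain_at[OF diff_chain_at[OF 1 2] 3])
  define U where "U = {q \<in> S. f q \<in> fst ?d} \<inter> fst ?c"
  have U: "openin (mtop A) U" unfolding U_def
    using smooth_map_on_openin_vimage[OF A B S f openin_chart_domain[OF d'(1)]] openin_chart_domain[OF c'(1)] by blast
  have o: "open (snd c ` (U \<inter> fst c))" "snd c p \<in> snd c ` (U \<inter> fst c)"
    using openin_mtop_chart_image[OF A U c(1)] p c c' d' by (auto simp: U_def)
  have "(snd d \<circ> f \<circ> chart_inv c has_derivative
      coord_deriv B d (f p) \<circ> (mderiv A B f p \<circ> inv (coord_deriv A c p))) (at (snd c p))"
  proof (rule has_derivative_transform_within_open[OF 4 o])
    fix y assume "y \<in> snd c ` (U \<inter> fst c)"
    then obtain q where "q \<in> U" "q \<in> fst c" "y = snd c q" by auto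
    then show "(transition ?d d \<circ> (snd ?d \<circ> f \<circ> chart_inv ?c \<circ> transition c ?c)) y = (snd d \<circ> f \<circ> chart_inv c) y"
      by (simp add: U_def transition_coord[OF A c(1)] transition_coord[OF B d'(1)] chart_inv_left[OF A] c(1) c'(1))
  qed
  then show ?thesis by (simp add: comp_assoc)
qed

section \<open>Arrows of an etale groupoid as germs of diffeomorphisms\<close>

locale etale_groupoid =
  fixes G :: "('o, 'a, 'e::euclidean_space, 'f::euclidean_space, 'z) groupoid_scheme"
  assumes lie: "lie_groupoid G" and etale: "etale G"
begin

lemma obj_manifold: "manifold (obj G)" and arr_manifold: "manifold (arr G)"
  using lie by (simp_all add: lie_groupoid_def)

lemma src_smooth: "smooth_map (arr G) (obj G) (src G)"
  and tgt_smooth: "smooth_map (arr G) (obj G) (tgt G)"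
  and ident_smooth: "smooth_map (obj G) (arr G) (ident G)"
  and mult_smooth: "smooth_map_on (prod_atlas (arr G) (arr G)) (arr G) (composable G) (\<lambda>(g, h). mult G g h)"
  using lie by (simp_all add: lie_groupoid_def submersion_def)

lemma groupoid: "is_groupoid G"
  using lie by (simp add: lie_groupoid_def)

lemma src_in: "g \<in> points (arr G) \<Longrightarrow> src G g \<in> points (obj G)"
  and tgt_in: "g \<in> points (arr G) \<Longrightarrow> tgt G g \<in> points (obj G)"
  using groupoid unfolding is_groupoid_def by simp_all

lemma ident_in: "x \<in> points (obj G) \<Longrightarrow> ident G x \<in> points (arr G)"
  and src_ident: "x \<in> points (obj G) \<Longrightarrow> src G (ident G x) = x"
  and tgt_ident: "x \<in> points (obj G) \<Longrightarrow> tgt G (ident G x) = x"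
  using groupoid unfolding is_groupoid_def by simp_all

lemma mult_in: "g \<in> points (arr G) \<Longrightarrow> h \<in> points (arr G) \<Longrightarrow> src G g = tgt G h \<Longrightarrow> mult G g h \<in> points (arr G)"
  and src_mult: "g \<in> points (arr G) \<Longrightarrow> h \<in> points (arr G) \<Longrightarrow> src G g = tgt G h \<Longrightarrow> src G (mult G g h) = src G h"
  and tgt_mult: "g \<in> points (arr G) \<Longrightarrow> h \<in> points (arr G) \<Longrightarrow> src G g = tgt G h \<Longrightarrow> tgt G (mult G g h) = tgt G g"
  using groupoid unfolding is_groupoid_def by simp_all

lemma mult_assoc: "g \<in> points (arr G) \<Longrightarrow> h \<in> points (arr G) \<Longrightarrow> k \<in> points (arr G) \<Longrightarrow>
    src G g = tgt G h \<Longrightarrow> src G h = tgt G k \<Longrightarrow> mult G (mult G g h) k = mult G g (mult G h k)"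
  using groupoid unfolding is_groupoid_def by simp

lemma mult_ident_right: "g \<in> points (arr G) \<Longrightarrow> mult G g (ident G (src G g)) = g"
  and mult_ident_left: "g \<in> points (arr G) \<Longrightarrow> mult G (ident G (tgt G g)) g = g"
  using groupoid unfolding is_groupoid_def by simp_all

lemma inv_in: "g \<in> points (arr G) \<Longrightarrow> invs G g \<in> points (arr G)"
  and src_inv: "g \<in> points (arr G) \<Longrightarrow> src G (invs G g) = tgt G g"
  and tgt_inv: "g \<in> points (arr G) \<Longrightarrow> tgt G (invs G g) = src G g"
  and mult_inv_right: "g \<in> points (arr G) \<Longrightarrow> mult G g (invs G g) = ident G (tgt G g)"
  and mult_inv_left: "g \<in> points (arr G) \<Longrightarrow> mult G (invs G g) g = ident G (src G g)"
  using groupoid unfolding is_groupoid_def by simp_all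

text \<open>A local section of the source map through \<open>g\<close>. Followed by the target map it is the local diffeomorphism
  through which \<open>g\<close> acts on objects.\<close>

definition local_section :: "'a \<Rightarrow> 'o set \<Rightarrow> ('o \<Rightarrow> 'a) \<Rightarrow> bool" where
  "local_section g V \<sigma> \<longleftrightarrow> g \<in> points (arr G) \<and> openin (mtop (obj G)) V \<and> src G g \<in> V \<and>
     smooth_map_on (obj G) (arr G) V \<sigma> \<and> (\<forall>p\<in>V. src G (\<sigma> p) = p) \<and> \<sigma> (src G g) = g"

lemma local_sectionD:
  assumes "local_section g V \<sigma>"
  shows "g \<in> points (arr G)" "openin (mtop (obj G)) V" "src G g \<in> V" "smooth_map_on (obj G) (arr G) V \<sigma>"
    "p \<in> V \<Longrightarrow> src G (\<sigma> p) = p" "\<sigma> (src G g) = g" "p \<in> V \<Longrightarrow> \<sigma> p \<in> points (arr G)"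
  using assms smooth_map_on_in_points[of "obj G" "arr G" V \<sigma> p] unfolding local_section_def by simp_all

lemma src_locally_injective:
  assumes "g \<in> points (arr G)"
  obtains U where "openin (mtop (arr G)) U" "g \<in> U" "inj_on (src G) U"
    "openin (mtop (obj G)) (src G ` U)" "smooth_map_on (obj G) (arr G) (src G ` U) (inv_into U (src G))"
proof -
  from bspec[OF etale[unfolded etale_def local_diffeo_def] assms]
  obtain U where "openin (mtop (arr G)) U \<and> g \<in> U \<and> openin (mtop (obj G)) (src G ` U) \<and> inj_on (src G) U \<and>
        smooth_map_on (arr G) (obj G) U (src G) \<and> smooth_map_on (obj G) (arr G) (src G ` U) (inv_into U (src G))"
    by (rule exE)
  then show thesis by (elim conjE) (rule that)
qed

lemma local_section_exists:
  assumes "g \<in> points (arr G)"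
  obtains V \<sigma> where "local_section g V \<sigma>"
proof -
  obtain U where U: "openin (mtop (arr G)) U" "g \<in> U" "inj_on (src G) U"
    "openin (mtop (obj G)) (src G ` U)" "smooth_map_on (obj G) (arr G) (src G ` U) (inv_into U (src G))"
    by (rule src_locally_injective[OF assms]) (rule that)
  have "local_section g (src G ` U) (inv_into U (src G))"
    unfolding local_section_def using U assms by (auto simp: f_inv_into_f)
  then show thesis by (rule that)
qed

lemma openin_section_vimage:
  "local_section g V \<sigma> \<Longrightarrow> openin (mtop (arr G)) U \<Longrightarrow> openin (mtop (obj G)) {p \<in> V. \<sigma> p \<in> U}"
  by (rule smooth_map_on_openin_vimage[OF obj_manifold arr_manifold]) (auto dest: local_sectionD)

lemma openin_src_vimage:
  "openin (mtop (obj G)) V \<Longrightarrow> openin (mtop (arr G)) {g \<in> points (arr G). src G g \<in> V}"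
  by (rule smooth_map_on_openin_vimage[OF arr_manifold obj_manifold openin_points src_smooth])

text \<open>Sections through the same arrow have the same germ, since the source map is injective near that arrow. All
  identities between germs are derived from this one.\<close>

lemma local_sections_agree:
  assumes "local_section g V \<sigma>" "local_section g V' \<sigma>'"
  obtains V'' where "openin (mtop (obj G)) V''" "src G g \<in> V''" "V'' \<subseteq> V" "V'' \<subseteq> V'"
    "\<And>p. p \<in> V'' \<Longrightarrow> \<sigma> p = \<sigma>' p"
proof -
  note s = local_sectionD[OF assms(1)] and s' = local_sectionD[OF assms(2)]
  obtain U where U: "openin (mtop (arr G)) U" "g \<in> U" "inj_on (src G) U"
    by (rule src_locally_injective[OF s(1)]) (rule that)
  let ?V = "{p \<in> V. \<sigma> p \<in> U} \<inter> {p \<in> V'. \<sigma>' p \<in> U}"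
  have 1: "openin (mtop (obj G)) ?V"
    by (rule openin_Int[OF openin_section_vimage[OF assms(1) U(1)] openin_section_vimage[OF assms(2) U(1)]])
  have 2: "src G g \<in> ?V" using s(3,6) s'(3,6) U(2) by simp
  have 3: "\<sigma> p = \<sigma>' p" if "p \<in> ?V" for p
    by (rule inj_onD[OF U(3)]) (use that s(5) s'(5) in auto)
  show thesis by (rule that[OF 1 2 _ _ 3]) auto
qed

lemma local_section_inverse:
  assumes "local_section g V \<sigma>"
  obtains N where "openin (mtop (arr G)) N" "g \<in> N" "N \<subseteq> points (arr G)"
    "\<And>h. h \<in> N \<Longrightarrow> src G h \<in> V" "\<And>h. h \<in> N \<Longrightarrow> \<sigma> (src G h) = h"
proof -
  note s = local_sectionD[OF assms]
  obtain U where U: "openin (mtop (arr G)) U" "g \<in> U" "inj_on (src G) U"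
    by (rule src_locally_injective[OF s(1)]) (rule that)
  let ?N = "U \<inter> {h \<in> points (arr G). src G h \<in> {p \<in> V. \<sigma> p \<in> U}}"
  have 1: "openin (mtop (arr G)) ?N"
    by (rule openin_Int[OF U(1) openin_src_vimage[OF openin_section_vimage[OF assms U(1)]]])
  have 2: "g \<in> ?N" using s(1,3,6) U(2) by simp
  have 3: "\<sigma> (src G h) = h" if "h \<in> ?N" for h
    by (rule inj_onD[OF U(3)]) (use that s(5) in auto)
  show thesis by (rule that[OF 1 2 _ _ 3]) auto
qed

text \<open>The source map and a section through \<open>g\<close> are inverse to each other as germs.\<close>

lemma src_deriv_section:
  assumes "local_section g V \<sigma>"
  shows "mderiv (arr G) (obj G) (src G) g \<circ> mderiv (obj G) (arr G) \<sigma> (src G g) = id"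
    and "mderiv (obj G) (arr G) \<sigma> (src G g) \<circ> mderiv (arr G) (obj G) (src G) g = id"
proof -
  note s = local_sectionD[OF assms]
  have i: "smooth_map_on (obj G) (obj G) (points (obj G)) (\<lambda>x. x)" 
       "smooth_map_on (arr G) (arr G) (points (arr G)) (\<lambda>x. x)"
    by (rule smooth_map_on_ident[OF obj_manifold subset_refl], rule smooth_map_on_ident[OF arr_manifold subset_refl])
  have "mderiv (arr G) (obj G) (src G) (\<sigma> (src G g)) \<circ> mderiv (obj G) (arr G) \<sigma> (src G g)
      = mderiv (obj G) (obj G) (src G \<circ> \<sigma>) (src G g)"
    by (rule mderiv_compose[OF obj_manifold arr_manifold obj_manifold s(2) openin_points s(4) src_smooth s(3), symmetric])
       (use s(1,6) in simp)
  also have "\<dots> = mderiv (obj G) (obj G) (\<lambda>x. x) (src G g)"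
    by (rule mderiv_cong[OF obj_manifold obj_manifold openin_points i(1) s(2,3) src_in[OF s(1)], symmetric])
       (use s(5) in simp)
  also have "\<dots> = id" by (rule mderiv_ident[OF obj_manifold src_in[OF s(1)]])
  finally show "mderiv (arr G) (obj G) (src G) g \<circ> mderiv (obj G) (arr G) \<sigma> (src G g) = id"
    by (simp only: s(6))
  obtain N where N: "openin (mtop (arr G)) N" "g \<in> N" "N \<subseteq> points (arr G)"
    "\<And>h. h \<in> N \<Longrightarrow> src G h \<in> V" "\<And>h. h \<in> N \<Longrightarrow> \<sigma> (src G h) = h"
    by (rule local_section_inverse[OF assms]) (rule that)
  have "mderiv (obj G) (arr G) \<sigma> (src G g) \<circ> mderiv (arr G) (obj G) (src G) g
      = mderiv (arr G) (arr G) (\<sigma> \<circ> src G) g"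
    by (rule mderiv_compose[OF arr_manifold obj_manifold arr_manifold openin_points s(2) src_smooth s(4) s(1,3), symmetric])
  also have "\<dots> = mderiv (arr G) (arr G) (\<lambda>x. x) g"
    by (rule mderiv_cong[OF arr_manifold arr_manifold openin_points i(2) N(1,2) s(1), symmetric])
       (use N(5) in simp)
  also have "\<dots> = id" by (rule mderiv_ident[OF arr_manifold s(1)])
  finally show "mderiv (obj G) (arr G) \<sigma> (src G g) \<circ> mderiv (arr G) (obj G) (src G) g = id" .
qed

lemma section_tgt_smooth:
  assumes "local_section g V \<sigma>"
  shows "smooth_map_on (obj G) (obj G) V (tgt G \<circ> \<sigma>)"
  by (rule smooth_map_on_compose[OF obj_manifold arr_manifold obj_manifold local_sectionD(2)[OF assms] openin_points
        local_sectionD(4)[OF assms] tgt_smooth])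
     (use local_sectionD(7)[OF assms] in auto)

lemma arrow_deriv_section:
  assumes "local_section g V \<sigma>"
  shows "arrow_deriv G g = mderiv (obj G) (obj G) (tgt G \<circ> \<sigma>) (src G g)"
proof -
  note s = local_sectionD[OF assms]
  have "inv (mderiv (arr G) (obj G) (src G) g) = mderiv (obj G) (arr G) \<sigma> (src G g)"
    by (rule inv_unique_comp[OF src_deriv_section[OF assms]])
  moreover have "mderiv (obj G) (obj G) (tgt G \<circ> \<sigma>) (src G g) =
      mderiv (arr G) (obj G) (tgt G) (\<sigma> (src G g)) \<circ> mderiv (obj G) (arr G) \<sigma> (src G g)"
    by (rule mderiv_compose[OF obj_manifold arr_manifold obj_manifold s(2) openin_points s(4) tgt_smooth s(3)])
       (use s(1,6) in simp)
  ultimately show ?thesis unfolding arrow_deriv_def by (simp only: s(6))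
qed

lemma src_deriv_bij:
  assumes "g \<in> points (arr G)" shows "bij (mderiv (arr G) (obj G) (src G) g)"
proof -
  obtain V \<sigma> where "local_section g V \<sigma>" by (rule local_section_exists[OF assms])
  from src_deriv_section[OF this] show ?thesis by (metis o_bij)
qed

lemma src_deriv_linear: "g \<in> points (arr G) \<Longrightarrow> linear (mderiv (arr G) (obj G) (src G) g)"
  by (rule mderiv_linear[OF arr_manifold obj_manifold src_smooth])

text \<open>The product of two sections follows the first-acting arrow \<open>h\<close> to its target before the section through
  \<open>g\<close> is evaluated.\<close>

lemma local_section_mult:
  assumes "local_section g V \<sigma>" "local_section h V' \<sigma>'" "src G g = tgt G h"
  shows "local_section (mult G g h) {p \<in> V'. tgt G (\<sigma>' p) \<in> V} (\<lambda>p. mult G (\<sigma> (tgt G (\<sigma>' p))) (\<sigma>' p))"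
proof -
  note s = local_sectionD[OF assms(1)] and s' = local_sectionD[OF assms(2)]
  let ?V = "{p \<in> V'. tgt G (\<sigma>' p) \<in> V}"
  have V: "openin (mtop (obj G)) ?V"
    using smooth_map_on_openin_vimage[OF obj_manifold obj_manifold s'(2) section_tgt_smooth[OF assms(2)] s(2)]
    by (simp only: comp_apply)
  have 1: "smooth_map_on (obj G) (arr G) ?V (\<sigma> \<circ> (tgt G \<circ> \<sigma>'))"
    by (rule smooth_map_on_compose[OF obj_manifold obj_manifold arr_manifold V s(2)
          smooth_map_on_subset[OF section_tgt_smooth[OF assms(2)]] s(4)]) auto
  have 2: "smooth_map_on (obj G) (arr G) ?V \<sigma>'"
    by (rule smooth_map_on_subset[OF s'(4)]) auto
  have "smooth_map_on (obj G) (arr G) ?V (\<lambda>p. (\<lambda>(g, h). mult G g h) ((\<sigma> \<circ> (tgt G \<circ> \<sigma>')) p, \<sigma>' p))"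
  proof (rule smooth_map_on_compose_pair[OF obj_manifold arr_manifold arr_manifold V 1 2 mult_smooth])
    fix p assume "p \<in> ?V"
    then have p: "p \<in> V'" "tgt G (\<sigma>' p) \<in> V" by auto
    show "((\<sigma> \<circ> (tgt G \<circ> \<sigma>')) p, \<sigma>' p) \<in> composable G"
      unfolding composable_def using s(5,7)[OF p(2)] s'(7)[OF p(1)] by simp
  qed
  then have 3: "smooth_map_on (obj G) (arr G) ?V (\<lambda>p. mult G (\<sigma> (tgt G (\<sigma>' p))) (\<sigma>' p))"
    by (simp only: comp_apply prod.case)
  have "src G (mult G (\<sigma> (tgt G (\<sigma>' p))) (\<sigma>' p)) = p" if "p \<in> ?V" for p
  proof -
    have p: "p \<in> V'" "tgt G (\<sigma>' p) \<in> V" using that by auto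
    show ?thesis using src_mult[OF s(7)[OF p(2)] s'(7)[OF p(1)] s(5)[OF p(2)]] s'(5)[OF p(1)] by simp
  qed
  then show ?thesis
    unfolding local_section_def using V 3 mult_in[OF s(1) s'(1) assms(3)] src_mult[OF s(1) s'(1) assms(3)]
      s'(3,6) s(3,6) assms(3) by simp
qed

text \<open>The chain rule, applied to the local diffeomorphism of a product of arrows, which by
  \<open>local_section_mult\<close> is the composite of the local diffeomorphisms of the factors.\<close>

lemma arrow_deriv_mult:
  assumes g: "g \<in> points (arr G)" and h: "h \<in> points (arr G)" and gh: "src G g = tgt G h"
  shows "arrow_deriv G (mult G g h) = arrow_deriv G g \<circ> arrow_deriv G h"
proof -
  obtain V \<sigma> where 1: "local_section g V \<sigma>" by (rule local_section_exists[OF g])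
  obtain V' \<sigma>' where 2: "local_section h V' \<sigma>'" by (rule local_section_exists[OF h])
  note s = local_sectionD[OF 1] and s' = local_sectionD[OF 2] and s'' = local_section_mult[OF 1 2 gh]
  note d = local_sectionD[OF s'']
  let ?V = "{p \<in> V'. tgt G (\<sigma>' p) \<in> V}"
  have "arrow_deriv G (mult G g h) =
      mderiv (obj G) (obj G) (tgt G \<circ> (\<lambda>p. mult G (\<sigma> (tgt G (\<sigma>' p))) (\<sigma>' p))) (src G h)"
    using arrow_deriv_section[OF s''] by (simp only: src_mult[OF g h gh])
  also have "\<dots> = mderiv (obj G) (obj G) ((tgt G \<circ> \<sigma>) \<circ> (tgt G \<circ> \<sigma>')) (src G h)"
  proof (rule mderiv_cong[OF obj_manifold obj_manifold d(2) section_tgt_smooth[OF s''] d(2)])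
    show "src G h \<in> ?V" "src G h \<in> ?V" using d(3) by (simp_all only: src_mult[OF g h gh])
    fix p assume "p \<in> ?V"
    then have p: "p \<in> V'" "tgt G (\<sigma>' p) \<in> V" by auto
    show "(tgt G \<circ> (\<lambda>p. mult G (\<sigma> (tgt G (\<sigma>' p))) (\<sigma>' p))) p = ((tgt G \<circ> \<sigma>) \<circ> (tgt G \<circ> \<sigma>')) p"
      using tgt_mult[OF s(7)[OF p(2)] s'(7)[OF p(1)] s(5)[OF p(2)]] by simp
  qed
  also have "\<dots> = mderiv (obj G) (obj G) (tgt G \<circ> \<sigma>) ((tgt G \<circ> \<sigma>') (src G h)) \<circ> mderiv (obj G) (obj G) (tgt G \<circ> \<sigma>') (src G h)"
    by (rule mderiv_compose[OF obj_manifold obj_manifold obj_manifold s'(2) s(2)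
          section_tgt_smooth[OF 2] section_tgt_smooth[OF 1] s'(3)])
       (use s'(6) s(3) gh in simp)
  also have "(tgt G \<circ> \<sigma>') (src G h) = src G g" using s'(6) gh by simp
  finally show ?thesis by (simp only: arrow_deriv_section[OF 1] arrow_deriv_section[OF 2])
qed

lemma local_section_ident:
  assumes "x \<in> points (obj G)" shows "local_section (ident G x) (points (obj G)) (ident G)"
  unfolding local_section_def using assms ident_in src_ident openin_points ident_smooth by simp

lemma arrow_deriv_ident:
  assumes x: "x \<in> points (obj G)" shows "arrow_deriv G (ident G x) = id"
proof -
  have "arrow_deriv G (ident G x) = mderiv (obj G) (obj G) (tgt G \<circ> ident G) x"
    using arrow_deriv_section[OF local_section_ident[OF x]] by (simp only: src_ident[OF x])
  also have "\<dots> = mderiv (obj G) (obj G) (\<lambda>x. x) x"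
    by (rule mderiv_cong[OF obj_manifold obj_manifold openin_points section_tgt_smooth[OF local_section_ident[OF x]]
          openin_points x x]) (simp add: tgt_ident)
  also have "\<dots> = id" by (rule mderiv_ident[OF obj_manifold x])
  finally show ?thesis .
qed

lemma arrow_deriv_inv:
  assumes g: "g \<in> points (arr G)"
  shows "arrow_deriv G (invs G g) \<circ> arrow_deriv G g = id" "arrow_deriv G g \<circ> arrow_deriv G (invs G g) = id"
  using arrow_deriv_mult[OF inv_in[OF g] g src_inv[OF g]] arrow_deriv_mult[OF g inv_in[OF g] tgt_inv[OF g, symmetric]]
  by (simp_all add: mult_inv_left[OF g] mult_inv_right[OF g] arrow_deriv_ident src_in[OF g] tgt_in[OF g])

lemma arrow_deriv_bij: "g \<in> points (arr G) \<Longrightarrow> bij (arrow_deriv G g)"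
  by (rule o_bij[OF arrow_deriv_inv])

lemma tgt_deriv_eq:
  "g \<in> points (arr G) \<Longrightarrow> mderiv (arr G) (obj G) (tgt G) g = arrow_deriv G g \<circ> mderiv (arr G) (obj G) (src G) g"
  unfolding arrow_deriv_def using src_deriv_bij by (simp add: fun_eq_iff bij_is_inj)

lemma arrow_deriv_linear:
  assumes g: "g \<in> points (arr G)" shows "linear (arrow_deriv G g)"
proof -
  obtain V \<sigma> where 1: "local_section g V \<sigma>" by (rule local_section_exists[OF g])
  note s = local_sectionD[OF 1]
  show ?thesis unfolding arrow_deriv_section[OF 1]
    by (rule has_derivative_linear[OF chart_rep_has_derivative[OF obj_manifold obj_manifold s(2) section_tgt_smooth[OF 1] s(3)]])
qed

lemma isotropyD: "g \<in> isotropy G x \<Longrightarrow> g \<in> points (arr G)" "g \<in> isotropy G x \<Longrightarrow> src G g = x"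
  "g \<in> isotropy G x \<Longrightarrow> tgt G g = x"
  by (simp_all add: isotropy_def)

lemma isotropy_ident: "x \<in> points (obj G) \<Longrightarrow> ident G x \<in> isotropy G x"
  by (simp add: isotropy_def ident_in src_ident tgt_ident)

lemma isotropy_mult: "g \<in> isotropy G x \<Longrightarrow> h \<in> isotropy G x \<Longrightarrow> mult G g h \<in> isotropy G x"
  by (simp add: isotropy_def mult_in src_mult tgt_mult)

lemma isotropy_inv: "g \<in> isotropy G x \<Longrightarrow> invs G g \<in> isotropy G x"
  by (simp add: isotropy_def inv_in src_inv tgt_inv)

text \<open>By properness the isotropy group is compact, and it is discrete because the source map, which is constant on
  it, is locally injective.\<close>

lemma isotropy_finite:
  assumes proper: "proper G" and x: "x \<in> points (obj G)"
  shows "finite (isotropy G x)"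
proof -
  have "compactin (mtop (arr G)) {g \<in> topspace (mtop (arr G)). (src G g, tgt G g) = (x, x)}"
    using proper x unfolding proper_def proper_map_def by (simp add: topspace_mtop)
  moreover have "{g \<in> topspace (mtop (arr G)). (src G g, tgt G g) = (x, x)} = isotropy G x"
    by (auto simp: isotropy_def topspace_mtop)
  ultimately have c: "compactin (mtop (arr G)) (isotropy G x)" by simp
  let ?U = "{U. openin (mtop (arr G)) U \<and> inj_on (src G) U}"
  have "isotropy G x \<subseteq> \<Union>?U"
  proof
    fix g assume "g \<in> isotropy G x"
    then obtain U where "openin (mtop (arr G)) U" "g \<in> U" "inj_on (src G) U"
      using src_locally_injective[OF isotropyD(1)] by metis
    then show "g \<in> \<Union>?U" by auto
  qed
  then obtain \<F> where F: "finite \<F>" "\<F> \<subseteq> ?U" "isotropy G x \<subseteq> \<Union>\<F>"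
    using c unfolding compactin_def by (metis (no_types, lifting) mem_Collect_eq)
  have "finite (U \<inter> isotropy G x)" if "U \<in> \<F>" for U
  proof (rule inj_on_finite)
    show "inj_on (src G) (U \<inter> isotropy G x)" using that F(2) by (auto intro: inj_on_subset)
    show "src G ` (U \<inter> isotropy G x) \<subseteq> {x}" by (auto simp: isotropy_def)
  qed simp
  then have "finite (\<Union>U\<in>\<F>. U \<inter> isotropy G x)" using F(1) by blast
  moreover have "isotropy G x \<subseteq> (\<Union>U\<in>\<F>. U \<inter> isotropy G x)" using F(3) by blast
  ultimately show ?thesis by (rule rev_finite_subset)
qed

end

section \<open>Faithfulness of the linear isotropy representation\<close>

context etale_groupoid begin

text \<open>Let \<open>H\<close> be the finite group of isotropy arrows with trivial differential, and let \<open>F\<close> be the sum over \<open>H\<close> of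
  the coordinate expressions of their local diffeomorphisms. Its derivative at \<open>x\<close> is \<open>card H\<close> times the
  identity, so \<open>F\<close> is injective near \<open>x\<close>; and moving the argument by \<open>k \<in> H\<close> only permutes the summands. Hence the
  local diffeomorphism of \<open>k\<close> is the identity near \<open>x\<close>, and effectiveness gives the claim.\<close>

lemma isotropy_faithful:
  assumes proper: "proper G" and eff: "effective G" and x: "x \<in> points (obj G)"
    and k: "k \<in> isotropy G x" and dk: "arrow_deriv G k = id"
  shows "k = ident G x"
proof -
  define H where "H = {h \<in> isotropy G x. arrow_deriv G h = id}"
  have H: "h \<in> points (arr G)" "src G h = x" "tgt G h = x" "arrow_deriv G h = id" if "h \<in> H" for h
    using that isotropyD unfolding H_def by auto
  have finH: "finite H" using isotropy_finite[OF proper x] by (simp add: H_def)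
  have kH: "k \<in> H" using k dk by (simp add: H_def)
  \<comment> \<open>Right translation by \<open>k\<close> permutes \<open>H\<close>.\<close>
  have hk: "mult G h k \<in> H" if "h \<in> H" for h
    using that kH arrow_deriv_mult[of h k] isotropy_mult[of h x k] H(1-3)[OF that] H(1-3)[OF kH] H(4)[OF that] dk
    by (simp add: H_def)
  have inj_hk: "inj_on (\<lambda>h. mult G h k) H"
  proof (rule inj_on_inverseI)
    fix h assume h: "h \<in> H"
    have "mult G (mult G h k) (invs G k) = mult G h (mult G k (invs G k))"
      using H[OF h] H[OF kH] inv_in tgt_inv by (intro mult_assoc) auto
    also have "\<dots> = h" using mult_inv_right[OF H(1)[OF kH]] mult_ident_right[OF H(1)[OF h]] H[OF h] H[OF kH] by simp
    finally show "mult G (mult G h k) (invs G k) = h" .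
  qed
  then have bij: "bij_betw (\<lambda>h. mult G h k) H H"
    unfolding bij_betw_def using endo_inj_surj[OF finH _ inj_hk] hk by blast
  have "\<exists>V \<sigma>. local_section h V \<sigma>" if "h \<in> H" for h
    by (rule local_section_exists[OF H(1)[OF that]]) blast
  then obtain V \<sigma> where sec: "\<And>h. h \<in> H \<Longrightarrow> local_section h (V h) (\<sigma> h)" by metis
  note s = local_sectionD[OF sec]
  \<comment> \<open>On \<open>T h\<close> the section through \<open>h k\<close> is the product of the sections through \<open>h\<close> and \<open>k\<close>.\<close>
  let ?\<phi> = "\<lambda>p. tgt G (\<sigma> k p)"
  have "\<exists>T. openin (mtop (obj G)) T \<and> x \<in> T \<and> T \<subseteq> V k \<and> T \<subseteq> {p. ?\<phi> p \<in> V h} \<and>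
      (\<forall>p\<in>T. mult G (\<sigma> h (?\<phi> p)) (\<sigma> k p) = \<sigma> (mult G h k) p)" if h: "h \<in> H" for h
  proof -
    have e: "src G h = tgt G k" using H[OF h] H[OF kH] by simp
    obtain T where T: "openin (mtop (obj G)) T" "src G (mult G h k) \<in> T" "T \<subseteq> {p \<in> V k. tgt G (\<sigma> k p) \<in> V h}"
      "T \<subseteq> V (mult G h k)" "\<And>p. p \<in> T \<Longrightarrow> mult G (\<sigma> h (?\<phi> p)) (\<sigma> k p) = \<sigma> (mult G h k) p"
      by (rule local_sections_agree[OF local_section_mult[OF sec[OF h] sec[OF kH] e] sec[OF hk[OF h]]]) (rule that)
    show ?thesis by (rule exI[of _ T]) (use T H(2)[OF hk[OF h]] in auto)
  qed
  then have "\<exists>T. \<forall>h\<in>H. openin (mtop (obj G)) (T h) \<and> x \<in> T h \<and> T h \<subseteq> V k \<and> T h \<subseteq> {p. ?\<phi> p \<in> V h} \<and>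
      (\<forall>p\<in>T h. mult G (\<sigma> h (?\<phi> p)) (\<sigma> k p) = \<sigma> (mult G h k) p)"
    by (intro bchoice ballI)
  then obtain T where T0: "\<forall>h\<in>H. openin (mtop (obj G)) (T h) \<and> x \<in> T h \<and> T h \<subseteq> V k \<and> T h \<subseteq> {p. ?\<phi> p \<in> V h} \<and>
      (\<forall>p\<in>T h. mult G (\<sigma> h (?\<phi> p)) (\<sigma> k p) = \<sigma> (mult G h k) p)"
    by (rule exE)
  have T: "openin (mtop (obj G)) (T h)" "x \<in> T h" "T h \<subseteq> V k" "T h \<subseteq> {p. ?\<phi> p \<in> V h}"
    "p \<in> T h \<Longrightarrow> mult G (\<sigma> h (?\<phi> p)) (\<sigma> k p) = \<sigma> (mult G h k) p" if "h \<in> H" for h p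
    using bspec[OF T0 that] by simp_all
  have xV: "x \<in> V h" if "h \<in> H" for h using s(3)[OF that] H(2)[OF that] by simp
  have T6: "tgt G (\<sigma> h (?\<phi> p)) = tgt G (\<sigma> (mult G h k) p)" if h: "h \<in> H" and p: "p \<in> T h" for h p
  proof -
    have p': "p \<in> V k" "?\<phi> p \<in> V h" using T(3,4)[OF h] p by auto
    show ?thesis
      using tgt_mult[OF s(7)[OF h p'(2)] s(7)[OF kH p'(1)] s(5)[OF h p'(2)]] T(5)[OF h p] by simp
  qed
  define c where "c = chart_at (obj G) x"
  have c: "c \<in> obj G" "x \<in> fst c" using chart_at_in[OF x] by (auto simp: c_def)
  define f where "f h = snd c \<circ> (tgt G \<circ> \<sigma> h) \<circ> chart_inv c" for h
  have fx: "(tgt G \<circ> \<sigma> h) x = x" if "h \<in> H" for h using s(6)[OF that] H[OF that] by simp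
  have "\<exists>W. open W \<and> snd c x \<in> W \<and> smooth_on W (f h)" if h: "h \<in> H" for h
  proof -
    have fc: "(tgt G \<circ> \<sigma> h) x \<in> fst c" using fx[OF h] c(2) by simp
    obtain W where "open W" "snd c x \<in> W" "smooth_on W (f h)"
      unfolding f_def
      by (rule smooth_map_on_chart[OF obj_manifold obj_manifold s(2)[OF h] section_tgt_smooth[OF sec[OF h]] xV[OF h] c c(1) fc])
         (rule that[unfolded f_def])
    then show ?thesis by blast
  qed
  then have "\<exists>W. \<forall>h\<in>H. open (W h) \<and> snd c x \<in> W h \<and> smooth_on (W h) (f h)"
    by (intro bchoice ballI)
  then obtain W where W0: "\<forall>h\<in>H. open (W h) \<and> snd c x \<in> W h \<and> smooth_on (W h) (f h)"
    by (rule exE)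
  have W: "open (W h)" "snd c x \<in> W h" "smooth_on (W h) (f h)" if "h \<in> H" for h
    using bspec[OF W0 that] by simp_all
  define F where "F y = (\<Sum>h\<in>H. f h y)" for y
  let ?W = "\<Inter>h\<in>H. W h"
  have W': "open ?W" using finH W(1) by blast
  have smF: "smooth_on ?W F" unfolding F_def
    by (rule smooth_on_sum[OF W' finH]) (rule smooth_on_subset[OF W(3)], auto)
  have "(f h has_derivative (\<lambda>v. v)) (at (snd c x))" if h: "h \<in> H" for h
  proof -
    have "mderiv (obj G) (obj G) (tgt G \<circ> \<sigma> h) x = id"
      using arrow_deriv_section[OF sec[OF h]] by (simp only: H(2,4)[OF h])
    then show ?thesis
      using chart_rep_has_derivative[OF obj_manifold obj_manifold s(2)[OF h] section_tgt_smooth[OF sec[OF h]] xV[OF h]]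
      by (simp only: fx[OF h] f_def c_def id_def)
  qed
  then have "(F has_derivative (\<lambda>v. \<Sum>h\<in>H. v)) (at (snd c x))"
    unfolding F_def by (rule has_derivative_sum)
  then have DF: "frechet_derivative F (at (snd c x)) = (\<lambda>v. real (card H) *\<^sub>R v)"
    by (simp add: frechet_derivative_eqI sum_constant_scaleR)
  have "card H > 0" using finH kH card_gt_0_iff by blast
  then have "inj (frechet_derivative F (at (snd c x)))" unfolding DF by (auto intro!: injI)
  moreover have "snd c x \<in> ?W" using W(2) by auto
  ultimately obtain r where r: "r > 0" "ball (snd c x) r \<subseteq> ?W" "inj_on F (ball (snd c x) r)"
    using smooth_on_locally_injective[OF W' _ smF] by metis
  define B where "B = {p \<in> fst c. snd c p \<in> ball (snd c x) r}"
  have oB: "openin (mtop (obj G)) B" unfolding B_def by (rule openin_chart_set[OF c(1) open_ball])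
  have xB: "x \<in> B" using r(1) c(2) by (simp add: B_def)
  define V' where "V' = (B \<inter> {p \<in> V k. (tgt G \<circ> \<sigma> k) p \<in> B}) \<inter> (\<Inter>h\<in>H. T h)"
  have oV': "openin (mtop (obj G)) V'" unfolding V'_def
  proof (intro openin_Int oB openin_INT2 finH T(1))
    show "openin (mtop (obj G)) {p \<in> V k. (tgt G \<circ> \<sigma> k) p \<in> B}"
      by (rule smooth_map_on_openin_vimage[OF obj_manifold obj_manifold s(2)[OF kH] section_tgt_smooth[OF sec[OF kH]] oB])
  qed (use kH in auto)
  have xV': "x \<in> V'" unfolding V'_def using xB xV[OF kH] fx[OF kH] T(2) by simp
  have fixed: "?\<phi> p = p" if p: "p \<in> V'" for p
  proof -
    have pB: "p \<in> fst c" "snd c p \<in> ball (snd c x) r" "?\<phi> p \<in> fst c" "snd c (?\<phi> p) \<in> ball (snd c x) r"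
      and pT: "\<And>h. h \<in> H \<Longrightarrow> p \<in> T h"
      using p by (auto simp: V'_def B_def)
    have "F (snd c (?\<phi> p)) = (\<Sum>h\<in>H. snd c (tgt G (\<sigma> h (?\<phi> p))))"
      unfolding F_def f_def by (simp add: chart_inv_left[OF obj_manifold c(1) pB(3)])
    also have "\<dots> = (\<Sum>h\<in>H. snd c (tgt G (\<sigma> (mult G h k) p)))"
      by (rule sum.cong) (simp_all add: T6 pT)
    also have "\<dots> = (\<Sum>h\<in>H. snd c (tgt G (\<sigma> h p)))"
      by (rule sum.reindex_bij_betw[OF bij])
    also have "\<dots> = F (snd c p)"
      unfolding F_def f_def by (simp add: chart_inv_left[OF obj_manifold c(1) pB(1)])
    finally have "snd c (?\<phi> p) = snd c p" using inj_onD[OF r(3)] pB(2,4) by blast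
    then show ?thesis by (rule chart_inj[OF obj_manifold c(1) pB(3,1)])
  qed
  obtain N where N: "openin (mtop (arr G)) N" "k \<in> N" "N \<subseteq> points (arr G)"
    "\<And>h. h \<in> N \<Longrightarrow> src G h \<in> V k" "\<And>h. h \<in> N \<Longrightarrow> \<sigma> k (src G h) = h"
    by (rule local_section_inverse[OF sec[OF kH]]) (rule that)
  let ?U = "N \<inter> {g \<in> points (arr G). src G g \<in> V'}"
  have "openin (mtop (arr G)) ?U" by (rule openin_Int[OF N(1) openin_src_vimage[OF oV']])
  moreover have "k \<in> ?U" using N(2) H(1,2)[OF kH] xV' by simp
  moreover have "\<forall>g\<in>?U. src G g = tgt G g" using fixed N(5) by fastforce
  ultimately have "\<exists>U. openin (mtop (arr G)) U \<and> k \<in> U \<and> (\<forall>g\<in>U. src G g = tgt G g)"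
    by (intro exI[of _ ?U] conjI)
  with eff x k show ?thesis unfolding effective_def by blast
qed

end

section \<open>The bracket of a contact frame\<close>

text \<open>The product rule for \<open>y \<mapsto> D\<phi>\<^sub>y (X y)\<close>, in which \<open>D\<phi>\<close> is only known to be differentiable
  vector by vector.\<close>

lemma deriv_along_field_has_derivative:
  fixes \<phi> :: "'e::euclidean_space \<Rightarrow> 'f::euclidean_space" and X :: "'e \<Rightarrow> 'e"
  assumes W: "open W" "a \<in> W" and \<phi>: "smooth_on W \<phi>" and X: "(X has_derivative X') (at a)"
  shows "((\<lambda>y. frechet_derivative \<phi> (at y) (X y)) has_derivative
      (\<lambda>v. frechet_derivative (\<lambda>y. frechet_derivative \<phi> (at y) (X a)) (at a) v + frechet_derivative \<phi> (at a) (X' v))) (at a)"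
proof -
  let ?D = "\<lambda>y. frechet_derivative \<phi> (at y)"
  have d: "(\<phi> has_derivative ?D y) (at y)" if "y \<in> W" for y
    by (rule smooth_on_has_derivative[OF \<phi> W(1) that])
  have d2: "((\<lambda>y. ?D y b) has_derivative frechet_derivative (\<lambda>y. ?D y b) (at a)) (at a)" for b
    by (rule smooth_on_has_derivative[OF smooth_on_deriv[OF \<phi>] W])
  have e: "?D y w = (\<Sum>b\<in>Basis. (w \<bullet> b) *\<^sub>R ?D y b)" if "y \<in> W" for y w
    using linear_sum[OF has_derivative_linear[OF d[OF that]], of "\<lambda>b. (w \<bullet> b) *\<^sub>R b" Basis]
    by (simp add: euclidean_representation linear_cmul[OF has_derivative_linear[OF d[OF that]]])
  have s: "((\<lambda>y. \<Sum>b\<in>Basis. (w \<bullet> b) *\<^sub>R ?D y b) has_derivative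
        (\<lambda>v. \<Sum>b\<in>Basis. (w \<bullet> b) *\<^sub>R frechet_derivative (\<lambda>y. ?D y b) (at a) v)) (at a)" for w
    by (intro has_derivative_sum has_derivative_scaleR_right d2)
  have "((\<lambda>y. ?D y (X a)) has_derivative
        (\<lambda>v. \<Sum>b\<in>Basis. (X a \<bullet> b) *\<^sub>R frechet_derivative (\<lambda>y. ?D y b) (at a) v)) (at a)"
    by (rule has_derivative_transform_within_open[OF s W]) (simp add: e)
  then have c: "frechet_derivative (\<lambda>y. ?D y (X a)) (at a) =
        (\<lambda>v. \<Sum>b\<in>Basis. (X a \<bullet> b) *\<^sub>R frechet_derivative (\<lambda>y. ?D y b) (at a) v)"
    by (rule frechet_derivative_eqI)
  have "((\<lambda>y. \<Sum>b\<in>Basis. (X y \<bullet> b) *\<^sub>R ?D y b) has_derivative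
        (\<lambda>v. \<Sum>b\<in>Basis. (X a \<bullet> b) *\<^sub>R frechet_derivative (\<lambda>y. ?D y b) (at a) v + (X' v \<bullet> b) *\<^sub>R ?D a b)) (at a)"
    by (intro has_derivative_sum has_derivative_scaleR d2 has_derivative_inner_left X)
  also have "(\<lambda>v. \<Sum>b\<in>Basis. (X a \<bullet> b) *\<^sub>R frechet_derivative (\<lambda>y. ?D y b) (at a) v + (X' v \<bullet> b) *\<^sub>R ?D a b)
     = (\<lambda>v. frechet_derivative (\<lambda>y. ?D y (X a)) (at a) v + ?D a (X' v))"
    unfolding c by (simp add: sum.distrib e[OF W(2), of "X' _"])
  finally show ?thesis
    by (rule has_derivative_transform_within_open[OF _ W]) (simp add: e[of _ "X _"])
qed

lemma has_derivative_zero_on_open: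
  assumes "(f has_derivative f') (at a)" "open W" "a \<in> W" "\<And>y. y \<in> W \<Longrightarrow> f y = 0"
  shows "f' v = 0"
proof -
  have "(f has_derivative (\<lambda>v. 0)) (at a)"
    by (rule has_derivative_transform_within_open[OF has_derivative_const assms(2,3)]) (simp add: assms(4))
  from has_derivative_unique[OF assms(1) this] show ?thesis by simp
qed

text \<open>Here \<open>N\<close> is a field conormal to the plane field spanned by \<open>X\<close> and \<open>Y\<close>, which \<open>\<phi>\<close> preserves, and
  \<open>X' (Y a) - Y' (X a)\<close> is their bracket up to sign. Differentiating \<open>N (\<phi> y) \<bullet> D\<phi>\<^sub>y (X y) = 0\<close> along \<open>Y\<close> and the same
  identity with \<open>X\<close> and \<open>Y\<close> exchanged along \<open>X\<close>, the second derivatives of \<open>\<phi>\<close> cancel by symmetry. What remains,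
  compared with the derivatives of \<open>N \<bullet> X = 0\<close> and \<open>N \<bullet> Y = 0\<close>, is the assertion. This is the
  naturality of the exterior derivative of the form \<open>N \<bullet> _\<close> in disguise.\<close>

lemma bracket_conormal_invariant:
  fixes \<phi> X Y N :: "'e::euclidean_space \<Rightarrow> 'e"
  assumes W: "open W" "a \<in> W" and \<phi>: "smooth_on W \<phi>" "\<phi> a = a"
    and X: "(X has_derivative X') (at a)" and Y: "(Y has_derivative Y') (at a)" and N: "(N has_derivative N') (at a)"
    and NX: "\<And>y. y \<in> W \<Longrightarrow> N y \<bullet> X y = 0" and NY: "\<And>y. y \<in> W \<Longrightarrow> N y \<bullet> Y y = 0"
    and pX: "\<And>y. y \<in> W \<Longrightarrow> N (\<phi> y) \<bullet> frechet_derivative \<phi> (at y) (X y) = 0"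
    and pY: "\<And>y. y \<in> W \<Longrightarrow> N (\<phi> y) \<bullet> frechet_derivative \<phi> (at y) (Y y) = 0"
    and fX: "frechet_derivative \<phi> (at a) (X a) = X a" and fY: "frechet_derivative \<phi> (at a) (Y a) = Y a"
  shows "N a \<bullet> frechet_derivative \<phi> (at a) (X' (Y a) - Y' (X a)) = N a \<bullet> (X' (Y a) - Y' (X a))"
proof -
  let ?D = "\<lambda>y. frechet_derivative \<phi> (at y)"
  let ?DX = "frechet_derivative (\<lambda>y. ?D y (X a)) (at a)" and ?DY = "frechet_derivative (\<lambda>y. ?D y (Y a)) (at a)"
  have d: "(\<phi> has_derivative ?D y) (at y)" if "y \<in> W" for y
    by (rule smooth_on_has_derivative[OF \<phi>(1) W(1) that])
  have d2: "((\<lambda>y. ?D y b) has_derivative frechet_derivative (\<lambda>y. ?D y b) (at a)) (at a)" for b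
    by (rule smooth_on_has_derivative[OF smooth_on_deriv[OF \<phi>(1)] W])
  have sym: "?DX (Y a) = ?DY (X a)"
    by (rule second_derivative_symmetric[OF W d d2 d2])
  have "(N has_derivative N') (at (\<phi> a))" using N \<phi>(2) by simp
  then have N\<phi>: "((\<lambda>y. N (\<phi> y)) has_derivative (\<lambda>v. N' (?D a v))) (at a)"
    by (rule has_derivative_compose[OF d[OF W(2)]])
  have 1: "N (\<phi> a) \<bullet> (?DX v + ?D a (X' v)) + N' (?D a v) \<bullet> ?D a (X a) = 0" for v
    by (rule has_derivative_zero_on_open[OF
        has_derivative_inner[OF N\<phi> deriv_along_field_has_derivative[OF W \<phi>(1) X]] W pX])
  have 2: "N (\<phi> a) \<bullet> (?DY v + ?D a (Y' v)) + N' (?D a v) \<bullet> ?D a (Y a) = 0" for v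
    by (rule has_derivative_zero_on_open[OF
        has_derivative_inner[OF N\<phi> deriv_along_field_has_derivative[OF W \<phi>(1) Y]] W pY])
  have 3: "N a \<bullet> X' v + N' v \<bullet> X a = 0" for v
    by (rule has_derivative_zero_on_open[OF has_derivative_inner[OF N X] W NX])
  have 4: "N a \<bullet> Y' v + N' v \<bullet> Y a = 0" for v
    by (rule has_derivative_zero_on_open[OF has_derivative_inner[OF N Y] W NY])
  have "?D a (X' (Y a) - Y' (X a)) = ?D a (X' (Y a)) - ?D a (Y' (X a))"
    by (rule linear_diff[OF has_derivative_linear[OF d[OF W(2)]]])
  then show ?thesis
    using 1[of "Y a"] 2[of "X a"] 3[of "Y a"] 4[of "X a"]
    by (simp add: \<phi>(2) fX fY sym inner_diff_right inner_add_right)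
qed

lemma bounded_bilinear_cross3: "bounded_bilinear cross3"
  using bilinear_cross bilinear_conv_bounded_bilinear by blast

text \<open>The vector \<open>m\<close> is the curl, if \<open>L\<close> is the derivative of a vector field.\<close>

lemma skew_part_as_cross3:
  fixes L :: "real ^ 3 \<Rightarrow> real ^ 3"
  assumes "linear L"
  shows "\<exists>m. \<forall>u v. L u \<bullet> v - L v \<bullet> u = m \<bullet> cross3 u v"
proof -
  let ?e = "\<lambda>i. L (axis i 1)"
  have L: "L u = u $ 1 *\<^sub>R ?e 1 + u $ 2 *\<^sub>R ?e 2 + u $ 3 *\<^sub>R ?e 3" for u
  proof -
    have "L u = L (\<Sum>i\<in>UNIV. u $ i *\<^sub>R axis i 1)"
      using basis_expansion[of u] by (simp add: scalar_mult_eq_scaleR)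
    also have "\<dots> = (\<Sum>i\<in>UNIV. u $ i *\<^sub>R ?e i)"
      by (simp add: linear_sum[OF assms] linear_cmul[OF assms])
    finally show ?thesis by (simp add: sum_3)
  qed
  have "L u \<bullet> v - L v \<bullet> u = vector [?e 2 $ 3 - ?e 3 $ 2, ?e 3 $ 1 - ?e 1 $ 3, ?e 1 $ 2 - ?e 2 $ 1] \<bullet> cross3 u v" for u v
    unfolding L[of u] L[of v] by (simp add: cross3_simps)
  then show ?thesis by blast
qed

text \<open>For the form \<open>\<alpha> = N \<bullet> _\<close> the 3-form \<open>\<alpha> \<and> d\<alpha>\<close> is \<open>curl N \<bullet> N\<close> times the determinant, and
  \<open>d\<alpha> p q = curl N \<bullet> (p \<times> q)\<close>. If \<open>N = p \<times> q\<close> at the point, then both vanish together.\<close>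

lemma wedge_conormal_zero:
  fixes N :: "real ^ 3 \<Rightarrow> real ^ 3"
  assumes N: "(N has_derivative N') (at a)" and Na: "N a = cross3 p q" and z: "N' p \<bullet> q - N' q \<bullet> p = 0"
  shows "wedge_ext_deriv (\<lambda>y. blinfun_inner_right (N y)) a u v w = 0"
proof -
  obtain m where m: "\<And>u v. N' u \<bullet> v - N' v \<bullet> u = m \<bullet> cross3 u v"
    using skew_part_as_cross3[OF has_derivative_linear[OF N]] by blast
  have "((\<lambda>y. blinfun_inner_right (N y)) has_derivative (\<lambda>v. blinfun_inner_right (N' v))) (at a)"
    by (rule bounded_linear.has_derivative[OF bounded_linear_blinfun_inner_right N])
  then have "ext_deriv (\<lambda>y. blinfun_inner_right (N y)) a u v = m \<bullet> cross3 u v" for u v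
    unfolding ext_deriv_def by (simp add: frechet_derivative_eqI m)
  then have "wedge_ext_deriv (\<lambda>y. blinfun_inner_right (N y)) a u v w =
      (N a \<bullet> u) * (m \<bullet> cross3 v w) + (N a \<bullet> v) * (m \<bullet> cross3 w u) + (N a \<bullet> w) * (m \<bullet> cross3 u v)"
    by (simp add: wedge_ext_deriv_def)
  also have "\<dots> = (m \<bullet> N a) * (u \<bullet> cross3 v w)"
    by (simp add: cross3_simps)
  also have "m \<bullet> N a = 0" using m[of p q] z Na by simp
  finally show ?thesis by simp
qed

lemma span_eq_cross3_hyperplane:
  fixes x y :: "real ^ 3"
  assumes "dim (span {x, y}) = 2"
  shows "span {x, y} = {v. cross3 x y \<bullet> v = 0}"
proof (rule subspace_dim_equal)
  have "cross3 x y \<noteq> 0"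
  proof
    assume "cross3 x y = 0"
    then consider "x = 0" | "y = 0" | c where "y = c *\<^sub>R x"
      by (auto simp: cross_eq_0 collinear_lemma)
    then obtain w where "{x, y} \<subseteq> span {w}"
    proof cases
      case 1
      then show ?thesis using that[of y] by (simp add: span_base span_zero)
    next
      case 2
      then show ?thesis using that[of x] by (simp add: span_base span_zero)
    next
      case 3
      then show ?thesis using that[of x] by (simp add: span_base span_scale)
    qed
    then have "dim {x, y} \<le> card {w}" by (rule dim_le_card) simp
    then show False using assms by simp
  qed
  then show "dim {v. cross3 x y \<bullet> v = 0} \<le> dim (span {x, y})" 
    using assms by (simp add: dim_hyperplane)
  show "subspace {v. cross3 x y \<bullet> v = 0}" by (rule subspace_hyperplane)
  show "span {x, y} \<subseteq> {v. cross3 x y \<bullet> v = 0}"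
    by (rule span_minimal[OF _ subspace_hyperplane]) (simp add: dot_cross_self)
qed simp

section \<open>Contact orbifolds\<close>

locale contact_orbifold =
  fixes S :: "('o, 'a, real ^ 3, real ^ 3) dist_groupoid"
  assumes contact: "contact_3_orbifold S"

sublocale contact_orbifold \<subseteq> etale_groupoid S
  using contact by unfold_locales (simp_all add: contact_3_orbifold_def orbifold_def)

context contact_orbifold begin

lemma proper: "proper S"
  using contact by (simp add: contact_3_orbifold_def orbifold_def)

lemma obj_contact: "contact_structure (obj S) (obj_dist S)"
  and arr_contact: "contact_structure (arr S) (arr_dist S)"
  using contact by (simp_all add: contact_3_orbifold_def)

lemma obj_rank2: "rank2_distribution (obj S) (obj_dist S)"
  and arr_rank2: "rank2_distribution (arr S) (arr_dist S)"
  using obj_contact arr_contact by (simp_all add: contact_structure_def)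

lemma obj_dist_plane: "x \<in> points (obj S) \<Longrightarrow> subspace (obj_dist S x)" "x \<in> points (obj S) \<Longrightarrow> dim (obj_dist S x) = 2"
  using obj_rank2 by (simp_all add: rank2_distribution_def)

lemma arr_dist_plane: "g \<in> points (arr S) \<Longrightarrow> subspace (arr_dist S g)" "g \<in> points (arr S) \<Longrightarrow> dim (arr_dist S g) = 2"
  using arr_rank2 by (simp_all add: rank2_distribution_def)

lemma src_deriv_dist:
  assumes g: "g \<in> points (arr S)"
  shows "mderiv (arr S) (obj S) (src S) g ` arr_dist S g = obj_dist S (src S g)"
proof (rule subspace_dim_equal)
  let ?L = "mderiv (arr S) (obj S) (src S) g"
  show "subspace (?L ` arr_dist S g)"
    by (rule linear_subspace_image[OF src_deriv_linear[OF g] arr_dist_plane(1)[OF g]])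
  show "?L ` arr_dist S g \<subseteq> obj_dist S (src S g)"
    using contact g by (simp add: contact_3_orbifold_def local_contactomorphism_def)
  have "dim (?L ` arr_dist S g) = dim (arr_dist S g)"
    by (rule dim_image_eq[OF src_deriv_linear[OF g]]) (rule inj_on_subset[OF bij_is_inj[OF src_deriv_bij[OF g]] subset_UNIV])
  then show "dim (obj_dist S (src S g)) \<le> dim (?L ` arr_dist S g)"
    by (simp add: arr_dist_plane(2)[OF g] obj_dist_plane(2)[OF src_in[OF g]])
qed (rule obj_dist_plane(1)[OF src_in[OF g]])

lemma arrow_deriv_dist:
  assumes g: "g \<in> points (arr S)"
  shows "arrow_deriv S g ` obj_dist S (src S g) = obj_dist S (tgt S g)"
proof (rule subspace_dim_equal)
  let ?L = "arrow_deriv S g"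
  show "subspace (?L ` obj_dist S (src S g))"
    by (rule linear_subspace_image[OF arrow_deriv_linear[OF g] obj_dist_plane(1)[OF src_in[OF g]]])
  have "mderiv (arr S) (obj S) (tgt S) g ` arr_dist S g \<subseteq> obj_dist S (tgt S g)"
    using contact g by (simp add: contact_3_orbifold_def local_contactomorphism_def)
  then show "?L ` obj_dist S (src S g) \<subseteq> obj_dist S (tgt S g)"
    by (simp only: tgt_deriv_eq[OF g] image_comp[symmetric] src_deriv_dist[OF g])
  have "dim (?L ` obj_dist S (src S g)) = dim (obj_dist S (src S g))"
    by (rule dim_image_eq[OF arrow_deriv_linear[OF g]]) (rule inj_on_subset[OF bij_is_inj[OF arrow_deriv_bij[OF g]] subset_UNIV])
  then show "dim (obj_dist S (tgt S g)) \<le> dim (?L ` obj_dist S (src S g))"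
    by (simp add: obj_dist_plane(2)[OF src_in[OF g]] obj_dist_plane(2)[OF tgt_in[OF g]])
qed (rule obj_dist_plane(1)[OF tgt_in[OF g]])

text \<open>The cross product of a frame gives a smooth local 1-form defining the contact structure. By the
  contact condition its exterior derivative does not vanish on the frame, and that value is the pairing of the
  conormal field with the bracket of the frame, up to sign.\<close>

lemma contact_frame:
  assumes c: "local_frame (obj S) (obj_dist S) c W X Y"
  defines "N \<equiv> \<lambda>y. cross3 (X y) (Y y)"
  shows "smooth_on W N"
    and "p \<in> fst c \<Longrightarrow> snd c p \<in> W \<Longrightarrow>
      coord_deriv (obj S) c p ` obj_dist S p = {v. N (snd c p) \<bullet> v = 0}"
    and "y \<in> W \<Longrightarrow> (X has_derivative X') (at y) \<Longrightarrow> (Y has_derivative Y') (at y) \<Longrightarrow>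
      N y \<bullet> (X' (Y y) - Y' (X y)) \<noteq> 0"
proof -
  have W: "c \<in> obj S" "open W" "W \<subseteq> snd c ` fst c" "smooth_on W X" "smooth_on W Y"
    and sp: "\<And>p. p \<in> fst c \<Longrightarrow> snd c p \<in> W \<Longrightarrow> coord_deriv (obj S) c p ` obj_dist S p = span {X (snd c p), Y (snd c p)}"
    using c by (simp_all add: local_frame_def)
  show N: "smooth_on W N" unfolding N_def
    by (rule smooth_on_bilinear[OF bounded_bilinear_cross3 W(2,4,5)])
  show k: "coord_deriv (obj S) c p ` obj_dist S p = {v. N (snd c p) \<bullet> v = 0}"
    if p: "p \<in> fst c" "snd c p \<in> W" for p
  proof -
    have pO: "p \<in> points (obj S)" using W(1) p(1) by (auto simp: points_def)
    have "dim (coord_deriv (obj S) c p ` obj_dist S p) = dim (obj_dist S p)"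
      by (rule dim_image_eq[OF coord_deriv_linear[OF obj_manifold W(1) p(1)]])
        (rule inj_on_subset[OF bij_is_inj[OF coord_deriv_bij(1)[OF obj_manifold W(1) p(1)]] subset_UNIV])
    then have "dim (span {X (snd c p), Y (snd c p)}) = 2"
      by (simp only: sp[OF p] obj_dist_plane(2)[OF pO])
    from span_eq_cross3_hyperplane[OF this] show ?thesis by (simp only: sp[OF p] N_def)
  qed
  assume y: "y \<in> W" and X': "(X has_derivative X') (at y)" and Y': "(Y has_derivative Y') (at y)"
  have sm: "smooth_on W (\<lambda>y. blinfun_inner_right (N y))"
    by (rule smooth_on_linear[OF bounded_linear_blinfun_inner_right W(2) N])
  have "\<exists>u v w. wedge_ext_deriv (\<lambda>y. blinfun_inner_right (N y)) y u v w \<noteq> 0"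
  proof -
    have "\<forall>W \<alpha>. open W \<and> W \<subseteq> snd c ` fst c \<and> smooth_on W \<alpha> \<and>
        (\<forall>p\<in>fst c. snd c p \<in> W \<longrightarrow>
           coord_deriv (obj S) c p ` obj_dist S p = {v. blinfun_apply (\<alpha> (snd c p)) v = 0})
        \<longrightarrow> (\<forall>y\<in>W. \<exists>u v w. wedge_ext_deriv \<alpha> y u v w \<noteq> 0)"
      using obj_contact W(1) unfolding contact_structure_def by (elim conjE) (rule bspec)
    from this[rule_format, of W "\<lambda>y. blinfun_inner_right (N y)" y] show ?thesis
      using W(2,3) sm k y by simp
  qed
  moreover obtain N' where N': "(N has_derivative N') (at y)"
    using smooth_on_has_derivative[OF N W(2) y] by blast
  ultimately have ne: "N' (X y) \<bullet> Y y - N' (Y y) \<bullet> X y \<noteq> 0"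
    using wedge_conormal_zero[OF N', of "X y" "Y y"] by (auto simp: N_def)
  have 1: "N y \<bullet> X' v + N' v \<bullet> X y = 0" for v
    by (rule has_derivative_zero_on_open[OF has_derivative_inner[OF N' X'] W(2) y]) (simp add: N_def dot_cross_self)
  have 2: "N y \<bullet> Y' v + N' v \<bullet> Y y = 0" for v
    by (rule has_derivative_zero_on_open[OF has_derivative_inner[OF N' Y'] W(2) y]) (simp add: N_def dot_cross_self)
  show "N y \<bullet> (X' (Y y) - Y' (X y)) \<noteq> 0"
    using ne 1[of "Y y"] 2[of "X y"] by (simp add: inner_diff_right)
qed

text \<open>The vector \<open>b\<close> is the bracket at \<open>x\<close> of a local frame of the contact structure, carried back from the
  chart of the frame. It is transverse by the contact condition. An arrow acting trivially on the
  contact plane fixes it modulo the plane, because the local diffeomorphism preserves the contact structure.\<close>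

lemma isotropy_transverse:
  assumes x: "x \<in> points (obj S)" and k: "k \<in> isotropy S x"
    and fixed: "\<And>v. v \<in> obj_dist S x \<Longrightarrow> arrow_deriv S k v = v"
  obtains b where "b \<notin> obj_dist S x" "arrow_deriv S k b - b \<in> obj_dist S x"
proof -
  note k' = isotropyD[OF k]
  have "\<exists>c W X Y. x \<in> fst c \<and> snd c x \<in> W \<and> local_frame (obj S) (obj_dist S) c W X Y"
    using obj_rank2 x unfolding rank2_distribution_def by simp
  then obtain c W0 X Y where c: "x \<in> fst c" "snd c x \<in> W0" and fr: "local_frame (obj S) (obj_dist S) c W0 X Y"
    by (elim exE conjE)
  have W0: "c \<in> obj S" "open W0" "W0 \<subseteq> snd c ` fst c" "smooth_on W0 X" "smooth_on W0 Y"
    and sp: "\<And>p. p \<in> fst c \<Longrightarrow> snd c p \<in> W0 \<Longrightarrow> coord_deriv (obj S) c p ` obj_dist S p = span {X (snd c p), Y (snd c p)}"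
    using fr by (simp_all add: local_frame_def)
  define N where "N = (\<lambda>y. cross3 (X y) (Y y))"
  have N: "smooth_on W0 N"
    "\<And>p. p \<in> fst c \<Longrightarrow> snd c p \<in> W0 \<Longrightarrow> coord_deriv (obj S) c p ` obj_dist S p = {v. N (snd c p) \<bullet> v = 0}"
    "\<And>y X' Y'. y \<in> W0 \<Longrightarrow> (X has_derivative X') (at y) \<Longrightarrow> (Y has_derivative Y') (at y) \<Longrightarrow>
      N y \<bullet> (X' (Y y) - Y' (X y)) \<noteq> 0"
    unfolding N_def by (rule contact_frame[OF fr]; assumption)+
  obtain V \<sigma> where sec: "local_section k V \<sigma>" by (rule local_section_exists[OF k'(1)])
  note s = local_sectionD[OF sec]
  have xV: "x \<in> V" using s(3) k'(2) by simp
  have fx: "(tgt S \<circ> \<sigma>) x = x" using s(6) k'(2,3) by simp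
  have fc: "(tgt S \<circ> \<sigma>) x \<in> fst c" using fx c(1) by simp
  define \<phi> where "\<phi> = snd c \<circ> (tgt S \<circ> \<sigma>) \<circ> chart_inv c"
  obtain W1 where W1: "open W1" "snd c x \<in> W1" "W1 \<subseteq> snd c ` (V \<inter> fst c)"
    "\<And>y. y \<in> W1 \<Longrightarrow> (tgt S \<circ> \<sigma>) (chart_inv c y) \<in> fst c" "smooth_on W1 \<phi>"
    by (rule smooth_map_on_chart[OF obj_manifold obj_manifold s(2) section_tgt_smooth[OF sec] xV W0(1) c(1) W0(1) fc])
      (rule that[unfolded \<phi>_def])
  define a where "a = snd c x"
  have \<phi>a: "\<phi> a = a" using fx by (simp add: \<phi>_def a_def chart_inv_left[OF obj_manifold W0(1) c(1)])
  \<comment> \<open>On \<open>W\<close> both \<open>y\<close> and \<open>\<phi> y\<close> stay in the domain of the frame.\<close>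
  define W where "W = W0 \<inter> (\<phi> -` W0 \<inter> W1)"
  have oW: "open W" unfolding W_def
    using continuous_on_open_vimage[OF W1(1)] smooth_on_continuous_on[OF W1(5)] W0(2) by blast
  have aW: "a \<in> W" using c(2) W1(2) \<phi>a by (simp add: W_def a_def)
  have W: "y \<in> W0" "\<phi> y \<in> W0" "y \<in> W1" if "y \<in> W" for y using that by (auto simp: W_def)
  have smW: "smooth_on W \<phi>" by (rule smooth_on_subset[OF W1(5)]) (auto simp: W_def)
  let ?T = "coord_deriv (obj S) c"
  have deriv: "frechet_derivative \<phi> (at (snd c p)) = ?T (tgt S (\<sigma> p)) \<circ> arrow_deriv S (\<sigma> p) \<circ> inv (?T p)"
    if p: "p \<in> V" "p \<in> fst c" "tgt S (\<sigma> p) \<in> fst c" for p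
  proof -
    have "local_section (\<sigma> p) V \<sigma>"
      unfolding local_section_def using s(2,4) s(5,7)[OF p(1)] s(5) p(1) by simp
    from arrow_deriv_section[OF this] have "mderiv (obj S) (obj S) (tgt S \<circ> \<sigma>) p = arrow_deriv S (\<sigma> p)"
      by (simp only: s(5)[OF p(1)])
    moreover have "(tgt S \<circ> \<sigma>) p \<in> fst c" using p(3) by simp
    ultimately show ?thesis
      using chart_rep_deriv[OF obj_manifold obj_manifold s(2) section_tgt_smooth[OF sec] p(1) W0(1) p(2) W0(1)]
      unfolding \<phi>_def by (simp only: frechet_derivative_eqI comp_apply)
  qed
  have inv: "N (\<phi> y) \<bullet> frechet_derivative \<phi> (at y) v = 0" if y: "y \<in> W" and v: "N y \<bullet> v = 0" for y v
  proof -
    obtain p where p: "p \<in> V" "p \<in> fst c" "y = snd c p" using W1(3) W(3)[OF y] by auto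
    have ci: "chart_inv c y = p" unfolding p(3) by (rule chart_inv_left[OF obj_manifold W0(1) p(2)])
    have q: "tgt S (\<sigma> p) \<in> fst c" "\<phi> y = snd c (tgt S (\<sigma> p))" using W1(4)[OF W(3)[OF y]] by (simp_all add: ci \<phi>_def)
    have "v \<in> ?T p ` obj_dist S p" using N(2)[OF p(2)] W(1)[OF y] v by (simp add: p(3))
    then obtain u where u: "u \<in> obj_dist S p" "v = ?T p u" by auto
    have "inv (?T p) v = u"
      unfolding u(2) by (rule inv_f_f[OF bij_is_inj[OF coord_deriv_bij(1)[OF obj_manifold W0(1) p(2)]]])
    then have "frechet_derivative \<phi> (at y) v = ?T (tgt S (\<sigma> p)) (arrow_deriv S (\<sigma> p) u)"
      unfolding p(3) deriv[OF p(1,2) q(1)] by simp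
    moreover have "arrow_deriv S (\<sigma> p) u \<in> obj_dist S (tgt S (\<sigma> p))"
      using arrow_deriv_dist[OF s(7)[OF p(1)]] u(1) s(5)[OF p(1)] by auto
    ultimately have "frechet_derivative \<phi> (at y) v \<in> ?T (tgt S (\<sigma> p)) ` obj_dist S (tgt S (\<sigma> p))"
      by simp
    then show ?thesis using N(2)[OF q(1)] W(2)[OF y] by (simp add: q(2))
  qed
  let ?D = "frechet_derivative \<phi> (at a)"
  have Da: "?D = ?T x \<circ> arrow_deriv S k \<circ> inv (?T x)"
  proof -
    have sx: "\<sigma> x = k" using s(6) k'(2) by simp
    have "tgt S (\<sigma> x) \<in> fst c" using c(1) by (simp only: sx k'(3))
    from deriv[OF xV c(1) this] show ?thesis by (simp only: a_def sx k'(3))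
  qed
  note Tb = coord_deriv_bij(1)[OF obj_manifold W0(1) c(1)] and Tl = coord_deriv_linear[OF obj_manifold W0(1) c(1)]
  have T: "?T x ` obj_dist S x = {v. N a \<bullet> v = 0}" using N(2)[OF c] by (simp add: a_def)
  have fix': "?D v = v" if "N a \<bullet> v = 0" for v
  proof -
    have "v \<in> ?T x ` obj_dist S x" using that by (simp add: T)
    then obtain u where "v = ?T x u" "u \<in> obj_dist S x" by (rule imageE)
    then show ?thesis unfolding Da by (simp add: fixed inv_f_f[OF bij_is_inj[OF Tb]])
  qed
  have NX: "N y \<bullet> X y = 0" and NY: "N y \<bullet> Y y = 0" for y by (simp_all add: N_def dot_cross_self)
  obtain X' where X': "(X has_derivative X') (at a)"
    by (rule that[OF smooth_on_has_derivative[OF W0(4,2) W(1)[OF aW]]])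
  obtain Y' where Y': "(Y has_derivative Y') (at a)"
    by (rule that[OF smooth_on_has_derivative[OF W0(5,2) W(1)[OF aW]]])
  obtain N' where N': "(N has_derivative N') (at a)"
    by (rule that[OF smooth_on_has_derivative[OF N(1) W0(2) W(1)[OF aW]]])
  define b where "b = X' (Y a) - Y' (X a)"
  have b: "N a \<bullet> b \<noteq> 0" unfolding b_def by (rule N(3)[OF W(1)[OF aW] X' Y'])
  have "N a \<bullet> ?D b = N a \<bullet> b" unfolding b_def
    by (rule bracket_conormal_invariant[OF oW aW smW \<phi>a X' Y' N' NX NY inv[OF _ NX] inv[OF _ NY] fix'[OF NX] fix'[OF NY]])
  then have "N a \<bullet> (?D b - b) = 0" by (simp add: inner_diff_right)
  then have "?D b - b \<in> ?T x ` obj_dist S x" using T by simp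
  then obtain u where u: "?D b - b = ?T x u" "u \<in> obj_dist S x" by (rule imageE)
  \<comment> \<open>The differential \<open>?T x\<close> carries the preferred coordinates at \<open>x\<close> to those of the chart of the frame.\<close>
  define b' where "b' = inv (?T x) b"
  have Tb': "?T x b' = b" unfolding b'_def by (rule surj_f_inv_f[OF bij_is_surj[OF Tb]])
  have "b' \<notin> obj_dist S x"
  proof
    assume "b' \<in> obj_dist S x"
    from imageI[OF this, of "?T x"] show False using b unfolding T Tb' by simp
  qed
  moreover have "?T x (arrow_deriv S k b' - b') = ?T x u"
    using u(1) unfolding Da by (simp add: linear_diff[OF Tl] Tb' b'_def[symmetric])
  then have "arrow_deriv S k b' - b' = u" by (rule injD[OF bij_is_inj[OF Tb]])
  then have "arrow_deriv S k b' - b' \<in> obj_dist S x" using u(2) by simp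
  ultimately show thesis by (rule that)
qed

end

section \<open>Freeness of the prolongations\<close>

text \<open>The two properties shared by \<^const>\<open>lines\<close> and \<^const>\<open>rays\<close> that freeness of a
  prolongation depends on. Only positive multiples are required, so that rays are included.\<close>

definition natural_fibres :: "('e::euclidean_space set \<Rightarrow> 'e set set) \<Rightarrow> bool" where
  "natural_fibres Fib \<longleftrightarrow>
     (\<forall>P l. l \<in> Fib P \<longrightarrow> (\<exists>u\<in>l. u \<noteq> 0 \<and> u \<in> P \<and> (\<forall>t>0. t *\<^sub>R u \<in> l))) \<and>
     (\<forall>L P. linear L \<and> inj L \<longrightarrow> Fib (L ` P) = (\<lambda>l. L ` l) ` Fib P)"

lemma natural_fibres_lines: "natural_fibres lines"
  unfolding natural_fibres_def
proof (intro conjI allI impI)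
  fix P l :: "'a set" assume l: "l \<in> lines P"
  then have "l \<noteq> {0}" by (auto simp: lines_def)
  moreover have "0 \<in> l" using l by (simp add: lines_def subspace_0)
  ultimately obtain u where "u \<in> l" "u \<noteq> 0" by auto
  then show "\<exists>u\<in>l. u \<noteq> 0 \<and> u \<in> P \<and> (\<forall>t>0. t *\<^sub>R u \<in> l)"
    using l by (auto simp: lines_def subspace_scale)
next
  fix L :: "'a \<Rightarrow> 'a" and P assume "linear L \<and> inj L"
  then have L: "linear L" "inj L" by auto
  have dim: "dim (L ` l) = dim l" for l by (rule dim_image_eq[OF L(1) inj_on_subset[OF L(2) subset_UNIV]])
  show "lines (L ` P) = (\<lambda>l. L ` l) ` lines P"
  proof (intro equalityI subsetI)
    fix m assume m: "m \<in> lines (L ` P)"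
    then have im: "L ` (L -` m) = m" by (auto simp: lines_def)
    then have "dim (L -` m) = 1" using dim[of "L -` m"] m by (simp add: lines_def)
    moreover have "m \<subseteq> L ` P" using m by (simp add: lines_def)
    then have "L -` m \<subseteq> P" using vimage_mono inj_vimage_image_eq[OF L(2)] by metis
    ultimately have "L -` m \<in> lines P"
      using m linear_subspace_vimage[OF L(1)] by (simp add: lines_def)
    then show "m \<in> (\<lambda>l. L ` l) ` lines P" using im by (metis imageI)
  next
    fix m assume "m \<in> (\<lambda>l. L ` l) ` lines P"
    then show "m \<in> lines (L ` P)" using linear_subspace_image[OF L(1)] dim by (auto simp: lines_def)
  qed
qed

lemma natural_fibres_rays: "natural_fibres rays"
  unfolding natural_fibres_def
proof (intro conjI allI impI)
  fix P l :: "'a set" assume "l \<in> rays P"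
  then obtain w where w: "w \<in> P" "w \<noteq> 0" "l = {c *\<^sub>R w |c. c > 0}" by (auto simp: rays_def)
  have "t *\<^sub>R w \<in> l" if "t > 0" for t using w(3) that by blast
  then show "\<exists>u\<in>l. u \<noteq> 0 \<and> u \<in> P \<and> (\<forall>t>0. t *\<^sub>R u \<in> l)"
    using w(1,2) by (intro bexI[of _ w]) (use scaleR_one zero_less_one in metis)+
next
  fix L :: "'a \<Rightarrow> 'a" and P assume "linear L \<and> inj L"
  then have L: "linear L" "inj L" by auto
  have "L ` {c *\<^sub>R w |c. c > 0} = {c *\<^sub>R L w |c. c > 0}" for w
    by (simp add: setcompr_eq_image image_image linear_cmul[OF L(1)])
  moreover have "L ` P - {0} = L ` (P - {0})"
    using linear_0[OF L(1)] L(2) by (auto simp: inj_def)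
  moreover have "rays P = (\<lambda>w. {c *\<^sub>R w |c. c > 0}) ` (P - {0})" for P :: "'a set"
    by (auto simp: rays_def)
  ultimately show "rays (L ` P) = (\<lambda>l. L ` l) ` rays P"
    by (simp add: image_image)
qed

lemma local_frame_swap: "local_frame A \<xi> c W X Y \<Longrightarrow> local_frame A \<xi> c W Y X"
  by (simp add: local_frame_def insert_commute)

lemma local_frame_scale:
  assumes "local_frame A \<xi> c W X Y" "s \<noteq> 0"
  shows "local_frame A \<xi> c W (\<lambda>y. s *\<^sub>R X y) Y"
proof -
  have 1: "span {s *\<^sub>R x, y} = span {x, y}" for x y :: 'b
  proof (rule span_eq[THEN iffD2, OF conjI])
    show "{s *\<^sub>R x, y} \<subseteq> span {x, y}" by (simp add: span_base span_scale)
    have "(1 / s) *\<^sub>R (s *\<^sub>R x) \<in> span {s *\<^sub>R x, y}" by (intro span_scale span_base) simp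
    then show "{x, y} \<subseteq> span {s *\<^sub>R x, y}" using assms(2) by (simp add: span_base)
  qed
  have "smooth_on W (\<lambda>y. s *\<^sub>R X y)"
    using assms(1) by (intro smooth_on_linear[OF bounded_linear_scaleR_right]) (simp_all add: local_frame_def)
  then show ?thesis using assms(1) by (simp add: local_frame_def 1)
qed

text \<open>The charts obtained from one frame \<open>X\<close>, \<open>Y\<close> by exchanging the two fields and changing their signs cover the
  whole fibre. If \<open>u = a X + b Y\<close> spans the line or ray and \<open>a \<noteq> 0\<close>, then dividing by \<open>\<bar>a\<bar>\<close> brings the coefficient of
  \<open>X\<close> to \<open>sgn a\<close>.\<close>

lemma points_prolong_atlas:
  assumes A: "manifold A" and \<xi>: "rank2_distribution A \<xi>" and Fib: "natural_fibres Fib"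
  shows "points (prolong_atlas Fib A \<xi>) = {(p, l). p \<in> points A \<and> l \<in> Fib (\<xi> p)}"
proof (intro equalityI subsetI)
  fix q assume "q \<in> points (prolong_atlas Fib A \<xi>)"
  then obtain ch where ch: "ch \<in> prolong_atlas Fib A \<xi>" "q \<in> fst ch"
    unfolding points_def by (rule UN_E)
  have "\<exists>c\<in>A. fst ch \<subseteq> {(p, l). p \<in> fst c \<and> l \<in> Fib (\<xi> p)}"
    using ch(1) unfolding prolong_atlas_def local_frame_def
    by (elim CollectE exE conjE) (rule bexI[rotated], assumption, auto)
  then obtain c where "c \<in> A" "fst ch \<subseteq> {(p, l). p \<in> fst c \<and> l \<in> Fib (\<xi> p)}" by (rule bexE)
  then show "q \<in> {(p, l). p \<in> points A \<and> l \<in> Fib (\<xi> p)}"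
    using ch(2) unfolding points_def by auto
next
  fix q assume "q \<in> {(p, l). p \<in> points A \<and> l \<in> Fib (\<xi> p)}"
  then obtain p l where q: "q = (p, l)" and p: "p \<in> points A" and l: "l \<in> Fib (\<xi> p)" by auto
  have covered: "q \<in> points (prolong_atlas Fib A \<xi>)"
    if "local_frame A \<xi> c W X Y" "p \<in> fst c" "snd c p \<in> W"
      "X (snd c p) + a *\<^sub>R Y (snd c p) \<in> coord_deriv A c p ` l" for c W X Y a
  proof -
    let ?U = "{(p, l). p \<in> fst c \<and> snd c p \<in> W \<and> l \<in> Fib (\<xi> p) \<and>
          (\<exists>a. X (snd c p) + a *\<^sub>R Y (snd c p) \<in> coord_deriv A c p ` l)}"
    have "\<exists>ch\<in>prolong_atlas Fib A \<xi>. fst ch = ?U"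
      unfolding prolong_atlas_def
      by (rule bexI[rotated], rule CollectI, intro exI conjI, rule refl, rule that(1)) simp
    moreover have "q \<in> ?U" using that(2-4) l by (auto simp: q)
    ultimately show ?thesis unfolding points_def by auto
  qed
  have "\<exists>c W X Y. p \<in> fst c \<and> snd c p \<in> W \<and> local_frame A \<xi> c W X Y"
    using \<xi> p unfolding rank2_distribution_def by simp
  then obtain c W X Y where c: "p \<in> fst c" "snd c p \<in> W" and fr: "local_frame A \<xi> c W X Y"
    by (elim exE conjE)
  let ?T = "coord_deriv A c p" and ?x = "X (snd c p)" and ?y = "Y (snd c p)"
  have cA: "c \<in> A" and sp: "?T ` \<xi> p = span {?x, ?y}" using fr c by (simp_all add: local_frame_def)
  note Tl = coord_deriv_linear[OF A cA c(1)] and Ti = bij_is_inj[OF coord_deriv_bij(1)[OF A cA c(1)]]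
  have "\<exists>u\<in>l. u \<noteq> 0 \<and> u \<in> \<xi> p \<and> (\<forall>t>0. t *\<^sub>R u \<in> l)"
    using Fib l unfolding natural_fibres_def by simp
  then obtain u where u: "u \<in> l" "u \<noteq> 0" "u \<in> \<xi> p" "\<And>t. t > 0 \<Longrightarrow> t *\<^sub>R u \<in> l" by auto
  have "?T u \<in> span {?x, ?y}" using u(3) sp by blast
  then obtain a b where ab: "?T u = a *\<^sub>R ?x + b *\<^sub>R ?y"
    by (auto simp: span_insert span_singleton) (metis add_diff_cancel_left' add.commute diff_add_cancel)
  have "?T u \<noteq> 0" using u(2) linear_injective_0[OF Tl] Ti by blast
  then have "a \<noteq> 0 \<or> b \<noteq> 0" using ab by auto
  have scaled: "sgn s *\<^sub>R v + (t / \<bar>s\<bar>) *\<^sub>R w \<in> ?T ` l" if "?T u = s *\<^sub>R v + t *\<^sub>R w" "s \<noteq> 0" for s t v w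
  proof -
    have "?T ((1 / \<bar>s\<bar>) *\<^sub>R u) = sgn s *\<^sub>R v + (t / \<bar>s\<bar>) *\<^sub>R w"
      using that by (simp add: linear_cmul[OF Tl] scaleR_add_right sgn_real_def abs_if)
    then show ?thesis using u(4)[of "1 / \<bar>s\<bar>"] that(2) by (metis imageI zero_less_abs_iff zero_less_divide_1_iff)
  qed
  from \<open>a \<noteq> 0 \<or> b \<noteq> 0\<close> show "q \<in> points (prolong_atlas Fib A \<xi>)"
  proof
    assume a: "a \<noteq> 0"
    then show ?thesis
      by (intro covered[OF local_frame_scale[OF fr, of "sgn a"] c scaled[OF ab a]]) (simp add: sgn_0_0)
  next
    assume b: "b \<noteq> 0"
    have ba: "?T u = b *\<^sub>R ?y + a *\<^sub>R ?x" using ab by simp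
    show ?thesis
      using b by (intro covered[OF local_frame_scale[OF local_frame_swap[OF fr], of "sgn b"] c scaled[OF ba b]])
        (simp add: sgn_0_0)
  qed
qed

text \<open>If \<open>(g, l)\<close> and \<open>(h, l')\<close> have the same source and target in the prolongation, then the isotropy arrow
  \<open>h\<^sup>-\<^sup>1 g\<close> fixes the common image of \<open>l\<close> and \<open>l'\<close> at the source. Conversely, if \<open>k\<close> fixes \<open>l\<close>, then \<open>k\<close> and the
  identity arrow prolong to arrows with equal source and target.\<close>

lemma (in contact_orbifold) prolongation_is_manifold_iff:
  assumes Fib: "natural_fibres Fib"
  shows "is_manifold (prolongation Fib S) \<longleftrightarrow>
    (\<forall>x\<in>points (obj S). \<forall>k\<in>isotropy S x. (\<exists>l\<in>Fib (obj_dist S x). arrow_deriv S k ` l = l) \<longrightarrow> k = ident S x)"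
proof -
  let ?s = "mderiv (arr S) (obj S) (src S)" and ?t = "mderiv (arr S) (obj S) (tgt S)"
  have pts: "points (prolong_atlas Fib (arr S) (arr_dist S)) = {(g, l). g \<in> points (arr S) \<and> l \<in> Fib (arr_dist S g)}"
    by (rule points_prolong_atlas[OF arr_manifold arr_rank2 Fib])
  have fibre: "Fib (obj_dist S (src S g)) = (\<lambda>l. ?s g ` l) ` Fib (arr_dist S g)" if g: "g \<in> points (arr S)" for g
    using Fib src_deriv_linear[OF g] bij_is_inj[OF src_deriv_bij[OF g]]
    unfolding natural_fibres_def src_deriv_dist[OF g, symmetric] by blast
  have tgt: "?t g ` l = arrow_deriv S g ` (?s g ` l)" if g: "g \<in> points (arr S)" for g l
    by (simp only: tgt_deriv_eq[OF g] image_comp)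
  define \<Phi> where "\<Phi> = (\<lambda>q. (prolong_map (arr S) (obj S) (src S) q, prolong_map (arr S) (obj S) (tgt S) q))"
  have \<Phi>: "\<Phi> (g, l) = ((src S g, ?s g ` l), (tgt S g, arrow_deriv S g ` (?s g ` l)))"
    if g: "g \<in> points (arr S)" for g l
    unfolding \<Phi>_def prolong_map_def by (simp add: tgt[OF g])
  have man: "is_manifold (prolongation Fib S) = inj_on \<Phi> {(g, l). g \<in> points (arr S) \<and> l \<in> Fib (arr_dist S g)}"
    by (simp only: is_manifold_def prolongation_def groupoid.simps pts \<Phi>_def)
  show ?thesis
  proof
    assume free: "is_manifold (prolongation Fib S)"
    show "\<forall>x\<in>points (obj S). \<forall>k\<in>isotropy S x. (\<exists>l\<in>Fib (obj_dist S x). arrow_deriv S k ` l = l) \<longrightarrow> k = ident S x"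
    proof (intro ballI impI)
      fix x k assume x: "x \<in> points (obj S)" and k: "k \<in> isotropy S x" and "\<exists>l\<in>Fib (obj_dist S x). arrow_deriv S k ` l = l"
      then obtain l where l: "l \<in> Fib (obj_dist S x)" "arrow_deriv S k ` l = l" by blast
      note k' = isotropyD[OF k] and e = isotropyD[OF isotropy_ident[OF x]]
      obtain m where m: "m \<in> Fib (arr_dist S k)" "?s k ` m = l" using fibre[OF k'(1)] l(1) k'(2) by auto
      obtain m' where m': "m' \<in> Fib (arr_dist S (ident S x))" "?s (ident S x) ` m' = l"
        using fibre[OF e(1)] l(1) e(2) by auto
      show "k = ident S x"
        using inj_onD[OF free[unfolded man], of "(k, m)" "(ident S x, m')"]
        by (simp add: \<Phi>[OF k'(1)] \<Phi>[OF e(1)] k' e m m' l(2) arrow_deriv_ident[OF x])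
    qed
  next
    assume fixed: "\<forall>x\<in>points (obj S). \<forall>k\<in>isotropy S x. (\<exists>l\<in>Fib (obj_dist S x). arrow_deriv S k ` l = l) \<longrightarrow> k = ident S x"
    show "is_manifold (prolongation Fib S)"
      unfolding man
    proof (rule inj_onI)
      fix q q' assume q: "q \<in> {(g, l). g \<in> points (arr S) \<and> l \<in> Fib (arr_dist S g)}"
        and q': "q' \<in> {(g, l). g \<in> points (arr S) \<and> l \<in> Fib (arr_dist S g)}" and qq: "\<Phi> q = \<Phi> q'"
      obtain g l where gl: "q = (g, l)" and g: "g \<in> points (arr S)" and l: "l \<in> Fib (arr_dist S g)"
        using q by auto
      obtain h l' where hl: "q' = (h, l')" and h: "h \<in> points (arr S)"
        using q' by auto
      have st: "src S g = src S h" "tgt S g = tgt S h" and eq: "?s g ` l = ?s h ` l'"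
        and "arrow_deriv S g ` (?s g ` l) = arrow_deriv S h ` (?s h ` l')"
        using qq unfolding gl hl \<Phi>[OF g] \<Phi>[OF h] prod.inject by blast+
      then have aeq: "arrow_deriv S g ` (?s g ` l) = arrow_deriv S h ` (?s g ` l)" by (simp only:)
      define k where "k = mult S (invs S h) g"
      have c: "src S (invs S h) = tgt S g" using src_inv[OF h] st by simp
      have k: "k \<in> isotropy S (src S g)"
        unfolding isotropy_def k_def using mult_in[OF inv_in[OF h] g c] src_mult[OF inv_in[OF h] g c]
          tgt_mult[OF inv_in[OF h] g c] tgt_inv[OF h] st by simp
      have "arrow_deriv S k ` (?s g ` l) = arrow_deriv S (invs S h) ` (arrow_deriv S g ` (?s g ` l))"
        unfolding k_def by (simp only: arrow_deriv_mult[OF inv_in[OF h] g c] image_comp comp_assoc)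
      also have "\<dots> = (arrow_deriv S (invs S h) \<circ> arrow_deriv S h) ` (?s g ` l)"
        unfolding aeq by (rule image_comp)
      finally have "arrow_deriv S k ` (?s g ` l) = ?s g ` l" by (simp add: arrow_deriv_inv(1)[OF h])
      moreover have "?s g ` l \<in> Fib (obj_dist S (src S g))" using fibre[OF g] l by simp
      ultimately have "k = ident S (src S g)" using fixed src_in[OF g] k by blast
      then have "mult S h k = h" using mult_ident_right[OF h] st by simp
      moreover have "mult S h k = mult S (mult S h (invs S h)) g"
        unfolding k_def using mult_assoc[OF h inv_in[OF h] g] tgt_inv[OF h] c by simp
      moreover have "\<dots> = g" using mult_inv_right[OF h] mult_ident_left[OF g] st by simp
      ultimately have gh: "g = h" by simp
      moreover have "l = l'" using eq unfolding gh
        by (rule inj_image_eq_iff[OF bij_is_inj[OF src_deriv_bij[OF h]], THEN iffD1])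
      ultimately show "q = q'" unfolding gl hl by simp
    qed
  qed
qed

section \<open>Linear maps acting on a plane\<close>

lemma fixed_ray_iff:
  fixes A :: "'e::euclidean_space \<Rightarrow> 'e"
  assumes A: "linear A"
  shows "(\<exists>l\<in>rays P. A ` l = l) \<longleftrightarrow> (\<exists>u\<in>P - {0}. \<exists>\<mu>>0. A u = \<mu> *\<^sub>R u)"
proof
  assume "\<exists>l\<in>rays P. A ` l = l"
  then obtain w where w: "w \<in> P - {0}" "A ` {c *\<^sub>R w |c. c > 0} = {c *\<^sub>R w |c. c > 0}"
    by (auto simp: rays_def)
  have "1 *\<^sub>R w \<in> {c *\<^sub>R w |c. c > 0}" using zero_less_one by blast
  from imageI[OF this, of A] have "A w \<in> {c *\<^sub>R w |c. c > 0}" unfolding w(2) by simp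
  then show "\<exists>u\<in>P - {0}. \<exists>\<mu>>0. A u = \<mu> *\<^sub>R u" using w(1) by blast
next
  assume "\<exists>u\<in>P - {0}. \<exists>\<mu>>0. A u = \<mu> *\<^sub>R u"
  then obtain u \<mu> where u: "u \<in> P - {0}" "\<mu> > 0" "A u = \<mu> *\<^sub>R u" by blast
  let ?l = "{c *\<^sub>R u |c. c > 0}"
  have "A ` ?l = ?l"
  proof (intro equalityI subsetI)
    fix v assume "v \<in> A ` ?l"
    then obtain c where "c > 0" "v = (c * \<mu>) *\<^sub>R u" by (auto simp: linear_cmul[OF A] u(3))
    then show "v \<in> ?l" using u(2) mult_pos_pos by blast
  next
    fix v assume "v \<in> ?l"
    then obtain c where c: "c > 0" "v = c *\<^sub>R u" by blast
    then have "v = A ((c / \<mu>) *\<^sub>R u)" using u(2) by (simp add: linear_cmul[OF A] u(3))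
    moreover have "c / \<mu> > 0" using c u(2) by simp
    ultimately show "v \<in> A ` ?l" by blast
  qed
  moreover have "?l \<in> rays P" using u(1) by (auto simp: rays_def)
  ultimately show "\<exists>l\<in>rays P. A ` l = l" by blast
qed

lemma fixed_line_eigenvector:
  fixes A :: "'e::euclidean_space \<Rightarrow> 'e"
  assumes A: "linear A" and l: "l \<in> lines P" "A ` l = l"
  obtains u \<mu> where "u \<in> P" "u \<noteq> 0" "A u = \<mu> *\<^sub>R u"
proof -
  have d: "dim l = 1" "subspace l" "l \<subseteq> P" using l by (auto simp: lines_def)
  then have "\<not> l \<subseteq> {0}" by (metis dim_eq_0 zero_neq_one)
  then obtain u where u0: "u \<in> l" "u \<noteq> 0" by blast
  have "span {u} = l"
    by (rule subspace_dim_equal) (use d u0 in \<open>auto simp: span_minimal\<close>)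
  then have u: "u \<noteq> 0" "l = span {u}" "u \<in> l" using u0 by simp_all
  then have "A u \<in> span {u}" using l(2) u(2) by blast
  then obtain \<mu> where "A u = \<mu> *\<^sub>R u" by (auto simp: span_singleton)
  then show thesis using that u(1,3) d(3) by blast
qed

lemma eigenvector_fixed_line:
  fixes A :: "'e::euclidean_space \<Rightarrow> 'e"
  assumes A: "linear A" and P: "subspace P" and u: "u \<in> P" "u \<noteq> 0" "A u = \<mu> *\<^sub>R u" "\<mu> \<noteq> 0"
  shows "\<exists>l\<in>lines P. A ` l = l"
proof
  have "A ` span {u} = span {\<mu> *\<^sub>R u}" by (simp add: linear_span_image[OF A, symmetric] u(3))
  also have "\<dots> = span {u}"
    using u(4) span_image_scale[of "{u}" "\<lambda>_. \<mu>"] by simp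
  finally show "A ` span {u} = span {u}" .
  have "dim (span {u}) = 1" using u(2) by simp
  then show "span {u} \<in> lines P" using P u(1) by (simp add: lines_def span_minimal)
qed

lemma plane_coordinates:
  fixes u v w :: "'e::euclidean_space"
  assumes P: "dim P = 2" and uv: "u \<in> P" "v \<in> P" "u \<noteq> v" "independent {u, v}" and w: "w \<in> P"
  obtains a b where "w = a *\<^sub>R u + b *\<^sub>R v"
proof -
  have "P \<subseteq> span {u, v}"
    by (rule card_ge_dim_independent) (use uv P in auto)
  then have "w \<in> span {u, v}" using w by blast
  then obtain a where "w - a *\<^sub>R u \<in> span {v}" using span_breakdown_eq by blast
  then obtain b where "w - a *\<^sub>R u = b *\<^sub>R v" by (auto simp: span_singleton)
  then have "w = a *\<^sub>R u + b *\<^sub>R v" by (simp add: algebra_simps)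
  then show thesis by (rule that)
qed

lemma independent_pair_zero:
  fixes u v :: "'e::euclidean_space"
  assumes "independent {u, v}" "u \<noteq> v" "a *\<^sub>R u + b *\<^sub>R v = 0"
  shows "a = 0" "b = 0"
proof -
  have "\<forall>w\<in>{u, v}. (if w = u then a else b) = 0"
    using assms(1) independentD[of "{u, v}" "{u, v}" "\<lambda>w. if w = u then a else b"] assms(2,3) by auto
  then show "a = 0" "b = 0" using assms(2) by auto
qed

text \<open>In some basis \<open>u\<close>, \<open>v\<close> of the plane the determinant of \<open>A\<close> is not positive, and by injectivity it is
  not 0. Being negative, it forces real eigenvalues of opposite signs; let \<open>\<mu>\<close> be the positive one. Its
  eigenvector is read off from a row of the matrix of \<open>A - \<mu>\<close>, and at least one of the two rows is
  nonzero.\<close>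

lemma orientation_reversing_eigenvector:
  fixes A :: "'e::euclidean_space \<Rightarrow> 'e"
  assumes A: "linear A" "inj A" and P: "subspace P" "dim P = 2" and AP: "A ` P \<subseteq> P"
    and rev: "\<not> preserves_plane_orientation P A"
  obtains u \<mu> where "u \<in> P" "u \<noteq> 0" "\<mu> > 0" "A u = \<mu> *\<^sub>R u"
proof -
  note conclusion = that
  obtain u v where uv: "u \<in> P" "v \<in> P" "u \<noteq> v" "independent {u, v}"
    and neg: "\<And>a b c d. A u = a *\<^sub>R u + b *\<^sub>R v \<Longrightarrow> A v = c *\<^sub>R u + d *\<^sub>R v \<Longrightarrow> a * d - b * c \<le> 0"
    using rev unfolding preserves_plane_orientation_def by (metis not_le)
  note ind = independent_pair_zero[OF uv(4,3)]
  obtain a b where ab: "A u = a *\<^sub>R u + b *\<^sub>R v"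
    using plane_coordinates[OF P(2) uv, of "A u"] AP uv by blast
  obtain c d where cd: "A v = c *\<^sub>R u + d *\<^sub>R v"
    using plane_coordinates[OF P(2) uv, of "A v"] AP uv by blast
  have Apq: "A (p *\<^sub>R u + q *\<^sub>R v) = (p * a + q * c) *\<^sub>R u + (p * b + q * d) *\<^sub>R v" for p q
    by (simp add: linear_add[OF A(1)] linear_cmul[OF A(1)] ab cd algebra_simps)
  have inj0: "w = 0" if "A w = 0" for w using that A(2) linear_0[OF A(1)] by (metis injD)
  \<comment> \<open>If the determinant vanished, \<open>d u - b v\<close> and \<open>c u - a v\<close> would lie in the kernel of \<open>A\<close>.\<close>
  have "a * d - b * c \<noteq> 0"
  proof
    assume z: "a * d - b * c = 0"
    have "A (d *\<^sub>R u + (- b) *\<^sub>R v) = 0" unfolding Apq using z by (simp add: algebra_simps)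
    then have 1: "d = 0" "- b = 0" using inj0 ind by blast+
    have "A (c *\<^sub>R u + (- a) *\<^sub>R v) = 0" unfolding Apq using 1 by (simp add: algebra_simps)
    then have "c = 0" "- a = 0" using inj0 ind by blast+
    then have "A u = 0" using ab 1 by simp
    then have "1 *\<^sub>R u + 0 *\<^sub>R v = 0" using inj0 by simp
    then show False using ind(1) by fastforce
  qed
  then have det: "a * d - b * c < 0" using neg[OF ab cd] by simp
  define r where "r = sqrt ((a + d)\<^sup>2 - 4 * (a * d - b * c))"
  define \<mu> where "\<mu> = (a + d + r) / 2"
  have r2: "r\<^sup>2 = (a + d)\<^sup>2 - 4 * (a * d - b * c)" unfolding r_def using det by (intro real_sqrt_pow2) (smt (verit) zero_le_power2)
  have "r > \<bar>a + d\<bar>" unfolding r_def using det by (intro real_less_rsqrt) simp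
  then have \<mu>0: "\<mu> > 0" by (simp add: \<mu>_def)
  have char: "\<mu> * \<mu> - (a + d) * \<mu> + (a * d - b * c) = 0"
  proof -
    have "4 * (\<mu> * \<mu> - (a + d) * \<mu> + (a * d - b * c)) = r\<^sup>2 - (a + d)\<^sup>2 + 4 * (a * d - b * c)"
      by (simp add: \<mu>_def power2_eq_square field_simps)
    then show ?thesis using r2 by simp
  qed
  have ev: thesis if "p * a + q * c = \<mu> * p" "p * b + q * d = \<mu> * q" "p \<noteq> 0 \<or> q \<noteq> 0" for p q
  proof (rule conclusion[OF _ _ \<mu>0])
    show "A (p *\<^sub>R u + q *\<^sub>R v) = \<mu> *\<^sub>R (p *\<^sub>R u + q *\<^sub>R v)"
      unfolding Apq using \<open>p * a + q * c = \<mu> * p\<close> \<open>p * b + q * d = \<mu> * q\<close> by (simp add: scaleR_add_right)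
    show "p *\<^sub>R u + q *\<^sub>R v \<in> P" using P(1) uv(1,2) by (simp add: subspace_add subspace_scale)
    show "p *\<^sub>R u + q *\<^sub>R v \<noteq> 0" using ind \<open>p \<noteq> 0 \<or> q \<noteq> 0\<close> by blast
  qed
  show thesis
  proof (cases "c = 0 \<and> \<mu> = a")
    case False
    then show ?thesis using char by (intro ev[of c "\<mu> - a"]) (auto simp: algebra_simps)
  next
    case True
    have "\<not> (b = 0 \<and> \<mu> = d)" using True det by auto
    then show ?thesis using char True by (intro ev[of "\<mu> - d" b]) (auto simp: algebra_simps)
  qed
qed

text \<open>The iterates of \<open>v\<close> under \<open>A\<close> are \<open>v + m w\<close>, which is periodic in \<open>m\<close> only for \<open>w = 0\<close>.\<close>

lemma unipotent_finite_order:
  fixes A :: "'e::real_vector \<Rightarrow> 'e"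
  assumes A: "linear A" "A ^^ n = id" "n > 0" and w: "A w = w" and v: "A v = v + w"
  shows "w = 0"
proof -
  have "(A ^^ m) v = v + real m *\<^sub>R w" for m
  proof (induction m)
    case (Suc m)
    then show ?case by (simp add: linear_add[OF A(1)] linear_cmul[OF A(1)] v w algebra_simps)
  qed simp
  from this[of n] show ?thesis using A(2,3) by simp
qed

lemma eigenvalue_finite_order:
  fixes A :: "'e::real_vector \<Rightarrow> 'e"
  assumes A: "linear A" "A ^^ n = id" and u: "u \<noteq> 0" "A u = \<mu> *\<^sub>R u"
  shows "\<mu> ^ n = 1"
proof -
  have "(A ^^ m) u = \<mu> ^ m *\<^sub>R u" for m
    by (induction m) (simp_all add: linear_cmul[OF A(1)] u(2) mult.commute)
  from this[of n] have "(\<mu> ^ n - 1) *\<^sub>R u = 0" using A(2) by (simp add: algebra_simps)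
  then show ?thesis using u(1) by simp
qed

text \<open>In a basis \<open>u\<close>, \<open>v\<close> the matrix of \<open>A\<close> is triangular with positive diagonal entries that are roots of unity, so
  \<open>A\<close> is unipotent and of finite order.\<close>

lemma orientation_preserving_fixed_plane:
  fixes A :: "'e::euclidean_space \<Rightarrow> 'e"
  assumes A: "linear A" "A ^^ n = id" "n > 0" and P: "subspace P" "dim P = 2"
    and pos: "preserves_plane_orientation P A"
    and u: "u \<in> P" "u \<noteq> 0" "\<mu> > 0" "A u = \<mu> *\<^sub>R u"
  shows "\<forall>w\<in>P. A w = w"
proof -
  have "\<mu> ^ n = 1" by (rule eigenvalue_finite_order[OF A(1,2) u(2,4)])
  then have "\<mu> = 1" using u(3) A(3) power_eq_1_iff[of \<mu> n] by auto
  then have Au: "A u = u" using u(4) by simp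
  have "\<not> P \<subseteq> span {u}"
  proof
    assume "P \<subseteq> span {u}"
    then have "dim P \<le> card {u}" by (rule dim_le_card) simp
    then show False using P(2) by simp
  qed
  then obtain v where v: "v \<in> P" "v \<notin> span {u}" by blast
  have "independent {u}" using u(2) by simp
  then have ind: "independent {u, v}" using v(2) independent_insertI[of v "{u}"] by (simp add: insert_commute)
  have uv: "u \<noteq> v" using v(2) span_base[of u "{u}"] by auto
  obtain a b c d where ab: "A u = a *\<^sub>R u + b *\<^sub>R v" and cd: "A v = c *\<^sub>R u + d *\<^sub>R v" and det: "a * d - b * c > 0"
    using pos u(1) v(1) uv ind unfolding preserves_plane_orientation_def by blast
  have "(a - 1) *\<^sub>R u + b *\<^sub>R v = 0" using ab Au by (simp add: algebra_simps)
  from independent_pair_zero[OF ind uv this] have "a = 1" "b = 0" by simp_all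
  then have d: "d > 0" using det by simp
  have pw: "\<exists>t. (A ^^ m) v = t *\<^sub>R u + d ^ m *\<^sub>R v" for m
  proof (induction m)
    case (Suc m)
    then obtain t where "(A ^^ m) v = t *\<^sub>R u + d ^ m *\<^sub>R v" by blast
    then have "(A ^^ Suc m) v = (t + d ^ m * c) *\<^sub>R u + d ^ Suc m *\<^sub>R v"
      by (simp add: linear_add[OF A(1)] linear_cmul[OF A(1)] Au cd algebra_simps)
    then show ?case by blast
  qed (auto intro: exI[of _ 0])
  obtain t where "(A ^^ n) v = t *\<^sub>R u + d ^ n *\<^sub>R v" using pw by blast
  then have "t *\<^sub>R u + (d ^ n - 1) *\<^sub>R v = 0" using A(2) by (simp add: algebra_simps)
  then have "d ^ n = 1" using independent_pair_zero(2)[OF ind uv] by fastforce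
  then have "d = 1" using d A(3) power_eq_1_iff[of d n] by auto
  then have "A v = v + c *\<^sub>R u" using cd by simp
  moreover from this have "c *\<^sub>R u = 0"
    by (rule unipotent_finite_order[OF A, rotated]) (simp add: linear_cmul[OF A(1)] Au)
  ultimately have Av: "A v = v" by simp
  show ?thesis
  proof
    fix w assume "w \<in> P"
    then obtain a b where "w = a *\<^sub>R u + b *\<^sub>R v" by (rule plane_coordinates[OF P(2) u(1) v(1) uv ind])
    then show "A w = w" by (simp add: linear_add[OF A(1)] linear_cmul[OF A(1)] Au Av)
  qed
qed

lemma preserves_plane_orientation_id: "preserves_plane_orientation P id"
  unfolding preserves_plane_orientation_def
  by (intro ballI impI exI[of _ 1] exI[of _ 0]) simp

section \<open>Finite groups\<close>

context
  fixes G :: "'g set" and m :: "'g \<Rightarrow> 'g \<Rightarrow> 'g" and e :: 'g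
  assumes fin: "finite G" and unit: "e \<in> G"
    and closed: "\<And>x y. x \<in> G \<Longrightarrow> y \<in> G \<Longrightarrow> m x y \<in> G"
    and assoc: "\<And>x y z. x \<in> G \<Longrightarrow> y \<in> G \<Longrightarrow> z \<in> G \<Longrightarrow> m (m x y) z = m x (m y z)"
    and left_unit: "\<And>x. x \<in> G \<Longrightarrow> m e x = x"
    and left_inverse: "\<And>x. x \<in> G \<Longrightarrow> \<exists>y\<in>G. m y x = e"
begin

private abbreviation "M \<equiv> \<lparr>carrier = G, monoid.mult = m, one = e\<rparr>"

private lemma M: "group M"
  by (rule groupI) (use unit closed assoc left_unit left_inverse in simp_all)

text \<open>Lagrange's theorem for a group given by plain functions, expressed for a homomorphism \<open>\<rho>\<close> into
  self-maps.\<close>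

lemma finite_group_representation_power:
  assumes rep_one: "\<rho> e = id" and rep_mult: "\<And>x y. x \<in> G \<Longrightarrow> y \<in> G \<Longrightarrow> \<rho> (m x y) = \<rho> x \<circ> \<rho> y"
    and k: "k \<in> G"
  shows "\<rho> k ^^ card G = id"
proof -
  interpret group M by (rule M)
  have "\<rho> (k [^]\<^bsub>M\<^esub> n) = \<rho> k ^^ n" for n :: nat
  proof (induction n)
    case (Suc n)
    have "k [^]\<^bsub>M\<^esub> n \<in> G" using nat_pow_closed[of k n] k by simp
    then show ?case using rep_mult k Suc.IH by (simp add: funpow_Suc_right del: funpow.simps)
  qed (simp add: rep_one)
  from this[of "Coset.order M"] show ?thesis using pow_order_eq_1[of k] k rep_one by (simp add: Coset.order_def)
qed

text \<open>A subgroup of order 2 exists by Sylow's theorem; its nontrivial element is the involution.\<close>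

lemma even_group_involution:
  assumes "even (card G)" shows "\<exists>k\<in>G. k \<noteq> e \<and> m k k = e"
proof -
  interpret group M by (rule M)
  obtain n where "Coset.order M = 2 ^ 1 * n" using assms by (auto simp: Coset.order_def)
  then obtain H where H: "subgroup H M" "card H = 2"
    using sylow_thm[OF two_is_prime_nat M, of 1 n] fin by auto
  have "e \<in> H" using subgroup.one_closed[OF H(1)] by simp
  moreover obtain x y where xy: "H = {x, y}" "x \<noteq> y" using H(2) by (auto simp: card_2_iff)
  ultimately obtain k where k: "H = {e, k}" "k \<noteq> e" by auto
  have kG: "k \<in> G" using subgroup.subset[OF H(1)] k(1) by auto
  have "m k k \<in> H" using subgroup.m_closed[OF H(1), of k k] k(1) by simp
  moreover have "m k k \<noteq> k"
    using l_cancel_one[of k k] kG k(2) by simp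
  ultimately show ?thesis using k kG by auto
qed

end

section \<open>Isotropy of positive contact orbifolds\<close>

context contact_orbifold begin

lemma isotropy_card_pos: "x \<in> points (obj S) \<Longrightarrow> card (isotropy S x) > 0"
  using isotropy_finite[OF proper] isotropy_ident card_gt_0_iff by blast

lemma isotropy_power:
  assumes x: "x \<in> points (obj S)" and k: "k \<in> isotropy S x"
  shows "arrow_deriv S k ^^ card (isotropy S x) = id"
proof (rule finite_group_representation_power[where m = "mult S" and e = "ident S x" and \<rho> = "arrow_deriv S"])
  show "finite (isotropy S x)" by (rule isotropy_finite[OF proper x])
  show "ident S x \<in> isotropy S x" by (rule isotropy_ident[OF x])
  show "mult S (mult S a b) c = mult S a (mult S b c)"
    if "a \<in> isotropy S x" "b \<in> isotropy S x" "c \<in> isotropy S x" for a b c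
    by (rule mult_assoc) (use that isotropyD in simp_all)
  show "mult S (ident S x) a = a" if "a \<in> isotropy S x" for a
    using mult_ident_left[OF isotropyD(1)[OF that]] isotropyD(3)[OF that] by simp
  show "\<exists>b\<in>isotropy S x. mult S b a = ident S x" if "a \<in> isotropy S x" for a
    using mult_inv_left[OF isotropyD(1)[OF that]] isotropyD(2)[OF that] isotropy_inv[OF that] by auto
  show "arrow_deriv S (mult S a b) = arrow_deriv S a \<circ> arrow_deriv S b"
    if "a \<in> isotropy S x" "b \<in> isotropy S x" for a b
    by (rule arrow_deriv_mult) (use that isotropyD in simp_all)
qed (use isotropy_mult arrow_deriv_ident[OF x] k in simp_all)

lemma isotropy_involution:
  assumes x: "x \<in> points (obj S)" and ev: "even (card (isotropy S x))"
  shows "\<exists>k\<in>isotropy S x. k \<noteq> ident S x \<and> mult S k k = ident S x"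
proof (rule even_group_involution[where m = "mult S" and e = "ident S x", OF _ _ _ _ _ _ ev])
  show "finite (isotropy S x)" by (rule isotropy_finite[OF proper x])
  show "ident S x \<in> isotropy S x" by (rule isotropy_ident[OF x])
  show "mult S (mult S a b) c = mult S a (mult S b c)"
    if "a \<in> isotropy S x" "b \<in> isotropy S x" "c \<in> isotropy S x" for a b c
    by (rule mult_assoc) (use that isotropyD in simp_all)
  show "mult S (ident S x) a = a" if "a \<in> isotropy S x" for a
    using mult_ident_left[OF isotropyD(1)[OF that]] isotropyD(3)[OF that] by simp
  show "\<exists>b\<in>isotropy S x. mult S b a = ident S x" if "a \<in> isotropy S x" for a
    using mult_inv_left[OF isotropyD(1)[OF that]] isotropyD(2)[OF that] isotropy_inv[OF that] by auto
qed (use isotropy_mult in simp_all)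

lemma isotropy_dist:
  assumes "k \<in> isotropy S x" shows "arrow_deriv S k ` obj_dist S x = obj_dist S x"
  using arrow_deriv_dist[OF isotropyD(1)[OF assms]] isotropyD(2,3)[OF assms] by simp

text \<open>A positive eigenvector makes the differential the identity on the contact plane, then, by
  \<open>isotropy_transverse\<close>, unipotent on the whole tangent space, hence the identity there, and
  \<open>isotropy_faithful\<close> applies.\<close>

lemma positive_eigenvector_trivial:
  assumes eff: "effective S" and x: "x \<in> points (obj S)" and k: "k \<in> isotropy S x"
    and pos: "preserves_plane_orientation (obj_dist S x) (arrow_deriv S k)"
    and u: "u \<in> obj_dist S x" "u \<noteq> 0" "\<mu> > 0" "arrow_deriv S k u = \<mu> *\<^sub>R u"
  shows "k = ident S x"
proof -
  let ?A = "arrow_deriv S k"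
  note A = arrow_deriv_linear[OF isotropyD(1)[OF k]] isotropy_power[OF x k] isotropy_card_pos[OF x]
  have fix_plane: "\<forall>w\<in>obj_dist S x. ?A w = w"
    by (rule orientation_preserving_fixed_plane[OF A obj_dist_plane[OF x] pos u])
  obtain b where b: "b \<notin> obj_dist S x" "?A b - b \<in> obj_dist S x"
    by (rule isotropy_transverse[OF x k bspec[OF fix_plane]])
  have "?A b - b = 0"
    by (rule unipotent_finite_order[OF A, of "?A b - b" b]) (use fix_plane b(2) in simp_all)
  then have Ab: "?A b = b" by simp
  \<comment> \<open>The fixed space contains the contact plane properly, so for dimension reasons it is everything.\<close>
  have sub: "subspace {w. ?A w = w}"
    by (rule subspaceI) (simp_all add: linear_0[OF A(1)] linear_add[OF A(1)] linear_cmul[OF A(1)])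
  have "obj_dist S x \<subset> {w. ?A w = w}" using fix_plane b(1) Ab by blast
  then have "dim (obj_dist S x) < dim {w. ?A w = w}"
    by (intro dim_psubset) (simp only: span_eq_iff[THEN iffD2, OF sub] span_eq_iff[THEN iffD2, OF obj_dist_plane(1)[OF x]])
  moreover have "dim {w. ?A w = w} \<le> DIM(real ^ 3)" by (rule dim_subset_UNIV)
  ultimately have "dim {w. ?A w = w} = DIM(real ^ 3)" using obj_dist_plane(2)[OF x] by simp
  then have "span {w. ?A w = w} = UNIV" by (simp only: dim_eq_full)
  then have "{w. ?A w = w} = UNIV" by (simp only: span_eq_iff[THEN iffD2, OF sub])
  then have "?A = id" by (auto simp: fun_eq_iff)
  then show ?thesis by (rule isotropy_faithful[OF proper eff x k])
qed

text \<open>An orientation-reversing isotropy arrow would have a positive eigenvector in the contact plane, and it is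
  not an identity arrow.\<close>

lemma positiveI:
  assumes "\<And>x k u \<mu>. x \<in> points (obj S) \<Longrightarrow> k \<in> isotropy S x \<Longrightarrow> u \<in> obj_dist S x \<Longrightarrow> u \<noteq> 0 \<Longrightarrow> \<mu> > 0 \<Longrightarrow>
    arrow_deriv S k u = \<mu> *\<^sub>R u \<Longrightarrow> k = ident S x"
  shows "positive_orbifold S"
  unfolding positive_orbifold_def
proof (intro ballI, rule ccontr)
  fix x k assume x: "x \<in> points (obj S)" and k: "k \<in> isotropy S x"
    and rev: "\<not> preserves_plane_orientation (obj_dist S x) (arrow_deriv S k)"
  note k' = isotropyD(1)[OF k]
  obtain u \<mu> where u: "u \<in> obj_dist S x" "u \<noteq> 0" "\<mu> > 0" "arrow_deriv S k u = \<mu> *\<^sub>R u"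
    by (rule orientation_reversing_eigenvector[OF arrow_deriv_linear[OF k'] bij_is_inj[OF arrow_deriv_bij[OF k']]
          obj_dist_plane[OF x] equalityD1[OF isotropy_dist[OF k]] rev])
  have "k = ident S x" by (rule assms[OF x k u])
  then show False using rev preserves_plane_orientation_id[of "obj_dist S x"] by (simp add: arrow_deriv_ident[OF x])
qed

lemma oriented_prolongation_manifold_iff:
  assumes eff: "effective S"
  shows "is_manifold (oriented_cartan_prolongation S) \<longleftrightarrow> positive_orbifold S"
proof
  assume "is_manifold (oriented_cartan_prolongation S)"
  then have free: "\<And>x k. x \<in> points (obj S) \<Longrightarrow> k \<in> isotropy S x \<Longrightarrow>
      \<exists>l\<in>rays (obj_dist S x). arrow_deriv S k ` l = l \<Longrightarrow> k = ident S x"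
    unfolding oriented_cartan_prolongation_def prolongation_is_manifold_iff[OF natural_fibres_rays] by blast
  show "positive_orbifold S"
  proof (rule positiveI)
    fix x k u \<mu> assume x: "x \<in> points (obj S)" and k: "k \<in> isotropy S x"
      and u: "u \<in> obj_dist S x" "u \<noteq> 0" "(\<mu>::real) > 0" "arrow_deriv S k u = \<mu> *\<^sub>R u"
    have "\<exists>l\<in>rays (obj_dist S x). arrow_deriv S k ` l = l"
      unfolding fixed_ray_iff[OF arrow_deriv_linear[OF isotropyD(1)[OF k]]] using u by blast
    then show "k = ident S x" by (rule free[OF x k])
  qed
next
  assume pos: "positive_orbifold S"
  show "is_manifold (oriented_cartan_prolongation S)"
    unfolding oriented_cartan_prolongation_def prolongation_is_manifold_iff[OF natural_fibres_rays]
  proof (intro ballI impI)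
    fix x k assume x: "x \<in> points (obj S)" and k: "k \<in> isotropy S x"
      and "\<exists>l\<in>rays (obj_dist S x). arrow_deriv S k ` l = l"
    then obtain u \<mu> where u: "u \<in> obj_dist S x" "u \<noteq> 0" "\<mu> > 0" "arrow_deriv S k u = \<mu> *\<^sub>R u"
      unfolding fixed_ray_iff[OF arrow_deriv_linear[OF isotropyD(1)[OF k]]] by blast
    have "preserves_plane_orientation (obj_dist S x) (arrow_deriv S k)"
      using pos x k unfolding positive_orbifold_def by blast
    then show "k = ident S x" by (rule positive_eigenvector_trivial[OF eff x k _ u])
  qed
qed

text \<open>An involution fixes the line through \<open>u + A u\<close>, or the line through \<open>u\<close> if that sum vanishes; this excludes
  even order. Conversely a real eigenvalue of an element of odd order is positive, so every fixed line consists of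
  eigenvectors to which \<open>positive_eigenvector_trivial\<close> applies.\<close>

lemma cartan_prolongation_manifold_iff:
  assumes eff: "effective S"
  shows "is_manifold (cartan_prolongation S) \<longleftrightarrow>
    positive_orbifold S \<and> (\<forall>x\<in>points (obj S). odd (card (isotropy S x)))"
proof
  assume "is_manifold (cartan_prolongation S)"
  then have "\<And>x k. x \<in> points (obj S) \<Longrightarrow> k \<in> isotropy S x \<Longrightarrow>
      \<exists>l\<in>lines (obj_dist S x). arrow_deriv S k ` l = l \<Longrightarrow> k = ident S x"
    unfolding cartan_prolongation_def prolongation_is_manifold_iff[OF natural_fibres_lines] by blast
  then have free: "k = ident S x" if "x \<in> points (obj S)" "k \<in> isotropy S x" "u \<in> obj_dist S x" "u \<noteq> 0"
      "arrow_deriv S k u = \<mu> *\<^sub>R u" "\<mu> \<noteq> 0" for x k u \<mu>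
    using eigenvector_fixed_line[OF arrow_deriv_linear[OF isotropyD(1)[OF that(2)]] obj_dist_plane(1)[OF that(1)] that(3-6)]
      that(1,2) by blast
  have "positive_orbifold S" by (rule positiveI) (rule free, assumption+, simp)
  moreover have "odd (card (isotropy S x))" if x: "x \<in> points (obj S)" for x
  proof
    assume "even (card (isotropy S x))"
    then obtain k where k: "k \<in> isotropy S x" "k \<noteq> ident S x" "mult S k k = ident S x"
      using isotropy_involution[OF x] by blast
    let ?A = "arrow_deriv S k"
    note k' = isotropyD[OF k(1)]
    note lin = arrow_deriv_linear[OF k'(1)]
    have "?A \<circ> ?A = id"
      using arrow_deriv_mult[OF k'(1) k'(1)] k' by (simp add: k(3) arrow_deriv_ident[OF x])
    then have AA: "?A (?A v) = v" for v by (metis comp_apply id_apply)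
    have "\<not> obj_dist S x \<subseteq> {0}" using obj_dist_plane(2)[OF x] by (metis dim_eq_0 zero_neq_numeral)
    then obtain u where u: "u \<in> obj_dist S x" "u \<noteq> 0" by blast
    have Au: "?A u \<in> obj_dist S x" using isotropy_dist[OF k(1)] u(1) by blast
    show False
    proof (cases "u + ?A u = 0")
      case True
      then have "?A u = (- 1) *\<^sub>R u" by (simp add: add_eq_0_iff)
      then show False using free[OF x k(1) u, of "- 1"] k(2) by simp
    next
      case False
      have "u + ?A u \<in> obj_dist S x" by (rule subspace_add[OF obj_dist_plane(1)[OF x] u(1) Au])
      moreover have "?A (u + ?A u) = 1 *\<^sub>R (u + ?A u)" by (simp add: linear_add[OF lin] AA add.commute)
      ultimately show False using free[OF x k(1) _ False, of 1] k(2) by simp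
    qed
  qed
  ultimately show "positive_orbifold S \<and> (\<forall>x\<in>points (obj S). odd (card (isotropy S x)))" by blast
next
  assume pos: "positive_orbifold S \<and> (\<forall>x\<in>points (obj S). odd (card (isotropy S x)))"
  show "is_manifold (cartan_prolongation S)"
    unfolding cartan_prolongation_def prolongation_is_manifold_iff[OF natural_fibres_lines]
  proof (intro ballI impI)
    fix x k assume x: "x \<in> points (obj S)" and k: "k \<in> isotropy S x"
      and "\<exists>l\<in>lines (obj_dist S x). arrow_deriv S k ` l = l"
    then obtain l where l: "l \<in> lines (obj_dist S x)" "arrow_deriv S k ` l = l" by blast
    note lin = arrow_deriv_linear[OF isotropyD(1)[OF k]]
    obtain u \<mu> where u: "u \<in> obj_dist S x" "u \<noteq> 0" "arrow_deriv S k u = \<mu> *\<^sub>R u"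
      by (rule fixed_line_eigenvector[OF lin l])
    have "\<mu> ^ card (isotropy S x) = 1" by (rule eigenvalue_finite_order[OF lin isotropy_power[OF x k] u(2,3)])
    then have \<mu>: "\<mu> > 0" using pos x zero_less_power_eq[of \<mu> "card (isotropy S x)"] by auto
    have "preserves_plane_orientation (obj_dist S x) (arrow_deriv S k)"
      using pos x k unfolding positive_orbifold_def by blast
    then show "k = ident S x" by (rule positive_eigenvector_trivial[OF eff x k _ u(1,2) \<mu> u(3)])
  qed
qed

end

theorem theorem3p1:
  fixes S :: "('o, 'a, real ^ 3, real ^ 3) dist_groupoid"
  assumes "contact_3_orbifold S"
    and "effective S"
  shows "(is_manifold (cartan_prolongation S) \<longleftrightarrow>
            positive_orbifold S \<and> (\<forall>x\<in>points (obj S). odd (card (isotropy S x)))) \<and>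
         (is_manifold (oriented_cartan_prolongation S) \<longleftrightarrow> positive_orbifold S)"
proof -
  interpret contact_orbifold S by unfold_locales (rule assms(1))
  show ?thesis
    using cartan_prolongation_manifold_iff[OF assms(2)] oriented_prolongation_manifold_iff[OF assms(2)] by blast
qed

end
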